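(* Let $0<\alpha<1$, $1<p<\infty$, $\alpha>\frac1p$ and $T>0$. Then the equation $\partial_t^\alpha(u-u_0)-\mathrm iAu=f$ on $(0,T)$ satisfies the maximal $L^p$-regularity, that is: for all $u_0\in\mathcal X_{\alpha,p}$ and $f\in L^p(0,T;H)$, the solution of this equation, given by \[ u(t)=\sum_{n=1}^{\infty}\left[\langle u_0,\varphi_n\rangle E_{\alpha,1}(-\mathrm i\lambda_nt^\alpha)+\int_0^t\langle f(s),\varphi_n\rangle (t-s)^{\alpha-1}E_{\alpha,\alpha}\big(-\mathrm i\lambda_n(t-s)^\alpha\big)\,\mathrm ds\right]\varphi_n , \] satisfies $u-u_0\in W_{\alpha,p}(0,T;H)$ and $u\in L^p(0,T;D(A))$, and there exists a constant $C>0$, independent of $u_0$ and $f$, such that \[ \|u-u_0\|_{W_{\alpha,p}(0,T;H)}+\|u\|_{L^p(0,T;D(A))}\le C\left(\|u_0\|_{\mathcal X_{\alpha,p}}+\|f\|_{L^p(0,T;H)}\right). \]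
   Context: $(H,\langle\cdot,\cdot\rangle)$ is a complex Hilbert space with norm $\|\cdot\|$ (inner product linear in the first argument). $A:D(A)\subset H\to H$ is self-adjoint, negative-definite ($\langle Au,u\rangle<0$ for all $u\in D(A)\setminus\{0\}$) and has compact resolvent. $\{\varphi_n\}_{n\in\mathbb N}\subset D(A)$ is an orthonormal basis of $H$ with $A\varphi_n=-\lambda_n\varphi_n$, $0<\lambda_1\le\lambda_2\le\cdots\to\infty$. $D(A)$ carries the norm $\|u\|_{D(A)}=\|Au\|$. $E_{\alpha,\beta}(z)=\sum_{n\ge0}\frac{z^n}{\Gamma(\alpha n+\beta)}$ is the Mittag-Leffler function. For $v\in L^p(0,T;H)$, $J^\alpha v(t)=\frac1{\Gamma(\alpha)}\int_0^t(t-s)^{\alpha-1}v(s)\,\mathrm ds$; $J^\alpha$ is injective on $L^p(0,T;H)$. $W_{\alpha,p}(0,T;H)=J^\alpha L^p(0,T;H)$ with norm $\|v\|_{W_{\alpha,p}(0,T;H)}=\|J^{-\alpha}v\|_{L^p(0,T;H)}$, and $\partial_t^\alpha:=J^{-\alpha}$ with domain $W_{\alpha,p}(0,T;H)$. In $u-u_0$, $u_0$ is regarded as a constant function of $t$. The equation is understood as an identity in $L^p(0,T;H)$. For $\beta>\frac1p$, $\mathcal X_{\beta,p}:=(H,D(A))_{1-\frac1{\beta p},\,p}$, where $(\cdot,\cdot)_{\theta,p}$ is the real interpolation space. *)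

theory Defs
  imports "HOL-Analysis.Analysis"
begin

section \<open>Complex Hilbert spaces and unbounded operators\<close>

text \<open>The inner product is linear in its first argument. Positive definiteness of the inner
  product follows from the last axiom and the axioms for the norm.\<close>

class complex_hilbert = banach +
  fixes scaleC :: "complex \<Rightarrow> 'a \<Rightarrow> 'a"  (infixr \<open>*\<^sub>C\<close> 75)
    and cinner :: "'a \<Rightarrow> 'a \<Rightarrow> complex"
  assumes scaleC_add_right: "a *\<^sub>C (x + y) = a *\<^sub>C x + a *\<^sub>C y"
    and scaleC_add_left: "(a + b) *\<^sub>C x = a *\<^sub>C x + b *\<^sub>C x"
    and scaleC_scaleC: "a *\<^sub>C (b *\<^sub>C x) = (a * b) *\<^sub>C x"
    and scaleR_scaleC: "r *\<^sub>R x = complex_of_real r *\<^sub>C x"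
    and cinner_add_left: "cinner (x + y) z = cinner x z + cinner y z"
    and cinner_scaleC_left: "cinner (a *\<^sub>C x) y = a * cinner x y"
    and cinner_commute: "cinner x y = cnj (cinner y x)"
    and norm_eq_sqrt_cinner: "norm x = sqrt (Re (cinner x x))"

text \<open>An unbounded operator is a domain \<open>D\<close> together with a function \<open>A\<close> whose values
  outside \<open>D\<close> are irrelevant.\<close>

definition linear_operator_on :: "'a::complex_hilbert set \<Rightarrow> ('a \<Rightarrow> 'a) \<Rightarrow> bool" where
  "linear_operator_on D A \<longleftrightarrow>
     0 \<in> D \<and>
     (\<forall>x\<in>D. \<forall>y\<in>D. x + y \<in> D \<and> A (x + y) = A x + A y) \<and>
     (\<forall>c. \<forall>x\<in>D. c *\<^sub>C x \<in> D \<and> A (c *\<^sub>C x) = c *\<^sub>C A x)"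

definition adjoint_graph :: "'a::complex_hilbert set \<Rightarrow> ('a \<Rightarrow> 'a) \<Rightarrow> ('a \<times> 'a) set" where
  "adjoint_graph D A = {(v, w). \<forall>u\<in>D. cinner (A u) v = cinner u w}"

definition selfadjoint :: "'a::complex_hilbert set \<Rightarrow> ('a \<Rightarrow> 'a) \<Rightarrow> bool" where
  "selfadjoint D A \<longleftrightarrow>
     linear_operator_on D A \<and> closure D = UNIV \<and> adjoint_graph D A = (\<lambda>u. (u, A u)) ` D"

definition negative_definite :: "'a::complex_hilbert set \<Rightarrow> ('a \<Rightarrow> 'a) \<Rightarrow> bool" where
  "negative_definite D A \<longleftrightarrow>
     (\<forall>u\<in>D - {0}. Im (cinner (A u) u) = 0 \<and> Re (cinner (A u) u) < 0)"

definition resolvent :: "'a::complex_hilbert set \<Rightarrow> ('a \<Rightarrow> 'a) \<Rightarrow> complex \<Rightarrow> 'a \<Rightarrow> 'a" where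
  "resolvent D A z = inv_into D (\<lambda>u. z *\<^sub>C u - A u)"

definition resolvent_set :: "'a::complex_hilbert set \<Rightarrow> ('a \<Rightarrow> 'a) \<Rightarrow> complex set" where
  "resolvent_set D A =
     {z. bij_betw (\<lambda>u. z *\<^sub>C u - A u) D UNIV \<and> bounded_linear (resolvent D A z)}"

definition compact_resolvent :: "'a::complex_hilbert set \<Rightarrow> ('a \<Rightarrow> 'a) \<Rightarrow> bool" where
  "compact_resolvent D A \<longleftrightarrow>
     (\<exists>z\<in>resolvent_set D A. \<forall>B. bounded B \<longrightarrow> compact (closure (resolvent D A z ` B)))"

text \<open>Basis elements are indexed from 0, so \<open>\<phi> n\<close> is the basis vector written with subscript
  \<open>n + 1\<close> on paper; the same shift applies to the eigenvalues.\<close>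

definition orthonormal_basis :: "(nat \<Rightarrow> 'a::complex_hilbert) \<Rightarrow> bool" where
  "orthonormal_basis \<phi> \<longleftrightarrow>
     (\<forall>m n. cinner (\<phi> m) (\<phi> n) = (if m = n then 1 else 0)) \<and>
     closure {\<Sum>k<n. c k *\<^sub>C \<phi> k | n c. True} = UNIV"


section \<open>Function spaces\<close>

text \<open>Elements of the Lebesgue spaces are represented by functions on the reals of which only the
  restriction to \<open>(0,T)\<close> matters; identities between them are identities almost everywhere.
  Strong measurability is Borel measurability because \<open>H\<close> is separable.\<close>

definition Lp_set ::
  "real \<Rightarrow> real \<Rightarrow> (real \<Rightarrow> 'a::{complex_hilbert, second_countable_topology}) set" where
  "Lp_set p T = {v. v \<in> borel_measurable (lebesgue_on {0<..<T}) \<and>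
                    integrable (lebesgue_on {0<..<T}) (\<lambda>t. norm (v t) powr p)}"

definition Lp_norm :: "real \<Rightarrow> real \<Rightarrow> (real \<Rightarrow> 'a::complex_hilbert) \<Rightarrow> real" where
  "Lp_norm p T v = (LINT t|lebesgue_on {0<..<T}. norm (v t) powr p) powr (1 / p)"

text \<open>\<open>D(A)\<close> carries the norm \<open>\<parallel>A u\<parallel>\<close>, so that \<open>A\<close> is an isometry from \<open>D(A)\<close> into \<open>H\<close>.
  Hence \<open>u\<close> is strongly measurable with values in \<open>D(A)\<close> iff \<open>A u\<close> is strongly measurable with
  values in \<open>H\<close>; values of \<open>u\<close> outside \<open>D(A)\<close> on a null set do no harm since the Lebesgue measure
  is complete.\<close>

definition Lp_dom_set ::
  "real \<Rightarrow> real \<Rightarrow> 'a::{complex_hilbert, second_countable_topology} set \<Rightarrow> ('a \<Rightarrow> 'a)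
     \<Rightarrow> (real \<Rightarrow> 'a) set" where
  "Lp_dom_set p T D A = {u. u \<in> borel_measurable (lebesgue_on {0<..<T}) \<and>
                            (AE t in lebesgue_on {0<..<T}. u t \<in> D) \<and>
                            (\<lambda>t. A (u t)) \<in> Lp_set p T}"

definition Lp_dom_norm ::
  "real \<Rightarrow> real \<Rightarrow> ('a::complex_hilbert \<Rightarrow> 'a) \<Rightarrow> (real \<Rightarrow> 'a) \<Rightarrow> real" where
  "Lp_dom_norm p T A u = Lp_norm p T (\<lambda>t. A (u t))"

definition frac_integral ::
  "real \<Rightarrow> (real \<Rightarrow> 'a::{complex_hilbert, second_countable_topology}) \<Rightarrow> real \<Rightarrow> 'a" where
  "frac_integral \<alpha> v t =
     (1 / Gamma \<alpha>) *\<^sub>R (LINT s|lebesgue_on {0<..<t}. (t - s) powr (\<alpha> - 1) *\<^sub>R v s)"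

definition W_set ::
  "real \<Rightarrow> real \<Rightarrow> real \<Rightarrow> (real \<Rightarrow> 'a::{complex_hilbert, second_countable_topology}) set" where
  "W_set \<alpha> p T =
     {v. \<exists>g\<in>Lp_set p T. AE t in lebesgue_on {0<..<T}. v t = frac_integral \<alpha> g t}"

text \<open>The inverse of the fractional integral. By injectivity of the latter, the choice is
  unique up to equality almost everywhere.\<close>

definition frac_deriv ::
  "real \<Rightarrow> real \<Rightarrow> real \<Rightarrow> (real \<Rightarrow> 'a::{complex_hilbert, second_countable_topology})
     \<Rightarrow> real \<Rightarrow> 'a" where
  "frac_deriv \<alpha> p T v =
     (SOME g. g \<in> Lp_set p T \<and> (AE t in lebesgue_on {0<..<T}. v t = frac_integral \<alpha> g t))"

definition W_norm ::
  "real \<Rightarrow> real \<Rightarrow> real \<Rightarrow> (real \<Rightarrow> 'a::{complex_hilbert, second_countable_topology}) \<Rightarrow> real"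
  where
  "W_norm \<alpha> p T v = Lp_norm p T (frac_deriv \<alpha> p T v)"


section \<open>Real interpolation by the K-method\<close>

text \<open>The interpolation couple is \<open>(H, Y)\<close> with a subspace \<open>Y\<close> of \<open>H\<close> normed by \<open>N\<close>.\<close>

definition K_functional ::
  "'a::complex_hilbert set \<Rightarrow> ('a \<Rightarrow> real) \<Rightarrow> real \<Rightarrow> 'a \<Rightarrow> real" where
  "K_functional Y N t x = Inf {norm a + t * N b | a b. b \<in> Y \<and> x = a + b}"

definition interp_set ::
  "'a::complex_hilbert set \<Rightarrow> ('a \<Rightarrow> real) \<Rightarrow> real \<Rightarrow> real \<Rightarrow> 'a set" where
  "interp_set Y N \<theta> p =
     {x. integrable (lebesgue_on {0<..}) (\<lambda>t. (t powr (-\<theta>) * K_functional Y N t x) powr p / t)}"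

definition interp_norm ::
  "'a::complex_hilbert set \<Rightarrow> ('a \<Rightarrow> real) \<Rightarrow> real \<Rightarrow> real \<Rightarrow> 'a \<Rightarrow> real" where
  "interp_norm Y N \<theta> p x =
     (LINT t|lebesgue_on {0<..}. (t powr (-\<theta>) * K_functional Y N t x) powr p / t) powr (1 / p)"

definition X_set ::
  "'a::complex_hilbert set \<Rightarrow> ('a \<Rightarrow> 'a) \<Rightarrow> real \<Rightarrow> real \<Rightarrow> 'a set" where
  "X_set D A \<beta> p = interp_set D (\<lambda>u. norm (A u)) (1 - 1 / (\<beta> * p)) p"

definition X_norm ::
  "'a::complex_hilbert set \<Rightarrow> ('a \<Rightarrow> 'a) \<Rightarrow> real \<Rightarrow> real \<Rightarrow> 'a \<Rightarrow> real" where
  "X_norm D A \<beta> p = interp_norm D (\<lambda>u. norm (A u)) (1 - 1 / (\<beta> * p)) p"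


section \<open>The fractional equation\<close>

definition mittag_leffler :: "real \<Rightarrow> real \<Rightarrow> complex \<Rightarrow> complex" where
  "mittag_leffler \<alpha> \<beta> z = (\<Sum>n. z ^ n / complex_of_real (Gamma (\<alpha> * real n + \<beta>)))"

definition is_solution ::
  "'a::{complex_hilbert, second_countable_topology} set \<Rightarrow> ('a \<Rightarrow> 'a) \<Rightarrow> real \<Rightarrow> real \<Rightarrow> real
     \<Rightarrow> 'a \<Rightarrow> (real \<Rightarrow> 'a) \<Rightarrow> (real \<Rightarrow> 'a) \<Rightarrow> bool" where
  "is_solution D A \<alpha> p T u\<^sub>0 f u \<longleftrightarrow>
     (\<lambda>t. u t - u\<^sub>0) \<in> W_set \<alpha> p T \<and>
     u \<in> Lp_dom_set p T D A \<and>
     (AE t in lebesgue_on {0<..<T}.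
        frac_deriv \<alpha> p T (\<lambda>t. u t - u\<^sub>0) t - \<i> *\<^sub>C A (u t) = f t)"

definition solution_coeff ::
  "(nat \<Rightarrow> 'a::complex_hilbert) \<Rightarrow> (nat \<Rightarrow> real) \<Rightarrow> real \<Rightarrow> 'a \<Rightarrow> (real \<Rightarrow> 'a)
     \<Rightarrow> nat \<Rightarrow> real \<Rightarrow> complex" where
  "solution_coeff \<phi> lam \<alpha> u\<^sub>0 f n t =
     cinner u\<^sub>0 (\<phi> n) * mittag_leffler \<alpha> 1 (- \<i> * of_real (lam n * t powr \<alpha>)) +
     (LINT s|lebesgue_on {0<..<t}.
        cinner (f s) (\<phi> n) * of_real ((t - s) powr (\<alpha> - 1)) *
        mittag_leffler \<alpha> \<alpha> (- \<i> * of_real (lam n * (t - s) powr \<alpha>)))"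

definition solution_series ::
  "(nat \<Rightarrow> 'a::complex_hilbert) \<Rightarrow> (nat \<Rightarrow> real) \<Rightarrow> real \<Rightarrow> 'a \<Rightarrow> (real \<Rightarrow> 'a)
     \<Rightarrow> real \<Rightarrow> 'a" where
  "solution_series \<phi> lam \<alpha> u\<^sub>0 f t = (\<Sum>n. solution_coeff \<phi> lam \<alpha> u\<^sub>0 f n t *\<^sub>C \<phi> n)"

end

theory Submission
  imports Defs "HOL-Complex_Analysis.Complex_Analysis"
begin

text \<open>In the eigenbasis the problem decouples into scalar Volterra equations
  \<open>u\<^sub>n - c\<^sub>n = J\<^sup>\<alpha>(- i \<lambda>\<^sub>n u\<^sub>n + f\<^sub>n)\<close>, and the point is to bound \<open>(\<Sum>n. \<bar>\<lambda>\<^sub>n u\<^sub>n\<bar>\<^sup>2)\<^sup>1\<^sup>/\<^sup>2\<close> in \<open>L\<^sup>p\<close>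
  uniformly in the number of modes. Since \<open>\<alpha> < 1\<close>, the ray \<open>- i [0,\<infinity>)\<close> lies in the decay sector of the
  Mittag-Leffler functions, so a Hankel contour gives \<open>\<bar>E\<^bsub>\<alpha>,\<alpha>\<^esub>(- i x)\<bar> \<le> C / (1 + x\<^sup>2)\<close> and
  \<open>\<bar>E\<^bsub>\<alpha>,1\<^esub>(- i x)\<bar> \<le> C / (1 + x)\<close>. The first bound shows that the convolution kernels
  \<open>\<lambda>\<^sub>n t\<^sup>\<alpha>\<^sup>-\<^sup>1 E\<^bsub>\<alpha>,\<alpha>\<^esub>(- i \<lambda>\<^sub>n t\<^sup>\<alpha>)\<close> have even, radially decreasing majorants whose masses do not depend
  on \<open>n\<close>. They are therefore dominated by the Hardy--Littlewood maximal function, and a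
  Fefferman--Stein type duality argument bounds the source term for every \<open>p\<close>. The second bound
  compares the contribution of the initial value at time \<open>t\<close> with \<open>t\<^sup>-\<^sup>\<alpha> K(t\<^sup>\<alpha>, u\<^sub>0)\<close>, and the
  substitution \<open>\<tau> = t\<^sup>\<alpha>\<close> turns its \<open>L\<^sup>p\<close> norm into the interpolation norm.\<close>

section \<open>The Hardy--Littlewood maximal function\<close>

text \<open>The bound for \<open>lam n * norm (ker n t)\<close> that is uniform in n is only of
  order 1/t, so the operator-valued kernel is not controlled by an integrable function, although
  every single mode has an integrable kernel of uniformly bounded mass. Hence Young's inequality
  cannot be applied in H. The modes are kept apart instead: for each one the square of a convolution
  is estimated against a common weight, and this survives summation over n without loss. The decay
  1/x^2 has its origin in 1/\<Gamma>(0) = 0. It gives E_{\<alpha>,0}(z) = z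
  E_{\<alpha>,\<alpha>}(z), so the general contour bound C/x, taken at parameter 0, gains one more
  power. For this reason Hankel's formula is carried down to \<beta> = 0. The condition \<alpha> >
  1/p places t^{\<alpha>-1} locally in the Lebesgue space dual to L^p. Fractional integrals, and the
  convergence of the solution series, are therefore available at every t and not just at almost
  every t. All estimates concern the first N modes, with constants free of N; the passage to H is by
  monotone convergence.\<close>

lemma nn_integral_powr_from_0:
  fixes a c :: real
  assumes "0 < a" "0 \<le> c"
  shows "(\<integral>\<^sup>+s. ennreal (s powr (a - 1)) * indicator {0<..<c} s \<partial>lborel) = ennreal (c powr a / a)"
proof -
  have "((\<lambda>s. s powr (a - 1)) has_integral (c powr (a - 1 + 1) / (a - 1 + 1))) {0..c}"
    using assms by (intro has_integral_powr_from_0) auto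
  then have "((\<lambda>s. s powr (a - 1)) has_integral (c powr a / a)) {0<..<c}"
    by (simp add: has_integral_Icc_iff_Ioo)
  then have "(\<integral>\<^sup>+s. ennreal (indicator {0<..<c} s * s powr (a - 1)) \<partial>lborel) = ennreal (c powr a / a)"
    by (intro nn_integral_has_integral_lebesgue) auto
  then show ?thesis
    by (subst (asm) nn_integral_cong[where v="\<lambda>s. ennreal (s powr (a - 1)) * indicator {0<..<c} s"])
      (auto simp: indicator_def)
qed

lemma borel_measurable_mult_indicator_ball:
  fixes w :: "real \<Rightarrow> ennreal"
  assumes "w \<in> borel_measurable borel"
  shows "(\<lambda>y. w y * indicator (ball c r) y) \<in> borel_measurable borel"
  using assms by (intro borel_measurable_times_ennreal borel_measurable_indicator) auto

text \<open>This is the uncentred maximal function: the ball need not be centred at x. Its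
  superlevel sets are then unions of open balls, which gives Borel measurability for every
  \<open>w\<close> and directly supplies the covering used in the weak type bound.\<close>

definition maxfun :: "(real \<Rightarrow> ennreal) \<Rightarrow> real \<Rightarrow> ennreal" where
  "maxfun w x = (SUP (c, r)\<in>{(c, r). 0 < r \<and> x \<in> ball c r}.
     (\<integral>\<^sup>+y. w y * indicator (ball c r) y \<partial>lborel) / ennreal (2 * r))"

lemma maxfun_level:
  "{x. s < maxfun w x} =
     (\<Union>(c, r)\<in>{(c, r). 0 < r \<and> s < (\<integral>\<^sup>+y. w y * indicator (ball c r) y \<partial>lborel) / ennreal (2 * r)}.
       ball c r)"
  unfolding maxfun_def less_SUP_iff by (auto split: prod.splits) (metis mem_ball)+

lemma open_maxfun_level: "open {x. s < maxfun w x}"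
  unfolding maxfun_level by auto

lemma borel_measurable_maxfun [measurable]: "maxfun w \<in> borel_measurable borel"
  by (rule borel_measurableI_greater) (use open_maxfun_level in \<open>auto simp: borel_open\<close>)

lemma ball_integral_le_maxfun:
  assumes "0 < r" "x \<in> ball c r"
  shows "(\<integral>\<^sup>+y. w y * indicator (ball c r) y \<partial>lborel) \<le> ennreal (2 * r) * maxfun w x"
proof -
  let ?I = "(\<integral>\<^sup>+y. w y * indicator (ball c r) y \<partial>lborel)"
  have "?I / ennreal (2 * r) \<le> maxfun w x"
    unfolding maxfun_def using assms by (intro SUP_upper2[of "(c, r)"]) auto
  then have "?I / ennreal (2 * r) * ennreal (2 * r) \<le> maxfun w x * ennreal (2 * r)"
    by (rule mult_right_mono) auto
  moreover have "?I / ennreal (2 * r) * ennreal (2 * r) = ?I"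
    using assms by (simp add: ennreal_divide_times mult_divide_eq_ennreal)
  ultimately show ?thesis by (simp add: mult.commute)
qed

lemma maxfun_mono:
  assumes "\<And>x. w x \<le> v x"
  shows "maxfun w x \<le> maxfun v x"
  unfolding maxfun_def
  by (rule SUP_mono) (force intro!: divide_right_mono_ennreal nn_integral_mono mult_right_mono assms)

lemma maxfun_le_bound:
  assumes "\<And>x. w x \<le> ennreal B"
  shows "maxfun w x \<le> ennreal B"
  unfolding maxfun_def
proof (rule SUP_least, clarify)
  fix c r :: real assume r: "0 < r" "x \<in> ball c r"
  have "(\<integral>\<^sup>+y. w y * indicator (ball c r) y \<partial>lborel)
      \<le> (\<integral>\<^sup>+y. ennreal B * indicator (ball c r) y \<partial>lborel)"
    by (intro nn_integral_mono mult_right_mono assms) auto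
  also have "\<dots> = ennreal B * ennreal (2 * r)"
    using r by (simp add: nn_integral_cmult_indicator ball_eq_greaterThanLessThan)
  finally have "(\<integral>\<^sup>+y. w y * indicator (ball c r) y \<partial>lborel) / ennreal (2 * r)
      \<le> ennreal B * ennreal (2 * r) / ennreal (2 * r)"
    by (rule divide_right_mono_ennreal)
  also have "\<dots> = ennreal B"
    using r by (simp add: mult_divide_eq_ennreal)
  finally show "(\<integral>\<^sup>+y. w y * indicator (ball c r) y \<partial>lborel) / ennreal (2 * r) \<le> ennreal B" .
qed

lemma maxfun_add_const:
  assumes [measurable]: "w \<in> borel_measurable borel"
  shows "maxfun (\<lambda>x. w x + ennreal b) x \<le> maxfun w x + ennreal b"
  unfolding maxfun_def[of "\<lambda>x. w x + ennreal b"]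
proof (rule SUP_least, clarify)
  fix c r :: real assume r: "0 < r" "x \<in> ball c r"
  have "(\<integral>\<^sup>+y. (w y + ennreal b) * indicator (ball c r) y \<partial>lborel)
      = (\<integral>\<^sup>+y. w y * indicator (ball c r) y \<partial>lborel) + ennreal b * ennreal (2 * r)"
    using r by (simp add: distrib_right nn_integral_add nn_integral_cmult_indicator
        ball_eq_greaterThanLessThan)
  also have "\<dots> \<le> ennreal (2 * r) * maxfun w x + ennreal b * ennreal (2 * r)"
    by (intro add_right_mono ball_integral_le_maxfun r)
  also have "\<dots> = (maxfun w x + ennreal b) * ennreal (2 * r)"
    by (simp add: algebra_simps)
  finally have "(\<integral>\<^sup>+y. (w y + ennreal b) * indicator (ball c r) y \<partial>lborel) / ennreal (2 * r)
      \<le> (maxfun w x + ennreal b) * ennreal (2 * r) / ennreal (2 * r)"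
    by (rule divide_right_mono_ennreal)
  also have "\<dots> = maxfun w x + ennreal b"
    using r by (simp add: mult_divide_eq_ennreal)
  finally show "(\<integral>\<^sup>+y. (w y + ennreal b) * indicator (ball c r) y \<partial>lborel) / ennreal (2 * r)
      \<le> maxfun w x + ennreal b" .
qed

text \<open>Vitali's covering lemma: the balls with average above s cover the level set, and a
  disjoint subfamily, dilated by 5, still does. The constant 5 is the ratio of lengths.\<close>

lemma maxfun_weak_type:
  fixes w :: "real \<Rightarrow> ennreal" and s :: real
  assumes [measurable]: "w \<in> borel_measurable borel" and s: "0 < s"
  shows "ennreal s * emeasure lborel {x. ennreal s < maxfun w x} \<le> 5 * (\<integral>\<^sup>+y. w y \<partial>lborel)"
proof (cases "(\<integral>\<^sup>+y. w y \<partial>lborel) = \<infinity>")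
  case True then show ?thesis by (simp add: ennreal_mult_top)
next
  case False
  define I where "I c r = (\<integral>\<^sup>+y. w y * indicator (ball c r) y \<partial>lborel)" for c r
  define W where "W = enn2real (\<integral>\<^sup>+y. w y \<partial>lborel)"
  have W: "(\<integral>\<^sup>+y. w y \<partial>lborel) = ennreal W"
    unfolding W_def using False by (simp add: less_top)
  have W0: "0 \<le> W" by (simp add: W_def)
  define K where "K = {(c, r). 0 < r \<and> ennreal s < I c r / ennreal (2 * r)}"
  have Kbig: "ennreal (s * (2 * r)) \<le> I c r" if "(c, r) \<in> K" for c r
  proof -
    have r: "0 < r" "ennreal s \<le> I c r / ennreal (2 * r)" using that by (auto simp: K_def)
    have "ennreal s * ennreal (2 * r) \<le> I c r / ennreal (2 * r) * ennreal (2 * r)"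
      by (intro mult_right_mono r) auto
    also have "\<dots> = I c r"
      using r by (simp add: ennreal_divide_times mult_divide_eq_ennreal)
    finally show ?thesis using s r by (simp add: ennreal_mult')
  qed
  \<comment> \<open>Finiteness of the total integral enters here: it bounds the radii, as the
    covering lemma requires.\<close>
  have Kr: "0 < snd i \<and> snd i \<le> W / s" if "i \<in> K" for i
  proof -
    obtain c r where i: "i = (c, r)" by (cases i)
    have r: "0 < r" using that by (auto simp: i K_def)
    have "ennreal (s * (2 * r)) \<le> I c r" using Kbig that i by auto
    also have "\<dots> \<le> (\<integral>\<^sup>+y. w y \<partial>lborel)"
      unfolding I_def by (intro nn_integral_mono) (auto simp: indicator_def)
    finally have "s * (2 * r) \<le> W" using W W0 by simp
    moreover have "0 < s * r" using s r by simp
    ultimately have "s * r \<le> W" by simp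
    then show ?thesis using s r i by (simp add: field_simps)
  qed
  have level: "{x. ennreal s < maxfun w x} = (\<Union>i\<in>K. ball (fst i) (snd i))"
    unfolding maxfun_level K_def I_def by auto
  obtain C where C: "countable C" "C \<subseteq> K"
      "pairwise (\<lambda>i j. disjnt (ball (fst i) (snd i)) (ball (fst j) (snd j))) C"
      and sub: "{x. ennreal s < maxfun w x} \<subseteq> (\<Union>i\<in>C. ball (fst i) (5 * snd i))"
    by (rule Vitali_covering_lemma_balls[OF equalityD1[OF level] Kr])
  \<comment> \<open>Sums over the countable family \<open>C\<close> are integrals against
    \<open>count_space C\<close>, so that interchanging them with Lebesgue integrals is an instance
    of Tonelli's theorem.\<close>
  have meas: "emeasure lborel {x. ennreal s < maxfun w x}
      \<le> (\<integral>\<^sup>+i. emeasure lborel (ball (fst i) (5 * snd i)) \<partial>count_space C)"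
  proof -
    have "emeasure lborel {x. ennreal s < maxfun w x}
        = (\<integral>\<^sup>+x. indicator {x. ennreal s < maxfun w x} x \<partial>lborel)"
      by (intro nn_integral_indicator[symmetric]) (auto intro: borel_open open_maxfun_level)
    also have "\<dots> \<le> (\<integral>\<^sup>+x. (\<integral>\<^sup>+i. indicator (ball (fst i) (5 * snd i)) x \<partial>count_space C) \<partial>lborel)"
    proof (intro nn_integral_mono)
      fix x :: real
      show "indicator {x. ennreal s < maxfun w x} x
          \<le> (\<integral>\<^sup>+i. indicator (ball (fst i) (5 * snd i)) x \<partial>count_space C)"
      proof (cases "x \<in> {x. ennreal s < maxfun w x}")
        case True
        then obtain i where i: "i \<in> C" "x \<in> ball (fst i) (5 * snd i)" using sub by blast
        have "(1::ennreal) = indicator (ball (fst i) (5 * snd i)) x" using i by simp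
        also have "\<dots> \<le> (\<integral>\<^sup>+i. indicator (ball (fst i) (5 * snd i)) x \<partial>count_space C)"
          by (rule nn_integral_ge_point) (rule i)
        finally show ?thesis using True by simp
      qed simp
    qed
    also have "\<dots> = (\<integral>\<^sup>+i. (\<integral>\<^sup>+x. indicator (ball (fst i) (5 * snd i)) x \<partial>lborel) \<partial>count_space C)"
      using C(1) by (intro nn_integral_count_space_nn_integral borel_measurable_indicator) auto
    finally show ?thesis by simp
  qed
  have "ennreal s * emeasure lborel {x. ennreal s < maxfun w x}
      \<le> ennreal s * (\<integral>\<^sup>+i. emeasure lborel (ball (fst i) (5 * snd i)) \<partial>count_space C)"
    by (intro mult_left_mono meas) auto
  also have "\<dots> = (\<integral>\<^sup>+i. ennreal s * emeasure lborel (ball (fst i) (5 * snd i)) \<partial>count_space C)"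
    by (simp add: nn_integral_cmult)
  also have "\<dots> \<le> (\<integral>\<^sup>+i. 5 * (\<integral>\<^sup>+y. w y * indicator (ball (fst i) (snd i)) y \<partial>lborel) \<partial>count_space C)"
  proof (intro nn_integral_mono)
    fix i assume "i \<in> space (count_space C)"
    then have iK: "(fst i, snd i) \<in> K" using C by auto
    then have r: "0 < snd i" using Kr by fastforce
    have "ennreal s * emeasure lborel (ball (fst i) (5 * snd i)) = 5 * ennreal (s * (2 * snd i))"
      using r s by (simp add: ball_eq_greaterThanLessThan ennreal_mult'[symmetric]
          ennreal_numeral[symmetric] del: ennreal_numeral)
    also have "\<dots> \<le> 5 * I (fst i) (snd i)"
      by (intro mult_left_mono Kbig iK) auto
    finally show "ennreal s * emeasure lborel (ball (fst i) (5 * snd i))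
        \<le> 5 * (\<integral>\<^sup>+y. w y * indicator (ball (fst i) (snd i)) y \<partial>lborel)"
      by (simp add: I_def)
  qed
  also have "\<dots> = 5 * (\<integral>\<^sup>+i. (\<integral>\<^sup>+y. w y * indicator (ball (fst i) (snd i)) y \<partial>lborel) \<partial>count_space C)"
    by (simp add: nn_integral_cmult)
  also have "\<dots> = 5 * (\<integral>\<^sup>+y. (\<integral>\<^sup>+i. w y * indicator (ball (fst i) (snd i)) y \<partial>count_space C) \<partial>lborel)"
    using C(1) by (subst nn_integral_count_space_nn_integral)
      (auto intro!: borel_measurable_mult_indicator_ball)
  also have "\<dots> \<le> 5 * (\<integral>\<^sup>+y. w y \<partial>lborel)"
  proof (intro mult_left_mono nn_integral_mono)
    fix y :: real
    show "(\<integral>\<^sup>+i. w y * indicator (ball (fst i) (snd i)) y \<partial>count_space C) \<le> w y"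
    proof (cases "\<exists>i\<in>C. y \<in> ball (fst i) (snd i)")
      case True
      then obtain i where i: "i \<in> C" "y \<in> ball (fst i) (snd i)" by blast
      have only: "j = i" if "j \<in> C" "y \<in> ball (fst j) (snd j)" for j
      proof (rule ccontr)
        assume "j \<noteq> i"
        then have "disjnt (ball (fst j) (snd j)) (ball (fst i) (snd i))"
          by (rule pairwiseD[OF C(3) that(1) i(1)])
        then show False using i(2) that(2) by (auto simp: disjnt_iff simp del: mem_ball)
      qed
      have "(\<integral>\<^sup>+j. w y * indicator (ball (fst j) (snd j)) y \<partial>count_space C)
          \<le> (\<integral>\<^sup>+j. w y * indicator {i} j \<partial>count_space C)"
      proof (intro nn_integral_mono)
        fix j assume "j \<in> space (count_space C)"
        then show "w y * indicator (ball (fst j) (snd j)) y \<le> w y * indicator {i} j"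
          using only[of j] by (cases "y \<in> ball (fst j) (snd j)") (simp_all del: mem_ball)
      qed
      also have "\<dots> = w y * emeasure (count_space C) {i}"
        using i by (intro nn_integral_cmult_indicator) auto
      also have "\<dots> = w y" using i by simp
      finally show ?thesis .
    next
      case False
      then have "(\<integral>\<^sup>+i. w y * indicator (ball (fst i) (snd i)) y \<partial>count_space C)
          = (\<integral>\<^sup>+i. 0 \<partial>count_space C)"
        by (intro nn_integral_cong) (auto simp: indicator_def)
      then show ?thesis by simp
    qed
  qed auto
  finally show ?thesis .
qed

text \<open>Marcinkiewicz interpolation: the layer-cake formula, with \<open>w\<close> cut at half
  of each level before the weak type bound is applied. Boundedness of \<open>w\<close> makes
  \<open>maxfun w\<close> finite, so that \<open>enn2real\<close> loses nothing.\<close>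

lemma maxfun_strong_type:
  fixes w :: "real \<Rightarrow> real" and q :: real
  assumes q: "1 < q" and [measurable]: "w \<in> borel_measurable borel"
    and w: "\<And>x. 0 \<le> w x" "\<And>x. w x \<le> B"
  shows "(\<integral>\<^sup>+x. ennreal (enn2real (maxfun w x) powr q) \<partial>lborel)
     \<le> ennreal (10 * q * 2 powr (q - 1) / (q - 1)) * (\<integral>\<^sup>+x. ennreal (w x powr q) \<partial>lborel)"
proof -
  define m where "m x = enn2real (maxfun w x)" for x
  have [measurable]: "m \<in> borel_measurable borel" unfolding m_def by measurable
  have fin: "maxfun w x < \<infinity>" for x
    using maxfun_le_bound[of w B x] w by (simp add: ennreal_leI le_less_trans)
  have m: "maxfun w x = ennreal (m x)" "0 \<le> m x" for x
    unfolding m_def using fin[of x] by (auto simp: less_top)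
  \<comment> \<open>As w \<le> v + s/2, the set where \<open>maxfun w\<close> exceeds s lies in the
    set where \<open>maxfun v\<close> exceeds s/2. The factor 10/s is 5 divided by s/2.\<close>
  have level: "emeasure lborel {x. s < m x}
      \<le> ennreal (10 / s) * (\<integral>\<^sup>+y. ennreal (w y) * indicator {y. s < 2 * w y} y \<partial>lborel)"
    if s: "0 < s" for s
  proof -
    define v where "v y = ennreal (w y) * indicator {y. s < 2 * w y} y" for y
    have [measurable]: "v \<in> borel_measurable borel" unfolding v_def by measurable
    have "{x. s < m x} \<subseteq> {x. ennreal (s / 2) < maxfun v x}"
    proof clarify
      fix x assume x: "s < m x"
      have "ennreal s < maxfun w x" using x s m by (simp add: ennreal_lessI)
      also have "\<dots> \<le> maxfun (\<lambda>x. v x + ennreal (s / 2)) x"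
        by (rule maxfun_mono) (auto simp: v_def indicator_def ennreal_leI)
      also have "\<dots> \<le> maxfun v x + ennreal (s / 2)" by (rule maxfun_add_const) measurable
      finally have "ennreal (s / 2) + ennreal (s / 2) < maxfun v x + ennreal (s / 2)"
        using s by (simp add: ennreal_plus[symmetric] del: ennreal_plus)
      then show "ennreal (s / 2) < maxfun v x"
        by (meson add_right_mono leD leI)
    qed
    then have "ennreal (s / 2) * emeasure lborel {x. s < m x}
        \<le> ennreal (s / 2) * emeasure lborel {x. ennreal (s / 2) < maxfun v x}"
      by (intro mult_left_mono emeasure_mono) (auto intro: borel_open open_maxfun_level)
    also have "\<dots> \<le> 5 * (\<integral>\<^sup>+y. v y \<partial>lborel)"
      using s by (intro maxfun_weak_type) auto
    finally have "ennreal (2 / s) * (ennreal (s / 2) * emeasure lborel {x. s < m x})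
        \<le> ennreal (2 / s) * (5 * (\<integral>\<^sup>+y. v y \<partial>lborel))"
      by (rule mult_left_mono) auto
    moreover have "ennreal (2 / s) * ennreal (s / 2) = 1" 
      using s by (simp add: ennreal_mult'[symmetric])
    moreover have "ennreal (2 / s) * 5 = ennreal (10 / s)"
      using s by (simp add: ennreal_mult'[symmetric] ennreal_numeral[symmetric] del: ennreal_numeral)
    ultimately show ?thesis
      by (simp add: v_def mult.assoc[symmetric])
  qed
  have "(\<integral>\<^sup>+x. ennreal (m x powr q) \<partial>lborel)
      = (\<integral>\<^sup>+x. (\<integral>\<^sup>+s. ennreal q * (ennreal (s powr (q - 1)) * indicator {0<..<m x} s) \<partial>lborel) \<partial>lborel)"
    using q m by (intro nn_integral_cong)
      (simp add: nn_integral_cmult nn_integral_powr_from_0 ennreal_mult'[symmetric])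
  also have "\<dots> = (\<integral>\<^sup>+s. (\<integral>\<^sup>+x. ennreal q * (ennreal (s powr (q - 1)) * indicator {0<..<m x} s) \<partial>lborel) \<partial>lborel)"
    unfolding indicator_def greaterThanLessThan_iff by (rule lborel_pair.Fubini') measurable
  also have "\<dots> = (\<integral>\<^sup>+s. ennreal (q * s powr (q - 1)) * indicator {0<..} s * emeasure lborel {x. s < m x} \<partial>lborel)"
  proof (rule nn_integral_cong)
    fix s :: real
    have "(\<integral>\<^sup>+x. ennreal q * (ennreal (s powr (q - 1)) * indicator {0<..<m x} s) \<partial>lborel)
      = (\<integral>\<^sup>+x. ennreal (q * s powr (q - 1)) * indicator {0<..} s * indicator {x. s < m x} x \<partial>lborel)"
      using q by (intro nn_integral_cong) (auto simp: indicator_def ennreal_mult')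
    also have "\<dots> = ennreal (q * s powr (q - 1)) * indicator {0<..} s * emeasure lborel {x. s < m x}"
      by (intro nn_integral_cmult_indicator) measurable
    finally show "(\<integral>\<^sup>+x. ennreal q * (ennreal (s powr (q - 1)) * indicator {0<..<m x} s) \<partial>lborel)
      = ennreal (q * s powr (q - 1)) * indicator {0<..} s * emeasure lborel {x. s < m x}" .
  qed
  also have "\<dots> \<le> (\<integral>\<^sup>+s. (\<integral>\<^sup>+y. ennreal (10 * q * w y) * (ennreal (s powr (q - 1 - 1)) * indicator {0<..<2 * w y} s) \<partial>lborel) \<partial>lborel)"
  proof (rule nn_integral_mono)
    fix s :: real
    show "ennreal (q * s powr (q - 1)) * indicator {0<..} s * emeasure lborel {x. s < m x}
       \<le> (\<integral>\<^sup>+y. ennreal (10 * q * w y) * (ennreal (s powr (q - 1 - 1)) * indicator {0<..<2 * w y} s) \<partial>lborel)"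
    proof (cases "0 < s")
      case True
      have "ennreal (q * s powr (q - 1)) * indicator {0<..} s * emeasure lborel {x. s < m x}
        \<le> ennreal (q * s powr (q - 1)) * (ennreal (10 / s) * (\<integral>\<^sup>+y. ennreal (w y) * indicator {y. s < 2 * w y} y \<partial>lborel))"
        using True level[of s] by (simp add: mult_left_mono)
      also have "\<dots> = ennreal (10 * q * s powr (q - 1 - 1)) * (\<integral>\<^sup>+y. ennreal (w y) * indicator {y. s < 2 * w y} y \<partial>lborel)"
      proof -
        have "q * s powr (q - 1) * (10 / s) = 10 * q * s powr (q - 1 - 1)"
          using True by (simp add: powr_diff power2_eq_square)
        then show ?thesis using q True by (simp add: mult.assoc[symmetric] ennreal_mult'[symmetric])
      qed
      also have "\<dots> = (\<integral>\<^sup>+y. ennreal (10 * q * w y) * (ennreal (s powr (q - 1 - 1)) * indicator {0<..<2 * w y} s) \<partial>lborel)"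
      proof (subst nn_integral_cmult[symmetric], measurable, rule nn_integral_cong)
        fix y
        show "ennreal (10 * q * s powr (q - 1 - 1)) * (ennreal (w y) * indicator {y. s < 2 * w y} y) =
            ennreal (10 * q * w y) * (ennreal (s powr (q - 1 - 1)) * indicator {0<..<2 * w y} s)"
          using True q w(1)[of y] by (cases "s < 2 * w y") (auto simp: ennreal_mult' mult_ac)
      qed
      finally show ?thesis .
    qed simp
  qed
  \<comment> \<open>After the interchange the inner integral is that of s^{q-2} over (0, 2 w(y)),
    finite because q > 1; it produces the factor (2 w(y))^{q-1} / (q-1).\<close>
  also have "\<dots> = (\<integral>\<^sup>+y. (\<integral>\<^sup>+s. ennreal (10 * q * w y) * (ennreal (s powr (q - 1 - 1)) * indicator {0<..<2 * w y} s) \<partial>lborel) \<partial>lborel)"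
    unfolding indicator_def greaterThanLessThan_iff by (rule lborel_pair.Fubini') measurable
  also have "\<dots> = (\<integral>\<^sup>+y. ennreal (10 * q * 2 powr (q - 1) / (q - 1)) * ennreal (w y powr q) \<partial>lborel)"
  proof (rule nn_integral_cong)
    fix y :: real
    have "10 * q * w y * ((2 * w y) powr (q - 1) / (q - 1)) = 10 * q * 2 powr (q - 1) / (q - 1) * w y powr q"
      using w(1)[of y] q by (cases "w y = 0") (auto simp: powr_mult powr_diff field_simps)
    moreover have "(\<integral>\<^sup>+s. ennreal (s powr (q - 1 - 1)) * indicator {0<..<2 * w y} s \<partial>lborel)
        = ennreal ((2 * w y) powr (q - 1) / (q - 1))"
      using q w(1)[of y] by (intro nn_integral_powr_from_0) auto
    ultimately show "(\<integral>\<^sup>+s. ennreal (10 * q * w y) * (ennreal (s powr (q - 1 - 1)) * indicator {0<..<2 * w y} s) \<partial>lborel)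
      = ennreal (10 * q * 2 powr (q - 1) / (q - 1)) * ennreal (w y powr q)"
      using q w(1)[of y] by (subst nn_integral_cmult) (simp_all add: ennreal_mult'[symmetric])
  qed
  finally show ?thesis by (simp add: nn_integral_cmult m_def)
qed

section \<open>Vector-valued estimates for families of kernels\<close>

definition convp :: "(real \<Rightarrow> ennreal) \<Rightarrow> (real \<Rightarrow> ennreal) \<Rightarrow> real \<Rightarrow> ennreal" where
  "convp \<kappa> w x = (\<integral>\<^sup>+y. \<kappa> (x - y) * w y \<partial>lborel)"

lemma borel_measurable_convp [measurable]:
  assumes [measurable]: "\<kappa> \<in> borel_measurable borel" "w \<in> borel_measurable borel"
  shows "convp \<kappa> w \<in> borel_measurable borel"
  unfolding convp_def by measurable

lemma nn_integral_shift_reflect: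
  fixes f :: "real \<Rightarrow> ennreal"
  assumes [measurable]: "f \<in> borel_measurable borel"
  shows "(\<integral>\<^sup>+y. f (x - y) \<partial>lborel) = (\<integral>\<^sup>+y. f y \<partial>lborel)"
  using nn_integral_real_affine[of f "-1" x] by simp

text \<open>The interface to the vector-valued estimate. Evenness makes convolution symmetric, so
  that it can be moved onto a weight; the mass enters through the Cauchy--Schwarz inequality; the
  last clause controls the convolved weight. A single M serves a whole family of kernels.\<close>

definition maximal_kernel :: "real \<Rightarrow> (real \<Rightarrow> ennreal) \<Rightarrow> bool" where
  "maximal_kernel M \<kappa> \<longleftrightarrow> \<kappa> \<in> borel_measurable borel \<and> (\<forall>x. \<kappa> (- x) = \<kappa> x) \<and>
     (\<integral>\<^sup>+x. \<kappa> x \<partial>lborel) \<le> ennreal M \<and>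
     (\<forall>w\<in>borel_measurable borel. \<forall>x. convp \<kappa> w x \<le> ennreal M * maxfun w x)"

lemma maximal_kernelD:
  assumes "maximal_kernel M \<kappa>"
  shows maximal_kernel_measurable: "\<kappa> \<in> borel_measurable borel"
    and maximal_kernel_even: "\<kappa> (- x) = \<kappa> x"
    and maximal_kernel_mass: "(\<integral>\<^sup>+x. \<kappa> x \<partial>lborel) \<le> ennreal M"
    and maximal_kernel_le: "w \<in> borel_measurable borel \<Longrightarrow> convp \<kappa> w x \<le> ennreal M * maxfun w x"
  using assms by (auto simp: maximal_kernel_def)

text \<open>The kernel is a superposition of indicators of balls centred at 0 with density
  \<mu>(\<rho>). Convolution therefore superposes integrals over balls around x, each at most
  2\<rho> times the maximal function. The mass is the same computation for the constant function
  1.\<close>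

lemma maximal_kernel_superposition:
  assumes [measurable]: "\<mu> \<in> borel_measurable borel"
    and M: "(\<integral>\<^sup>+\<rho>. \<mu> \<rho> * ennreal (2 * \<rho>) * indicator {0<..} \<rho> \<partial>lborel) \<le> ennreal M"
  shows "maximal_kernel M (\<lambda>x. \<integral>\<^sup>+\<rho>. \<mu> \<rho> * indicator {\<bar>x\<bar><..} \<rho> \<partial>lborel)"
proof -
  let ?k = "\<lambda>x. \<integral>\<^sup>+\<rho>. \<mu> \<rho> * indicator {\<bar>x\<bar><..} \<rho> \<partial>lborel"
  have meas: "?k \<in> borel_measurable borel"
    unfolding indicator_def greaterThan_iff by measurable
  have conv: "convp ?k w x
      = (\<integral>\<^sup>+\<rho>. \<mu> \<rho> * indicator {0<..} \<rho> * (\<integral>\<^sup>+y. w y * indicator (ball x \<rho>) y \<partial>lborel) \<partial>lborel)"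
    if [measurable]: "w \<in> borel_measurable borel" for w x
  proof -
    have "convp ?k w x = (\<integral>\<^sup>+y. (\<integral>\<^sup>+\<rho>. \<mu> \<rho> * indicator {\<bar>x - y\<bar><..} \<rho> * w y \<partial>lborel) \<partial>lborel)"
      unfolding convp_def by (intro nn_integral_cong nn_integral_multc[symmetric]) measurable
    also have "\<dots> = (\<integral>\<^sup>+\<rho>. (\<integral>\<^sup>+y. \<mu> \<rho> * indicator {\<bar>x - y\<bar><..} \<rho> * w y \<partial>lborel) \<partial>lborel)"
      unfolding indicator_def greaterThan_iff by (rule lborel_pair.Fubini') measurable
    also have "\<dots> = (\<integral>\<^sup>+\<rho>. (\<integral>\<^sup>+y. \<mu> \<rho> * indicator {0<..} \<rho> * (w y * indicator (ball x \<rho>) y) \<partial>lborel) \<partial>lborel)"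
      by (intro nn_integral_cong) (auto simp: indicator_def dist_real_def)
    also have "\<dots> = (\<integral>\<^sup>+\<rho>. \<mu> \<rho> * indicator {0<..} \<rho> * (\<integral>\<^sup>+y. w y * indicator (ball x \<rho>) y \<partial>lborel) \<partial>lborel)"
      by (intro nn_integral_cong nn_integral_cmult)
        (simp add: borel_measurable_mult_indicator_ball)
    finally show ?thesis .
  qed
  have "convp ?k w x \<le> ennreal M * maxfun w x" if [measurable]: "w \<in> borel_measurable borel" for w x
  proof -
    have "convp ?k w x \<le> (\<integral>\<^sup>+\<rho>. \<mu> \<rho> * ennreal (2 * \<rho>) * indicator {0<..} \<rho> * maxfun w x \<partial>lborel)"
      unfolding conv[OF that]
    proof (intro nn_integral_mono)
      fix \<rho> :: real
      show "\<mu> \<rho> * indicator {0<..} \<rho> * (\<integral>\<^sup>+y. w y * indicator (ball x \<rho>) y \<partial>lborel)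
          \<le> \<mu> \<rho> * ennreal (2 * \<rho>) * indicator {0<..} \<rho> * maxfun w x"
        using ball_integral_le_maxfun[of \<rho> x x w]
        by (cases "0 < \<rho>") (auto simp: mult.assoc intro!: mult_left_mono)
    qed
    also have "\<dots> = (\<integral>\<^sup>+\<rho>. \<mu> \<rho> * ennreal (2 * \<rho>) * indicator {0<..} \<rho> \<partial>lborel) * maxfun w x"
      by (intro nn_integral_multc) measurable
    also have "\<dots> \<le> ennreal M * maxfun w x" by (intro mult_right_mono M) auto
    finally show ?thesis .
  qed
  moreover have "(\<integral>\<^sup>+x. ?k x \<partial>lborel) \<le> ennreal M"
  proof -
    have "(\<integral>\<^sup>+x. ?k x \<partial>lborel) = (\<integral>\<^sup>+x. ?k (0 - x) \<partial>lborel)" by simp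
    also have "\<dots> = convp ?k (\<lambda>_. 1) 0" by (simp add: convp_def)
    also have "\<dots> = (\<integral>\<^sup>+\<rho>. \<mu> \<rho> * indicator {0<..} \<rho> * (\<integral>\<^sup>+y. 1 * indicator (ball (0::real) \<rho>) y \<partial>lborel) \<partial>lborel)"
      using conv[of "\<lambda>_. 1" 0] by simp
    also have "\<dots> = (\<integral>\<^sup>+\<rho>. \<mu> \<rho> * ennreal (2 * \<rho>) * indicator {0<..} \<rho> \<partial>lborel)"
    proof (rule nn_integral_cong)
      fix \<rho> :: real
      show "\<mu> \<rho> * indicator {0<..} \<rho> * (\<integral>\<^sup>+y. 1 * indicator (ball (0::real) \<rho>) y \<partial>lborel)
          = \<mu> \<rho> * ennreal (2 * \<rho>) * indicator {0<..} \<rho>"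
        by (cases "0 < \<rho>") (simp_all add: ball_eq_greaterThanLessThan)
    qed
    also have "\<dots> \<le> ennreal M" by (rule M)
    finally show ?thesis .
  qed
  ultimately show ?thesis using meas by (simp add: maximal_kernel_def)
qed

text \<open>Tonelli's theorem, followed by \<kappa>(x - y) = \<kappa>(y - x).\<close>

lemma convp_adjoint:
  assumes "maximal_kernel M \<kappa>" and [measurable]: "f \<in> borel_measurable borel" "w \<in> borel_measurable borel"
  shows "(\<integral>\<^sup>+x. convp \<kappa> f x * w x \<partial>lborel) = (\<integral>\<^sup>+y. f y * convp \<kappa> w y \<partial>lborel)"
proof -
  note [measurable] = maximal_kernel_measurable[OF assms(1)]
  have "(\<integral>\<^sup>+x. convp \<kappa> f x * w x \<partial>lborel) = (\<integral>\<^sup>+x. (\<integral>\<^sup>+y. \<kappa> (x - y) * f y * w x \<partial>lborel) \<partial>lborel)"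
    unfolding convp_def by (intro nn_integral_cong nn_integral_multc[symmetric]) measurable
  also have "\<dots> = (\<integral>\<^sup>+y. (\<integral>\<^sup>+x. \<kappa> (x - y) * f y * w x \<partial>lborel) \<partial>lborel)"
    by (rule lborel_pair.Fubini') measurable
  also have "\<dots> = (\<integral>\<^sup>+y. (\<integral>\<^sup>+x. f y * (\<kappa> (y - x) * w x) \<partial>lborel) \<partial>lborel)"
    using maximal_kernel_even[OF assms(1)] 
    by (intro nn_integral_cong) (metis (no_types, lifting) minus_diff_eq mult.assoc mult.commute)
  also have "\<dots> = (\<integral>\<^sup>+y. f y * convp \<kappa> w y \<partial>lborel)"
    unfolding convp_def by (intro nn_integral_cong nn_integral_cmult) measurable
  finally show ?thesis .
qed

lemma convp_mass:
  assumes "maximal_kernel M \<kappa>"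
  shows "(\<integral>\<^sup>+y. \<kappa> (x - y) \<partial>lborel) \<le> ennreal M"
  using nn_integral_shift_reflect[OF maximal_kernel_measurable[OF assms], of x]
    maximal_kernel_mass[OF assms] by simp

lemma convp_le_bound:
  assumes "maximal_kernel M \<kappa>" "0 \<le> M" "\<And>y. w y \<le> ennreal B" "0 \<le> B"
  shows "convp \<kappa> w x \<le> ennreal (M * B)"
proof -
  note [measurable] = maximal_kernel_measurable[OF assms(1)]
  have "convp \<kappa> w x \<le> (\<integral>\<^sup>+y. \<kappa> (x - y) * ennreal B \<partial>lborel)"
    unfolding convp_def by (intro nn_integral_mono mult_left_mono assms) auto
  also have "\<dots> = (\<integral>\<^sup>+y. \<kappa> (x - y) \<partial>lborel) * ennreal B"
    by (intro nn_integral_multc) measurable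
  also have "\<dots> \<le> ennreal M * ennreal B" by (intro mult_right_mono convp_mass assms) auto
  finally show ?thesis using assms by (simp add: ennreal_mult')
qed

text \<open>The Cauchy--Schwarz inequality for the measure \<kappa>(x - y) dy, whose mass is at most
  M.\<close>

lemma convp_square_le:
  assumes "maximal_kernel M \<kappa>" and [measurable]: "f \<in> borel_measurable borel"
  shows "(convp \<kappa> f x)\<^sup>2 \<le> ennreal M * convp \<kappa> (\<lambda>y. (f y)\<^sup>2) x"
proof -
  note [measurable] = maximal_kernel_measurable[OF assms(1)]
  let ?\<nu> = "density lborel (\<lambda>y. \<kappa> (x - y))"
  have eq: "(\<integral>\<^sup>+y. g y \<partial>?\<nu>) = (\<integral>\<^sup>+y. \<kappa> (x - y) * g y \<partial>lborel)"
    if "g \<in> borel_measurable borel" for g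
    using that by (subst nn_integral_density) auto
  have "(convp \<kappa> f x)\<^sup>2 = (\<integral>\<^sup>+y. 1 * f y \<partial>?\<nu>)\<^sup>2"
    by (simp add: convp_def eq)
  also have "\<dots> \<le> (\<integral>\<^sup>+y. 1\<^sup>2 \<partial>?\<nu>) * (\<integral>\<^sup>+y. (f y)\<^sup>2 \<partial>?\<nu>)"
    by (rule Cauchy_Schwarz_nn_integral) auto
  also have "\<dots> = (\<integral>\<^sup>+y. \<kappa> (x - y) \<partial>lborel) * convp \<kappa> (\<lambda>y. (f y)\<^sup>2) x"
    using eq[of "\<lambda>_. 1"] eq[of "\<lambda>y. (f y)\<^sup>2"] by (simp add: convp_def)
  also have "\<dots> \<le> ennreal M * convp \<kappa> (\<lambda>y. (f y)\<^sup>2) x"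
    by (intro mult_right_mono convp_mass assms) auto
  finally show ?thesis .
qed

text \<open>One factor M is the mass from Cauchy--Schwarz, the other is the domination of the
  convolved weight. The argument is made mode by mode with the same weight, so adding up the modes
  costs nothing, and the maximal function of \<open>w\<close> does not see n.\<close>

lemma convp_weighted_square:
  assumes \<kappa>: "\<And>n. n < N \<Longrightarrow> maximal_kernel M (\<kappa> n)"
    and [measurable]: "\<And>n. f n \<in> borel_measurable borel" "w \<in> borel_measurable borel"
  shows "(\<integral>\<^sup>+x. (\<Sum>n<N. (convp (\<kappa> n) (f n) x)\<^sup>2) * w x \<partial>lborel)
      \<le> ennreal M * (\<integral>\<^sup>+y. (\<Sum>n<N. (f n y)\<^sup>2 * convp (\<kappa> n) w y) \<partial>lborel)"
    and "(\<integral>\<^sup>+x. (\<Sum>n<N. (convp (\<kappa> n) (f n) x)\<^sup>2) * w x \<partial>lborel)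
      \<le> ennreal M * (ennreal M * (\<integral>\<^sup>+y. (\<Sum>n<N. (f n y)\<^sup>2) * maxfun w y \<partial>lborel))"
proof -
  have m[measurable]: "n < N \<Longrightarrow> \<kappa> n \<in> borel_measurable borel" for n
    using \<kappa> maximal_kernel_measurable by blast
  have [measurable]: "n < N \<Longrightarrow> convp (\<kappa> n) g \<in> borel_measurable borel" 
    if "g \<in> borel_measurable borel" for n g
    using m that by (intro borel_measurable_convp) auto
  have "(\<integral>\<^sup>+x. (\<Sum>n<N. (convp (\<kappa> n) (f n) x)\<^sup>2) * w x \<partial>lborel)
      = (\<Sum>n<N. \<integral>\<^sup>+x. (convp (\<kappa> n) (f n) x)\<^sup>2 * w x \<partial>lborel)"
    by (subst nn_integral_sum[symmetric]) (auto simp: sum_distrib_right)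
  also have "\<dots> \<le> (\<Sum>n<N. ennreal M * (\<integral>\<^sup>+y. (f n y)\<^sup>2 * convp (\<kappa> n) w y \<partial>lborel))"
  proof (rule sum_mono)
    fix n assume n: "n \<in> {..<N}"
    have "(\<integral>\<^sup>+x. (convp (\<kappa> n) (f n) x)\<^sup>2 * w x \<partial>lborel)
        \<le> (\<integral>\<^sup>+x. ennreal M * (convp (\<kappa> n) (\<lambda>y. (f n y)\<^sup>2) x * w x) \<partial>lborel)"
      using n by (auto simp: mult.assoc[symmetric] intro!: nn_integral_mono mult_right_mono convp_square_le \<kappa>)
    also have "\<dots> = ennreal M * (\<integral>\<^sup>+x. convp (\<kappa> n) (\<lambda>y. (f n y)\<^sup>2) x * w x \<partial>lborel)"
      using n by (intro nn_integral_cmult) auto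
    also have "\<dots> = ennreal M * (\<integral>\<^sup>+y. (f n y)\<^sup>2 * convp (\<kappa> n) w y \<partial>lborel)"
      using n by (subst convp_adjoint[OF \<kappa>]) auto
    finally show "(\<integral>\<^sup>+x. (convp (\<kappa> n) (f n) x)\<^sup>2 * w x \<partial>lborel)
        \<le> ennreal M * (\<integral>\<^sup>+y. (f n y)\<^sup>2 * convp (\<kappa> n) w y \<partial>lborel)" .
  qed
  also have "\<dots> = ennreal M * (\<integral>\<^sup>+y. (\<Sum>n<N. (f n y)\<^sup>2 * convp (\<kappa> n) w y) \<partial>lborel)"
    by (subst nn_integral_sum) (auto simp: sum_distrib_left)
  finally show *: "(\<integral>\<^sup>+x. (\<Sum>n<N. (convp (\<kappa> n) (f n) x)\<^sup>2) * w x \<partial>lborel)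
      \<le> ennreal M * (\<integral>\<^sup>+y. (\<Sum>n<N. (f n y)\<^sup>2 * convp (\<kappa> n) w y) \<partial>lborel)" .
  also have "\<dots> \<le> ennreal M * (\<integral>\<^sup>+y. ennreal M * ((\<Sum>n<N. (f n y)\<^sup>2) * maxfun w y) \<partial>lborel)"
  proof (intro mult_left_mono nn_integral_mono)
    fix y
    have "(\<Sum>n<N. (f n y)\<^sup>2 * convp (\<kappa> n) w y) \<le> (\<Sum>n<N. (f n y)\<^sup>2 * (ennreal M * maxfun w y))"
      using maximal_kernel_le[OF \<kappa>] by (intro sum_mono mult_left_mono) auto
    also have "\<dots> = ennreal M * ((\<Sum>n<N. (f n y)\<^sup>2) * maxfun w y)"
      by (simp add: sum_distrib_left sum_distrib_right mult_ac)
    finally show "(\<Sum>n<N. (f n y)\<^sup>2 * convp (\<kappa> n) w y) \<le> ennreal M * ((\<Sum>n<N. (f n y)\<^sup>2) * maxfun w y)" .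
  qed auto
  also have "\<dots> = ennreal M * (ennreal M * (\<integral>\<^sup>+y. (\<Sum>n<N. (f n y)\<^sup>2) * maxfun w y \<partial>lborel))"
    by (subst nn_integral_cmult) auto
  finally show "(\<integral>\<^sup>+x. (\<Sum>n<N. (convp (\<kappa> n) (f n) x)\<^sup>2) * w x \<partial>lborel)
      \<le> ennreal M * (ennreal M * (\<integral>\<^sup>+y. (\<Sum>n<N. (f n y)\<^sup>2) * maxfun w y \<partial>lborel))" .
qed

text \<open>Young's inequality for a/\<delta> and \<delta>b, with the factors 1/p and 1/q estimated
  by 1. A small \<delta> makes the second term absorbable at the price of a large constant in the
  first.\<close>

lemma Youngs_inequality_scaled:
  fixes a b \<delta> p q :: real
  assumes "p > 1" "q > 1" "1 / p + 1 / q = 1" "0 \<le> a" "0 \<le> b" "0 < \<delta>"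
  shows "a * b \<le> \<delta> powr (- p) * a powr p + \<delta> powr q * b powr q"
proof -
  have "a * b = (a / \<delta>) * (\<delta> * b)" using assms by simp
  also have "\<dots> \<le> (a / \<delta>) powr p / p + (\<delta> * b) powr q / q"
    using assms by (intro Youngs_inequality) auto
  also have "\<dots> \<le> (a / \<delta>) powr p / 1 + (\<delta> * b) powr q / 1"
    using assms by (intro add_mono divide_left_mono) auto
  finally have "a * b \<le> (a / \<delta>) powr p + (\<delta> * b) powr q" by simp
  moreover have "(a / \<delta>) powr p = \<delta> powr (- p) * a powr p"
    unfolding powr_minus powr_divide
    by (simp only: divide_inverse mult.commute)
  moreover have "(\<delta> * b) powr q = \<delta> powr q * b powr q"
    using assms by (simp add: powr_mult)
  ultimately show ?thesis by simp
qed

lemma exists_small_powr: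
  fixes K q :: real
  assumes "0 < q" "0 \<le> K"
  obtains \<delta> where "0 < \<delta>" "K * \<delta> powr q \<le> 1 / 2"
proof
  let ?d = "(1 / (2 * (K + 1))) powr (1 / q)"
  show "0 < ?d" using assms by simp
  have "?d powr q = 1 / (2 * (K + 1))" using assms by (simp add: powr_powr)
  then show "K * ?d powr q \<le> 1 / 2" using assms by (simp only: ) (simp add: divide_simps)
qed

text \<open>Finiteness of X is essential: it permits subtracting c X \<le> X/2 from both
  sides.\<close>

lemma ennreal_absorb_half:
  fixes X Z :: ennreal
  assumes "X \<le> Z + ennreal c * X" "X < \<infinity>" "0 \<le> c" "c \<le> 1 / 2"
  shows "X \<le> 2 * Z"
proof (cases "Z = \<infinity>")
  case False
  obtain x where x: "X = ennreal x" "0 \<le> x" using assms by (cases X) auto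
  obtain z where z: "Z = ennreal z" "0 \<le> z" using False by (cases Z) auto
  have "ennreal x \<le> ennreal (z + c * x)" using assms x z by (simp add: ennreal_mult' ennreal_plus)
  then have "x \<le> z + c * x" using x z assms by (subst (asm) ennreal_le_iff) auto
  moreover have "c * x \<le> 1 / 2 * x" using assms x by (intro mult_right_mono) auto
  ultimately have "x \<le> 2 * z" by simp
  then show ?thesis using x z
    by (simp add: ennreal_leI ennreal_mult'[symmetric] flip: ennreal_numeral)
qed (simp add: ennreal_mult_top)

text \<open>The square of the l^2 norm of the first N modes, without the root. Exponents p of the
  norm thus appear as p/2 throughout.\<close>

definition sqf :: "nat \<Rightarrow> (nat \<Rightarrow> real \<Rightarrow> real) \<Rightarrow> real \<Rightarrow> real" where
  "sqf N F x = (\<Sum>n<N. (F n x)\<^sup>2)"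

lemma sqf_nonneg [simp]: "0 \<le> sqf N F x"
  by (simp add: sqf_def sum_nonneg)

lemma borel_measurable_sqf [measurable]:
  assumes "\<And>n. F n \<in> borel_measurable M"
  shows "sqf N F \<in> borel_measurable M"
  unfolding sqf_def[abs_def] using assms by measurable

lemma ennreal_sqf: "(\<And>n. n < N \<Longrightarrow> 0 \<le> F n x) \<Longrightarrow> ennreal (sqf N F x) = (\<Sum>n<N. (ennreal (F n x))\<^sup>2)"
  unfolding sqf_def by (subst sum_ennreal[symmetric]) (auto simp: ennreal_power)

text \<open>Boundedness guarantees that the quantity to be absorbed is finite. The bound B must not
  enter any constant, because it is removed later by truncation.\<close>

definition bdd_family :: "real \<Rightarrow> real \<Rightarrow> (nat \<Rightarrow> real \<Rightarrow> real) \<Rightarrow> bool" where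
  "bdd_family T B F \<longleftrightarrow> 0 \<le> B \<and> (\<forall>n. F n \<in> borel_measurable borel) \<and>
     (\<forall>n x. 0 \<le> F n x \<and> F n x \<le> B) \<and> (\<forall>n x. x \<notin> {0<..<T} \<longrightarrow> F n x = 0)"

abbreviation l2int :: "real \<Rightarrow> real \<Rightarrow> nat \<Rightarrow> (nat \<Rightarrow> real \<Rightarrow> real) \<Rightarrow> ennreal" where
  "l2int p T N F \<equiv> (\<integral>\<^sup>+x. ennreal (sqf N F x powr (p / 2)) * indicator {0<..<T} x \<partial>lborel)"

text \<open>The value is \<open>0\<close> where the convolution is infinite.\<close>

definition convf :: "(nat \<Rightarrow> real \<Rightarrow> ennreal) \<Rightarrow> (nat \<Rightarrow> real \<Rightarrow> real) \<Rightarrow> nat \<Rightarrow> real \<Rightarrow> real" where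
  "convf \<kappa> F n x = enn2real (convp (\<kappa> n) (\<lambda>y. ennreal (F n y)) x)"

lemma convf_bdd:
  assumes "maximal_kernel M (\<kappa> n)" "0 \<le> M" "bdd_family T B F"
  shows "ennreal (convf \<kappa> F n x) = convp (\<kappa> n) (\<lambda>y. ennreal (F n y)) x"
    and "convf \<kappa> F n x \<le> M * B" "0 \<le> convf \<kappa> F n x"
proof -
  have *: "convp (\<kappa> n) (\<lambda>y. ennreal (F n y)) x \<le> ennreal (M * B)"
    using assms by (intro convp_le_bound) (auto simp: bdd_family_def ennreal_leI)
  then show "ennreal (convf \<kappa> F n x) = convp (\<kappa> n) (\<lambda>y. ennreal (F n y)) x"
    unfolding convf_def by (simp add: le_less_trans less_top top.not_eq_extremum ennreal_enn2real)
  show "convf \<kappa> F n x \<le> M * B" unfolding convf_def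
    using * assms by (intro enn2real_leI) (auto simp: bdd_family_def)
  show "0 \<le> convf \<kappa> F n x" by (simp add: convf_def)
qed

lemma borel_measurable_convf:
  assumes "maximal_kernel M (\<kappa> n)" "F n \<in> borel_measurable borel"
  shows "convf \<kappa> F n \<in> borel_measurable borel"
proof -
  note [measurable] = maximal_kernel_measurable[OF assms(1)] assms(2)
  show ?thesis unfolding convf_def[abs_def] by measurable
qed

lemma sqf_convf_bdd:
  assumes "\<And>n. n < N \<Longrightarrow> maximal_kernel M (\<kappa> n)" "0 \<le> M" "bdd_family T B F"
  shows "sqf N (convf \<kappa> F) x \<le> real N * (M * B)\<^sup>2"
proof -
  have "sqf N (convf \<kappa> F) x \<le> (\<Sum>n<N. (M * B)\<^sup>2)"
    unfolding sqf_def using convf_bdd[where \<kappa>=\<kappa>, OF assms(1) assms(2,3)] by (intro sum_mono power_mono) auto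
  then show ?thesis by simp
qed

lemma nn_integral_bdd_Ioo_finite:
  fixes g :: "real \<Rightarrow> real"
  assumes "\<And>x. g x \<le> b"
  shows "(\<integral>\<^sup>+x. ennreal (g x) * indicator {0<..<T} x \<partial>lborel) < \<infinity>"
proof -
  have "(\<integral>\<^sup>+x. ennreal (g x) * indicator {0<..<T} x \<partial>lborel)
      \<le> (\<integral>\<^sup>+x. ennreal b * indicator {0<..<T} x \<partial>lborel)"
    by (intro nn_integral_mono mult_right_mono ennreal_leI assms) auto
  also have "\<dots> = ennreal b * emeasure lborel {0<..<T}"
    by (intro nn_integral_cmult_indicator) auto
  also have "\<dots> < \<infinity>" by (cases "0 \<le> T") (auto simp: ennreal_mult_less_top)
  finally show ?thesis .
qed

text \<open>For \<open>p > 2\<close> and \<open>G = (\<Sum>n. (\<kappa>\<^sub>n * F\<^sub>n)\<^sup>2)\<^sup>1\<^sup>/\<^sup>2\<close> write \<open>G\<^sup>p = G\<^sup>2 w\<close> with the weight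
  \<open>w = G\<^sup>p\<^sup>-\<^sup>2\<close>. The Cauchy--Schwarz inequality for each kernel moves it onto the weight, where it is
  dominated by the maximal function of \<open>w\<close>; Young's inequality and the strong type bound then
  absorb a small multiple of \<open>\<integral>G\<^sup>p\<close>, which is finite because \<open>F\<close> is bounded.\<close>

lemma convf_Lp_ge2_bdd:
  fixes p M :: real
  assumes p: "2 \<le> p" and M: "0 \<le> M"
  obtains C where "0 \<le> C"
    "\<And>\<kappa> F N B T. (\<And>n. maximal_kernel M (\<kappa> n)) \<Longrightarrow> bdd_family T B F \<Longrightarrow>
       l2int p T N (convf \<kappa> F)
         \<le> ennreal C * l2int p T N F"
proof (cases "p = 2")
  \<comment> \<open>For p = 2 the weight is the constant 1, whose maximal function is at most 1, and
    nothing has to be absorbed.\<close>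
  case True
  have "l2int p T N (convf \<kappa> F)
         \<le> ennreal (M * M) * l2int p T N F"
    if \<kappa>: "\<And>n. maximal_kernel M (\<kappa> n)" and F: "bdd_family T B F" for \<kappa> F N B T
  proof -
    have [measurable]: "\<And>n. F n \<in> borel_measurable borel" using F by (auto simp: bdd_family_def)
    have "l2int p T N (convf \<kappa> F)
        \<le> (\<integral>\<^sup>+x. (\<Sum>n<N. (convp (\<kappa> n) (\<lambda>y. ennreal (F n y)) x)\<^sup>2) * 1 \<partial>lborel)"
      using True convf_bdd[where \<kappa>=\<kappa>, OF \<kappa> M F]
      by (intro nn_integral_mono) (auto simp: indicator_def ennreal_sqf)
    also have "\<dots> \<le> ennreal M * (ennreal M * (\<integral>\<^sup>+y. (\<Sum>n<N. (ennreal (F n y))\<^sup>2) * maxfun (\<lambda>_. 1) y \<partial>lborel))"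
      using \<kappa> by (intro convp_weighted_square(2)) auto
    also have "\<dots> \<le> ennreal M * (ennreal M * (\<integral>\<^sup>+y. ennreal (sqf N F y powr (p / 2)) * indicator {0<..<T} y \<partial>lborel))"
    proof (intro mult_left_mono nn_integral_mono)
      fix y
      have "maxfun (\<lambda>_. 1) y \<le> 1" using maxfun_le_bound[of "\<lambda>_. 1" 1 y] by simp
      then have "(\<Sum>n<N. (ennreal (F n y))\<^sup>2) * maxfun (\<lambda>_. 1) y \<le> ennreal (sqf N F y) * 1"
        using F by (subst ennreal_sqf) (auto simp: bdd_family_def intro!: mult_left_le)
      also have "\<dots> = ennreal (sqf N F y powr (p / 2)) * indicator {0<..<T} y"
        using F True by (cases "y \<in> {0<..<T}") (auto simp: bdd_family_def sqf_def sum_nonneg)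
      finally show "(\<Sum>n<N. (ennreal (F n y))\<^sup>2) * maxfun (\<lambda>_. 1) y
          \<le> ennreal (sqf N F y powr (p / 2)) * indicator {0<..<T} y" .
    qed auto
    finally show ?thesis using M by (simp add: ennreal_mult' mult.assoc)
  qed
  then show ?thesis using that[of "M * M"] M by auto
next
  case False
  then have p2: "2 < p" using p by simp
  \<comment> \<open>The exponent conjugate to p/2. It is chosen so that the weight G^{(p-2)/2} has
    q-th power G^{p/2}, where G denotes the squared norm; the integral of the q-th power of the
    weight is then the left-hand side itself.\<close>
  define q where "q = p / (p - 2)"
  have q: "1 < q" "1 / (p / 2) + 1 / q = 1" "1 < p / 2"
    using p2 by (auto simp: q_def field_simps)
  define Cq where "Cq = 10 * q * 2 powr (q - 1) / (q - 1)"
  have Cq: "0 \<le> Cq" using q by (auto simp: Cq_def)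
  \<comment> \<open>\<delta> is fixed before kernels, data, N, B and T appear, so the final constant
    depends on p and M only.\<close>
  obtain \<delta> where \<delta>: "0 < \<delta>" "(M * M * Cq) * \<delta> powr q \<le> 1 / 2"
    using exists_small_powr[of q "M * M * Cq"] q Cq M by auto
  have "l2int p T N (convf \<kappa> F)
         \<le> ennreal (2 * (M * M * \<delta> powr (- (p / 2)))) *
            l2int p T N F"
    if \<kappa>: "\<And>n. maximal_kernel M (\<kappa> n)" and F: "bdd_family T B F" for \<kappa> F N B T
  proof -
    have [measurable]: "\<And>n. F n \<in> borel_measurable borel" using F by (auto simp: bdd_family_def)
    have [measurable]: "\<And>n. convf \<kappa> F n \<in> borel_measurable borel"
      by (rule borel_measurable_convf[OF \<kappa>]) measurable
    define G where "G = sqf N (convf \<kappa> F)"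
    have G0: "0 \<le> G x" for x by (simp add: G_def)
    have [measurable]: "G \<in> borel_measurable borel" unfolding G_def by measurable
    define b where "b = real N * (M * B)\<^sup>2"
    have Gb: "G x \<le> b" for x
      unfolding G_def b_def using \<kappa> M F by (intro sqf_convf_bdd) auto
    define w where "w x = G x powr ((p - 2) / 2) * indicator {0<..<T} x" for x
    have [measurable]: "w \<in> borel_measurable borel" unfolding w_def by measurable
    have wb: "0 \<le> w x" "w x \<le> b powr ((p - 2) / 2)" for x
      using Gb[of x] G0[of x] p2 by (auto simp: w_def indicator_def powr_mono2)
    have wq: "w x powr q = G x powr (p / 2) * indicator {0<..<T} x" for x
    proof -
      have "(p - 2) / 2 * q = p / 2" using p2 by (simp add: q_def field_simps)
      then show ?thesis using q by (auto simp: w_def indicator_def powr_powr)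
    qed
    define m where "m x = enn2real (maxfun w x)" for x
    have m: "maxfun w x = ennreal (m x)" "0 \<le> m x" for x
      using maxfun_le_bound[of w "b powr ((p - 2) / 2)" x] wb[of x]
      by (auto simp: m_def ennreal_leI wb le_less_trans ennreal_enn2real)
    have [measurable]: "m \<in> borel_measurable borel" unfolding m_def by measurable
    define X where "X = (\<integral>\<^sup>+x. ennreal (G x powr (p / 2)) * indicator {0<..<T} x \<partial>lborel)"
    define Z where "Z = l2int p T N F"
    have Zeq: "Z = (\<integral>\<^sup>+x. ennreal (sqf N F x powr (p / 2)) \<partial>lborel)"
      unfolding Z_def using F
      by (intro nn_integral_cong) (auto simp: indicator_def bdd_family_def sqf_def)
    have Xfin: "X < \<infinity>"
      unfolding X_def using Gb G0 p
      by (intro nn_integral_bdd_Ioo_finite[where b="b powr (p / 2)"] powr_mono2) auto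
    have "X = (\<integral>\<^sup>+x. (\<Sum>n<N. (convp (\<kappa> n) (\<lambda>y. ennreal (F n y)) x)\<^sup>2) * ennreal (w x) \<partial>lborel)"
      unfolding X_def
    proof (rule nn_integral_cong)
      fix x
      have "(\<Sum>n<N. (convp (\<kappa> n) (\<lambda>y. ennreal (F n y)) x)\<^sup>2) = ennreal (G x)"
        unfolding G_def using convf_bdd[where \<kappa>=\<kappa>, OF \<kappa> M F] by (subst ennreal_sqf) auto
      moreover have "G x powr (p / 2) = G x * G x powr ((p - 2) / 2)"
        using G0[of x] p2 by (cases "G x = 0") (auto simp: powr_mult_base diff_divide_distrib)
      ultimately show "ennreal (G x powr (p / 2)) * indicator {0<..<T} x
        = (\<Sum>n<N. (convp (\<kappa> n) (\<lambda>y. ennreal (F n y)) x)\<^sup>2) * ennreal (w x)"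
        using G0[of x] by (auto simp: w_def indicator_def ennreal_mult')
    qed
    also have "\<dots> \<le> ennreal M * (ennreal M * (\<integral>\<^sup>+y. (\<Sum>n<N. (ennreal (F n y))\<^sup>2) * maxfun w y \<partial>lborel))"
      using \<kappa> by (intro convp_weighted_square(2)) auto
    also have "\<dots> = ennreal (M * M) * (\<integral>\<^sup>+y. ennreal (sqf N F y * m y) \<partial>lborel)"
      using F M m by (simp add: ennreal_sqf[symmetric] bdd_family_def ennreal_mult' mult.assoc)
    also have "\<dots> \<le> ennreal (M * M) * (\<integral>\<^sup>+y. ennreal (\<delta> powr (- (p / 2))) * ennreal (sqf N F y powr (p / 2))
        + ennreal (\<delta> powr q) * ennreal (m y powr q) \<partial>lborel)"
    proof (intro mult_left_mono nn_integral_mono)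
      fix y
      have "sqf N F y * m y \<le> \<delta> powr (- (p / 2)) * sqf N F y powr (p / 2) + \<delta> powr q * m y powr q"
        using q \<delta> m by (intro Youngs_inequality_scaled) auto
      then show "ennreal (sqf N F y * m y) \<le> ennreal (\<delta> powr (- (p / 2))) * ennreal (sqf N F y powr (p / 2))
        + ennreal (\<delta> powr q) * ennreal (m y powr q)"
        by (simp add: ennreal_leI ennreal_mult'[symmetric] ennreal_plus[symmetric] del: ennreal_plus)
    qed auto
    also have "\<dots> = ennreal (M * M) * (ennreal (\<delta> powr (- (p / 2))) * Z
        + ennreal (\<delta> powr q) * (\<integral>\<^sup>+y. ennreal (m y powr q) \<partial>lborel))"
      unfolding Zeq by (subst nn_integral_add) (auto simp: nn_integral_cmult)
    also have "\<dots> \<le> ennreal (M * M) * (ennreal (\<delta> powr (- (p / 2))) * Z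
        + ennreal (\<delta> powr q) * (ennreal Cq * (\<integral>\<^sup>+x. ennreal (w x powr q) \<partial>lborel)))"
      unfolding m_def Cq_def using q wb
      by (intro mult_left_mono add_left_mono maxfun_strong_type[where B="b powr ((p - 2) / 2)"]) auto
    also have "(\<integral>\<^sup>+x. ennreal (w x powr q) \<partial>lborel) = X"
      unfolding X_def by (intro nn_integral_cong) (auto simp: wq indicator_def)
    also have "ennreal (M * M) * (ennreal (\<delta> powr (- (p / 2))) * Z + ennreal (\<delta> powr q) * (ennreal Cq * X))
        = ennreal (M * M * \<delta> powr (- (p / 2))) * Z + ennreal (M * M * Cq * \<delta> powr q) * X"
      using M Cq by (simp add: distrib_left ennreal_mult' mult_ac)
    finally have "X \<le> 2 * (ennreal (M * M * \<delta> powr (- (p / 2))) * Z)"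
      using \<delta> Xfin M Cq by (intro ennreal_absorb_half[where c="M * M * Cq * \<delta> powr q"]) auto
    also have "\<dots> = ennreal (2 * (M * M * \<delta> powr (- (p / 2)))) * Z"
      using M by (simp add: ennreal_mult' mult_ac)
    finally show ?thesis by (simp add: X_def Z_def G_def)
  qed
  then show ?thesis using M \<delta> by (intro that[of "2 * (M * M * \<delta> powr (- (p / 2)))"]) auto
qed

text \<open>Duality: the case of the conjugate exponent is applied to \<open>H\<^sub>n = Y\<^sub>n G\<^sup>p\<^sup>-\<^sup>2\<close>.\<close>

lemma convf_Lp_lt2_bdd:
  fixes p M :: real
  assumes p: "1 < p" "p < 2" and M: "0 \<le> M"
  obtains C where "0 \<le> C"
    "\<And>\<kappa> F N B T. (\<And>n. maximal_kernel M (\<kappa> n)) \<Longrightarrow> bdd_family T B F \<Longrightarrow>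
       l2int p T N (convf \<kappa> F)
         \<le> ennreal C * l2int p T N F"
proof -
  define q where "q = p / (p - 1)"
  have q: "2 \<le> q" "1 < q" "1 / p + 1 / q = 1"
    using p by (auto simp: q_def field_simps)
  obtain Cq where Cq: "0 \<le> Cq" and Cq_bound: "\<And>\<kappa> F N B T. (\<And>n. maximal_kernel M (\<kappa> n)) \<Longrightarrow> bdd_family T B F \<Longrightarrow>
       l2int q T N (convf \<kappa> F)
         \<le> ennreal Cq * l2int q T N F"
    using convf_Lp_ge2_bdd[OF q(1) M] by blast
  obtain \<delta> where \<delta>: "0 < \<delta>" "Cq * \<delta> powr q \<le> 1 / 2"
    using exists_small_powr[of q Cq] q Cq by auto
  have "l2int p T N (convf \<kappa> F)
         \<le> ennreal (2 * \<delta> powr (- p)) *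
            l2int p T N F"
    if \<kappa>: "\<And>n. maximal_kernel M (\<kappa> n)" and F: "bdd_family T B F" for \<kappa> F N B T
  proof -
    have [measurable]: "\<And>n. F n \<in> borel_measurable borel" and F0: "\<And>n x. 0 \<le> F n x"
      using F by (auto simp: bdd_family_def)
    define Y where "Y = convf \<kappa> F"
    have [measurable]: "\<And>n. Y n \<in> borel_measurable borel"
      unfolding Y_def by (rule borel_measurable_convf[OF \<kappa>]) measurable
    note Y = convf_bdd[where \<kappa>=\<kappa>, OF \<kappa> M F, folded Y_def]
    define G where "G = sqf N Y"
    have G0: "0 \<le> G x" for x by (simp add: G_def)
    have [measurable]: "G \<in> borel_measurable borel" unfolding G_def by measurable
    define b where "b = real N * (M * B)\<^sup>2"
    have Gb: "G x \<le> b" for x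
      unfolding G_def b_def Y_def using \<kappa> M F by (intro sqf_convf_bdd) auto
    have YG: "Y n x \<le> G x powr (1 / 2)" if "n < N" for n x
    proof -
      have "(Y n x)\<^sup>2 \<le> G x" unfolding G_def sqf_def
        using that by (intro member_le_sum) auto
      then show ?thesis using G0[of x] Y(3)
        by (simp add: powr_half_sqrt real_le_rsqrt)
    qed
    \<comment> \<open>The dual element. \<open>G\<close> is the squared norm here, hence the
      exponent (p - 2)/2, which is negative; where \<open>G\<close> vanishes \<open>powr\<close>
      yields 0, so \<open>H\<close> vanishes there as well. It has squared norm G^{p-1}, and (p - 1)
      q = p, so its L^q integral equals \<open>X\<close>.\<close>
    define H where "H n x = (if n < N then Y n x * G x powr ((p - 2) / 2) * indicator {0<..<T} x else 0)" for n x
    have [measurable]: "\<And>n. H n \<in> borel_measurable borel" unfolding H_def by measurable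
    have H0: "0 \<le> H n x" for n x using Y(3) G0 by (auto simp: H_def)
    have HB: "H n x \<le> b powr ((p - 1) / 2)" for n x
    proof (cases "n < N \<and> x \<in> {0<..<T}")
      case True
      have "Y n x * G x powr ((p - 2) / 2) \<le> G x powr (1 / 2) * G x powr ((p - 2) / 2)"
        using YG True by (intro mult_right_mono) auto
      also have "\<dots> = G x powr ((p - 1) / 2)"
        by (simp add: powr_add[symmetric] add_divide_distrib[symmetric])
      also have "\<dots> \<le> b powr ((p - 1) / 2)" using Gb G0 p by (intro powr_mono2) auto
      finally show ?thesis using True by (simp add: H_def)
    qed (auto simp: H_def)
    have Hbdd: "bdd_family T (b powr ((p - 1) / 2)) H"
      unfolding bdd_family_def using H0 HB by (auto simp: H_def)
    have sqH: "sqf N H x = G x powr (p - 1) * indicator {0<..<T} x" for x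
    proof (cases "x \<in> {0<..<T}")
      case True
      have "sqf N H x = G x * (G x powr ((p - 2) / 2))\<^sup>2"
        using True by (simp add: sqf_def H_def G_def power_mult_distrib sum_distrib_right)
      also have "\<dots> = G x powr (p - 1)"
        using G0[of x] by (cases "G x = 0") (auto simp: power2_eq_square powr_mult_base powr_add[symmetric])
      finally show ?thesis using True by simp
    qed (simp add: sqf_def H_def)
    define X where "X = (\<integral>\<^sup>+x. ennreal (G x powr (p / 2)) * indicator {0<..<T} x \<partial>lborel)"
    define Z where "Z = l2int p T N F"
    have Xfin: "X < \<infinity>"
      unfolding X_def using Gb G0 p
      by (intro nn_integral_bdd_Ioo_finite[where b="b powr (p / 2)"] powr_mono2) auto
    define V where "V = convf \<kappa> H"
    note V = convf_bdd[where \<kappa>=\<kappa>, OF \<kappa> M Hbdd, folded V_def]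
    have [measurable]: "\<And>n. V n \<in> borel_measurable borel"
      unfolding V_def by (rule borel_measurable_convf[OF \<kappa>]) measurable
    have "X = (\<integral>\<^sup>+x. (\<Sum>n<N. convp (\<kappa> n) (\<lambda>y. ennreal (F n y)) x * ennreal (H n x)) \<partial>lborel)"
      unfolding X_def
    proof (rule nn_integral_cong)
      fix x
      have "(\<Sum>n<N. convp (\<kappa> n) (\<lambda>y. ennreal (F n y)) x * ennreal (H n x)) = ennreal (\<Sum>n<N. Y n x * H n x)"
        using Y H0 by (subst sum_ennreal[symmetric]) (auto simp: ennreal_mult')
      also have "(\<Sum>n<N. Y n x * H n x) = G x powr (p / 2) * indicator {0<..<T} x"
      proof -
        have "(\<Sum>n<N. Y n x * H n x) = G x * G x powr ((p - 2) / 2) * indicator {0<..<T} x"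
        proof -
          have "(\<Sum>n<N. Y n x * H n x) = (\<Sum>n<N. (Y n x)\<^sup>2 * (G x powr ((p - 2) / 2) * indicator {0<..<T} x))"
            by (intro sum.cong) (auto simp: H_def power2_eq_square)
          also have "\<dots> = G x * (G x powr ((p - 2) / 2) * indicator {0<..<T} x)"
            unfolding sum_distrib_right[symmetric] by (simp add: G_def sqf_def)
          finally show ?thesis by simp
        qed
        also have "G x * G x powr ((p - 2) / 2) = G x powr (p / 2)"
          using G0[of x] p by (cases "G x = 0") (auto simp: powr_mult_base diff_divide_distrib)
        finally show ?thesis .
      qed
      finally show "ennreal (G x powr (p / 2)) * indicator {0<..<T} x
        = (\<Sum>n<N. convp (\<kappa> n) (\<lambda>y. ennreal (F n y)) x * ennreal (H n x))"
        by (simp add: indicator_def)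
    qed
    also have "\<dots> = (\<Sum>n<N. \<integral>\<^sup>+x. convp (\<kappa> n) (\<lambda>y. ennreal (F n y)) x * ennreal (H n x) \<partial>lborel)"
      using Y(1) by (intro nn_integral_sum) (simp add: Y(1)[symmetric])
    \<comment> \<open>Each kernel moves from \<open>F n\<close> to \<open>H n\<close>. After
      Cauchy--Schwarz in l^2 and Young's inequality, the known bound for the exponent q \<ge> 2
      applies to the convolutions of \<open>H\<close>.\<close>
    also have "\<dots> = (\<Sum>n<N. \<integral>\<^sup>+x. ennreal (F n x) * convp (\<kappa> n) (\<lambda>y. ennreal (H n y)) x \<partial>lborel)"
      by (intro sum.cong convp_adjoint[OF \<kappa>]) auto
    also have "\<dots> = (\<integral>\<^sup>+x. (\<Sum>n<N. ennreal (F n x) * convp (\<kappa> n) (\<lambda>y. ennreal (H n y)) x) \<partial>lborel)"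
      by (intro nn_integral_sum[symmetric]) (simp add: V(1)[symmetric])
    also have "\<dots> \<le> (\<integral>\<^sup>+x. (ennreal (\<delta> powr (- p)) * ennreal (sqf N F x powr (p / 2))
        + ennreal (\<delta> powr q) * ennreal (sqf N V x powr (q / 2))) * indicator {0<..<T} x \<partial>lborel)"
    proof (rule nn_integral_mono)
      fix x
      show "(\<Sum>n<N. ennreal (F n x) * convp (\<kappa> n) (\<lambda>y. ennreal (H n y)) x)
        \<le> (ennreal (\<delta> powr (- p)) * ennreal (sqf N F x powr (p / 2))
        + ennreal (\<delta> powr q) * ennreal (sqf N V x powr (q / 2))) * indicator {0<..<T} x"
      proof (cases "x \<in> {0<..<T}")
        case True
        have "(\<Sum>n<N. ennreal (F n x) * convp (\<kappa> n) (\<lambda>y. ennreal (H n y)) x) = ennreal (\<Sum>n<N. F n x * V n x)"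
          using V F0 by (subst sum_ennreal[symmetric]) (auto simp: ennreal_mult')
        also have "\<dots> \<le> ennreal (sqf N F x powr (1 / 2) * sqf N V x powr (1 / 2))"
        proof (rule ennreal_leI)
          have "(\<Sum>n<N. F n x * V n x) \<le> (\<Sum>n<N. \<bar>F n x\<bar> * \<bar>V n x\<bar>)"
            by (intro sum_mono) (simp add: abs_mult[symmetric])
          also have "\<dots> \<le> L2_set (\<lambda>n. F n x) {..<N} * L2_set (\<lambda>n. V n x) {..<N}"
            by (rule L2_set_mult_ineq)
          also have "\<dots> = sqf N F x powr (1 / 2) * sqf N V x powr (1 / 2)"
            by (simp add: L2_set_def sqf_def[symmetric] powr_half_sqrt)
          finally show "(\<Sum>n<N. F n x * V n x) \<le> sqf N F x powr (1 / 2) * sqf N V x powr (1 / 2)" .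
        qed
        also have "\<dots> \<le> ennreal (\<delta> powr (- p) * (sqf N F x powr (1 / 2)) powr p + \<delta> powr q * (sqf N V x powr (1 / 2)) powr q)"
          using p q \<delta> by (intro ennreal_leI Youngs_inequality_scaled) auto
        finally show ?thesis using True
          by (simp add: powr_powr ennreal_mult'[symmetric] ennreal_plus[symmetric] del: ennreal_plus)
      next
        case False
        then have "F n x = 0" for n using F by (auto simp: bdd_family_def)
        then show ?thesis by simp
      qed
    qed
    also have "\<dots> = ennreal (\<delta> powr (- p)) * Z + ennreal (\<delta> powr q) *
        l2int q T N V"
      unfolding Z_def distrib_right mult.assoc by (subst nn_integral_add) (auto simp: nn_integral_cmult)
    also have "\<dots> \<le> ennreal (\<delta> powr (- p)) * Z + ennreal (\<delta> powr q) *
        (ennreal Cq * l2int q T N H)"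
      unfolding V_def by (intro add_left_mono mult_left_mono Cq_bound[OF \<kappa> Hbdd]) auto
    also have "l2int q T N H = X"
      unfolding X_def
    proof (rule nn_integral_cong)
      fix x
      have "(p - 1) * (q / 2) = p / 2" using p by (simp add: q_def field_simps)
      then show "ennreal (sqf N H x powr (q / 2)) * indicator {0<..<T} x
          = ennreal (G x powr (p / 2)) * indicator {0<..<T} x"
        using p q by (auto simp: sqH indicator_def powr_powr)
    qed
    also have "ennreal (\<delta> powr (- p)) * Z + ennreal (\<delta> powr q) * (ennreal Cq * X)
       = ennreal (\<delta> powr (- p)) * Z + ennreal (Cq * \<delta> powr q) * X"
      using Cq by (simp add: ennreal_mult' mult_ac)
    finally have "X \<le> 2 * (ennreal (\<delta> powr (- p)) * Z)"
      using \<delta> Xfin Cq by (intro ennreal_absorb_half[where c="Cq * \<delta> powr q"]) auto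
    also have "\<dots> = ennreal (2 * \<delta> powr (- p)) * Z"
      by (simp add: ennreal_mult' mult_ac)
    finally show ?thesis by (simp add: X_def Z_def G_def Y_def)
  qed
  then show ?thesis using \<delta> by (intro that[of "2 * \<delta> powr (- p)"]) auto
qed

lemma convf_Lp_bdd:
  fixes p M :: real
  assumes p: "1 < p" and M: "0 \<le> M"
  obtains C where "0 \<le> C"
    "\<And>\<kappa> F N B T. (\<And>n. maximal_kernel M (\<kappa> n)) \<Longrightarrow> bdd_family T B F \<Longrightarrow>
       l2int p T N (convf \<kappa> F)
         \<le> ennreal C * l2int p T N F"
proof (cases "p < 2")
  case True
  show ?thesis by (rule convf_Lp_lt2_bdd[OF p True M]) (rule that, assumption, blast)
next
  case False
  then have "2 \<le> p" by simp
  show ?thesis by (rule convf_Lp_ge2_bdd[OF \<open>2 \<le> p\<close> M]) (rule that, assumption, blast)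
qed

lemma convp_truncate_tendsto:
  fixes F :: "real \<Rightarrow> real"
  assumes [measurable]: "\<kappa> \<in> borel_measurable borel" "F \<in> borel_measurable borel"
  shows "(\<lambda>m. convp \<kappa> (\<lambda>y. ennreal (min (F y) (real m))) x) \<longlonglongrightarrow> convp \<kappa> (\<lambda>y. ennreal (F y)) x"
  unfolding convp_def
proof (rule nn_integral_LIMSEQ)
  show "incseq (\<lambda>m y. \<kappa> (x - y) * ennreal (min (F y) (real m)))"
    by (auto simp: incseq_def le_fun_def intro!: mult_left_mono ennreal_leI)
  fix y
  have "eventually (\<lambda>m. min (F y) (real m) = F y) sequentially"
    using eventually_ge_at_top[of "nat \<lceil>F y\<rceil>"] by eventually_elim linarith
  then have "eventually (\<lambda>m. \<kappa> (x - y) * ennreal (min (F y) (real m)) = \<kappa> (x - y) * ennreal (F y)) sequentially"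
    by eventually_elim simp
  then show "(\<lambda>m. \<kappa> (x - y) * ennreal (min (F y) (real m))) \<longlonglongrightarrow> \<kappa> (x - y) * ennreal (F y)"
    by (rule tendsto_eventually)
qed measurable

text \<open>The bounded case is applied to F cut at height m. At points where all the convolutions
  are finite the truncated ones converge to them, and Fatou's lemma carries the bound over, since
  the constant does not depend on m.\<close>

theorem convf_Lp:
  fixes p M :: real
  assumes p: "1 < p" and M: "0 \<le> M"
  obtains C where "0 \<le> C"
    "\<And>\<kappa> F N T. (\<And>n. maximal_kernel M (\<kappa> n)) \<Longrightarrow> (\<And>n. F n \<in> borel_measurable borel) \<Longrightarrow>
       (\<And>n x. 0 \<le> F n x) \<Longrightarrow> (\<And>n x. x \<notin> {0<..<T} \<Longrightarrow> F n x = 0) \<Longrightarrow>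
       (\<And>n. AE x in lborel. convp (\<kappa> n) (\<lambda>y. ennreal (F n y)) x < \<infinity>) \<Longrightarrow>
       l2int p T N (convf \<kappa> F)
         \<le> ennreal C * l2int p T N F"
proof -
  obtain C where C: "0 \<le> C" and Cb: "\<And>\<kappa> F N B T. (\<And>n. maximal_kernel M (\<kappa> n)) \<Longrightarrow> bdd_family T B F \<Longrightarrow>
       l2int p T N (convf \<kappa> F)
         \<le> ennreal C * l2int p T N F"
    using convf_Lp_bdd[OF p M] by blast
  show ?thesis
  proof (rule that[OF C])
    fix \<kappa> :: "nat \<Rightarrow> real \<Rightarrow> ennreal" and F :: "nat \<Rightarrow> real \<Rightarrow> real" and N T
    assume \<kappa>: "\<And>n. maximal_kernel M (\<kappa> n)"
      and F [measurable]: "\<And>n. F n \<in> borel_measurable borel"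
      and F0: "\<And>n x. 0 \<le> F n x" "\<And>n x. x \<notin> {0<..<T} \<Longrightarrow> F n x = 0"
      and fin: "\<And>n. AE x in lborel. convp (\<kappa> n) (\<lambda>y. ennreal (F n y)) x < \<infinity>"
    define Fm where "Fm m n x = min (F n x) (real m)" for m n x
    have [measurable]: "Fm m n \<in> borel_measurable borel" for m n unfolding Fm_def by measurable
    have bdd: "bdd_family T (real m) (Fm m)" for m
      using F0 by (auto simp: bdd_family_def Fm_def)
    have [measurable]: "convf \<kappa> (Fm m) n \<in> borel_measurable borel" for m n
      by (rule borel_measurable_convf[OF \<kappa>]) measurable
    define h where "h m x = ennreal (sqf N (convf \<kappa> (Fm m)) x powr (p / 2)) * indicator {0<..<T} x" for m x
    have [measurable]: "h m \<in> borel_measurable borel" for m unfolding h_def by measurable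
    have "AE x in lborel. \<forall>n. convp (\<kappa> n) (\<lambda>y. ennreal (F n y)) x < \<infinity>"
      using fin by (simp add: AE_all_countable)
    then have AE: "AE x in lborel. ennreal (sqf N (convf \<kappa> F) x powr (p / 2)) * indicator {0<..<T} x
        \<le> liminf (\<lambda>m. h m x)"
    proof eventually_elim
      case (elim x)
      have "(\<lambda>m. convf \<kappa> (Fm m) n x) \<longlonglongrightarrow> convf \<kappa> F n x" for n
        unfolding convf_def Fm_def
        using elim convp_truncate_tendsto[OF maximal_kernel_measurable[OF \<kappa>] F]
        by (intro tendsto_enn2real) auto
      then have "(\<lambda>m. sqf N (convf \<kappa> (Fm m)) x) \<longlonglongrightarrow> sqf N (convf \<kappa> F) x"
        unfolding sqf_def by (intro tendsto_intros)
      then have "(\<lambda>m. sqf N (convf \<kappa> (Fm m)) x powr (p / 2)) \<longlonglongrightarrow> sqf N (convf \<kappa> F) x powr (p / 2)"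
        using p by (intro tendsto_powr2) auto
      then have "(\<lambda>m. ennreal (sqf N (convf \<kappa> (Fm m)) x powr (p / 2)))
          \<longlonglongrightarrow> ennreal (sqf N (convf \<kappa> F) x powr (p / 2))"
        by (rule tendsto_ennrealI)
      then have "(\<lambda>m. h m x) \<longlonglongrightarrow> ennreal (sqf N (convf \<kappa> F) x powr (p / 2)) * indicator {0<..<T} x"
        unfolding h_def by (cases "x \<in> {0<..<T}") auto
      then show ?case by (simp add: lim_imp_Liminf)
    qed
    have "l2int p T N (convf \<kappa> F)
        \<le> (\<integral>\<^sup>+x. liminf (\<lambda>m. h m x) \<partial>lborel)"
      by (rule nn_integral_mono_AE[OF AE])
    also have "\<dots> \<le> liminf (\<lambda>m. \<integral>\<^sup>+x. h m x \<partial>lborel)"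
      by (rule nn_integral_liminf) measurable
    also have "\<dots> \<le> liminf (\<lambda>m. ennreal C * l2int p T N F)"
    proof (intro Liminf_mono always_eventually allI)
      fix m
      have "(\<integral>\<^sup>+x. h m x \<partial>lborel)
          \<le> ennreal C * l2int p T N (Fm m)"
        unfolding h_def by (rule Cb[OF \<kappa> bdd])
      also have "\<dots> \<le> ennreal C * l2int p T N F"
        unfolding sqf_def Fm_def using F0 p
        by (intro mult_left_mono nn_integral_mono mult_right_mono ennreal_leI powr_mono2 sum_mono power_mono sum_nonneg) auto
      finally show "(\<integral>\<^sup>+x. h m x \<partial>lborel)
          \<le> ennreal C * l2int p T N F" .
    qed
    also have "\<dots> = ennreal C * l2int p T N F"
      by (simp add: Liminf_const)
    finally show "l2int p T N (convf \<kappa> F)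
         \<le> ennreal C * l2int p T N F" .
  qed
qed

section \<open>Even majorants, decreasing in the distance from 0, for the kernels of the
  modes\<close>

definition ml_kernel :: "real \<Rightarrow> real \<Rightarrow> real \<Rightarrow> ennreal" where
  "ml_kernel \<alpha> l x = (\<integral>\<^sup>+\<rho>. ennreal (\<rho> powr (- 2) * min (l * \<rho> powr \<alpha>) (1 / (l * \<rho> powr \<alpha>)))
     * indicator {\<bar>x\<bar><..} \<rho> \<partial>lborel)"

text \<open>Scale invariance removes \<open>l\<close>: with y = l \<rho>^\<alpha> and d\<rho>/\<rho>
  = dy/(\<alpha> y), the moment required for a superposition is (2/\<alpha>) times the integral of
  min(y, 1/y) dy/y over (0, \<infinity>), which is 2. The proof splits at the radius r where l
  r^\<alpha> = 1.\<close>

lemma maximal_kernel_ml_kernel: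
  assumes \<alpha>: "0 < \<alpha>" and l: "0 < l"
  shows "maximal_kernel (4 / \<alpha>) (ml_kernel \<alpha> l)"
  unfolding ml_kernel_def[abs_def]
proof (rule maximal_kernel_superposition)
  define r where "r = l powr (- 1 / \<alpha>)"
  have r: "0 < r" using l by (simp add: r_def)
  have ra: "r powr \<alpha> = 1 / l" "r powr (- \<alpha>) = l"
    unfolding r_def powr_powr using \<alpha> l by (simp_all add: powr_minus_divide)
  have I2: "(\<integral>\<^sup>+\<rho>. ennreal (\<rho> powr (- 1 - \<alpha>)) * indicator {r..} \<rho> \<partial>lborel) = ennreal (l / \<alpha>)"
  proof -
    have "((\<lambda>\<rho>. \<rho> powr (- 1 - \<alpha>)) has_integral - (r powr (- 1 - \<alpha> + 1)) / (- 1 - \<alpha> + 1)) {r..}"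
      using \<alpha> r by (intro has_integral_powr_to_inf) auto
    then have "((\<lambda>\<rho>. \<rho> powr (- 1 - \<alpha>)) has_integral (l / \<alpha>)) {r..}"
      using ra by simp
    then have "(\<integral>\<^sup>+\<rho>. ennreal (indicator {r..} \<rho> * \<rho> powr (- 1 - \<alpha>)) \<partial>lborel) = ennreal (l / \<alpha>)"
      by (intro nn_integral_has_integral_lebesgue) auto
    then show ?thesis
      by (subst (asm) nn_integral_cong[where v="\<lambda>\<rho>. ennreal (\<rho> powr (- 1 - \<alpha>)) * indicator {r..} \<rho>"])
        (auto simp: indicator_def)
  qed
  have "(\<integral>\<^sup>+\<rho>. ennreal (\<rho> powr (- 2) * min (l * \<rho> powr \<alpha>) (1 / (l * \<rho> powr \<alpha>))) * ennreal (2 * \<rho>) * indicator {0<..} \<rho> \<partial>lborel)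
     \<le> (\<integral>\<^sup>+\<rho>. ennreal (2 * l) * (ennreal (\<rho> powr (\<alpha> - 1)) * indicator {0<..<r} \<rho>)
        + ennreal (2 / l) * (ennreal (\<rho> powr (- 1 - \<alpha>)) * indicator {r..} \<rho>) \<partial>lborel)"
  proof (rule nn_integral_mono)
    fix \<rho> :: real
    show "ennreal (\<rho> powr (- 2) * min (l * \<rho> powr \<alpha>) (1 / (l * \<rho> powr \<alpha>))) * ennreal (2 * \<rho>) * indicator {0<..} \<rho>
      \<le> ennreal (2 * l) * (ennreal (\<rho> powr (\<alpha> - 1)) * indicator {0<..<r} \<rho>)
        + ennreal (2 / l) * (ennreal (\<rho> powr (- 1 - \<alpha>)) * indicator {r..} \<rho>)"
    proof (cases "0 < \<rho>")
      case True
      have e1: "\<rho> powr (- 2) * (l * \<rho> powr \<alpha>) * (2 * \<rho>) = 2 * l * \<rho> powr (\<alpha> - 1)"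
        using True by (simp add: powr_minus powr_diff divide_simps powr_numeral power2_eq_square)
      have e2: "\<rho> powr (- 2) * (1 / (l * \<rho> powr \<alpha>)) * (2 * \<rho>) = 2 / l * \<rho> powr (- 1 - \<alpha>)"
        using True l by (simp add: powr_minus powr_diff divide_simps powr_numeral power2_eq_square)
      have "\<rho> powr (- 2) * min (l * \<rho> powr \<alpha>) (1 / (l * \<rho> powr \<alpha>)) * (2 * \<rho>)
          \<le> (if \<rho> < r then 2 * l * \<rho> powr (\<alpha> - 1) else 2 / l * \<rho> powr (- 1 - \<alpha>))"
      proof (cases "\<rho> < r")
        case True
        then show ?thesis unfolding if_P[OF True] e1[symmetric]
          using \<open>0 < \<rho>\<close> by (intro mult_right_mono mult_left_mono) auto
      next
        case False
        then show ?thesis unfolding if_not_P[OF False] e2[symmetric]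
          using \<open>0 < \<rho>\<close> by (intro mult_right_mono mult_left_mono) auto
      qed
      then show ?thesis using True l
        by (auto simp: indicator_def ennreal_mult'[symmetric] intro!: ennreal_leI split: if_splits)
    qed auto
  qed
  also have "\<dots> = ennreal (2 * l) * ennreal (r powr \<alpha> / \<alpha>) + ennreal (2 / l) * ennreal (l / \<alpha>)"
    using \<alpha> r by (subst nn_integral_add) (auto simp: nn_integral_cmult nn_integral_powr_from_0 I2)
  also have "\<dots> = ennreal (4 / \<alpha>)"
    using l \<alpha> by (simp add: ra ennreal_mult'[symmetric] ennreal_plus[symmetric] del: ennreal_plus)
  finally show "(\<integral>\<^sup>+\<rho>. ennreal (\<rho> powr (- 2) * min (l * \<rho> powr \<alpha>) (1 / (l * \<rho> powr \<alpha>))) * ennreal (2 * \<rho>) * indicator {0<..} \<rho> \<partial>lborel)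
      \<le> ennreal (4 / \<alpha>)" by simp
qed measurable

text \<open>Only the radii in (t, 2t) are kept. There \<rho>^{-2} \<ge> 1/(4 t^2), and the minimum
  drops by at most a factor 2 because \<rho>^\<alpha> \<le> 2 t^\<alpha> for \<alpha> < 1. The
  interval has length t, whence the factor 8 = 4 * 2.\<close>

lemma ml_kernel_ge:
  assumes \<alpha>: "0 < \<alpha>" "\<alpha> < 1" and l: "0 < l" and t: "0 < t"
  shows "ennreal (min (l * t powr \<alpha>) (1 / (l * t powr \<alpha>)) / t) \<le> 8 * ml_kernel \<alpha> l t"
proof -
  define m where "m = min (l * t powr \<alpha>) (1 / (l * t powr \<alpha>))"
  have m: "0 \<le> m" using l t by (simp add: m_def)
  have "ennreal (m / t) = 8 * (\<integral>\<^sup>+\<rho>. ennreal (m / (8 * t\<^sup>2)) * indicator {t<..<2*t} \<rho> \<partial>lborel)"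
  proof -
    have "(\<integral>\<^sup>+\<rho>. ennreal (m / (8 * t\<^sup>2)) * indicator {t<..<2*t} \<rho> \<partial>lborel) = ennreal (m / (8 * t\<^sup>2)) * ennreal t"
      using t by (subst nn_integral_cmult_indicator) auto
    also have "8 * \<dots> = ennreal (8 * (m / (8 * t\<^sup>2) * t))"
      using t m by (simp add: ennreal_mult'[symmetric] flip: ennreal_numeral)
    also have "8 * (m / (8 * t\<^sup>2) * t) = m / t" using t by (simp add: power2_eq_square)
    finally show ?thesis by simp
  qed
  also have "\<dots> \<le> 8 * ml_kernel \<alpha> l t"
    unfolding ml_kernel_def
  proof (intro mult_left_mono nn_integral_mono)
    fix \<rho> :: real
    show "ennreal (m / (8 * t\<^sup>2)) * indicator {t<..<2*t} \<rho>
      \<le> ennreal (\<rho> powr (- 2) * min (l * \<rho> powr \<alpha>) (1 / (l * \<rho> powr \<alpha>))) * indicator {\<bar>t\<bar><..} \<rho>"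
    proof (cases "\<rho> \<in> {t<..<2*t}")
      case True
      have u: "t powr \<alpha> \<le> \<rho> powr \<alpha>" using True t \<alpha> by (intro powr_mono2) auto
      have "\<rho> powr \<alpha> \<le> (2 * t) powr \<alpha>" using True t \<alpha> by (intro powr_mono2) auto
      also have "\<dots> = 2 powr \<alpha> * t powr \<alpha>" using t by (simp add: powr_mult)
      also have "\<dots> \<le> 2 powr 1 * t powr \<alpha>" using \<alpha> by (intro mult_right_mono powr_mono) auto
      finally have v: "\<rho> powr \<alpha> \<le> 2 * t powr \<alpha>" by simp
      have "m / 2 \<le> l * t powr \<alpha>" using m by (simp add: m_def)
      also have "\<dots> \<le> l * \<rho> powr \<alpha>" using u l by simp
      finally have a: "m / 2 \<le> l * \<rho> powr \<alpha>" .
      have "m / 2 \<le> 1 / (l * (2 * t powr \<alpha>))" by (simp add: m_def min_def field_simps)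
      also have "\<dots> \<le> 1 / (l * \<rho> powr \<alpha>)"
        using v l t True by (intro divide_left_mono mult_left_mono mult_pos_pos) auto
      finally have b: "m / 2 \<le> 1 / (l * \<rho> powr \<alpha>)" .
      have "\<rho> powr 2 \<le> (2 * t) powr 2" using True t by (intro powr_mono2) auto
      then have "1 / (4 * t\<^sup>2) \<le> \<rho> powr (- 2)"
        using True t by (simp add: powr_minus powr_numeral divide_simps power_mult_distrib)
      then have "1 / (4 * t\<^sup>2) * (m / 2) \<le> \<rho> powr (- 2) * min (l * \<rho> powr \<alpha>) (1 / (l * \<rho> powr \<alpha>))"
        using a b m by (intro mult_mono) auto
      then show ?thesis using True t by (auto intro!: ennreal_leI)
    qed auto
  qed auto
  finally show ?thesis by (simp add: m_def)
qed

section \<open>Hankel contours and Mittag-Leffler functions\<close>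

text \<open>Contour integrals along Hankel contours are written in the logarithmic coordinate \<open>s = exp w\<close>, in
  which the sector becomes a horizontal strip and the circular arc a vertical segment. The integral
  over the whole contour is the limit of the integrals \<open>vert\<close> over vertical segments.\<close>

definition strip :: "real \<Rightarrow> complex set" where
  "strip \<theta> = {w. \<bar>Im w\<bar> < \<theta>}"

lemma convex_strip: "convex (strip \<theta>)" and open_strip: "open (strip \<theta>)"
proof -
  have *: "strip \<theta> = {w. Im w < \<theta>} \<inter> {w. - \<theta> < Im w}" by (auto simp: strip_def)
  show "convex (strip \<theta>)" unfolding *
    by (intro convex_Int convex_halfspace_Im_lt convex_halfspace_Im_gt)
  show "open (strip \<theta>)" unfolding *
    by (intro open_Int open_halfspace_Im_lt open_halfspace_Im_gt)
qed

definition vert :: "real \<Rightarrow> (complex \<Rightarrow> complex) \<Rightarrow> real \<Rightarrow> complex" where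
  "vert \<theta> \<phi> b = integral {- \<theta>..\<theta>} (\<lambda>y. \<i> * \<phi> (Complex b y))"

lemma Complex_has_vector_derivative:
  "((\<lambda>y. Complex b y) has_vector_derivative \<i>) (at y within S)"
  "((\<lambda>x. Complex x b) has_vector_derivative 1) (at y within S)"
  unfolding Complex_eq by (auto intro!: derivative_eq_intros)

lemma strip_primitive_integrals:
  assumes \<Phi>: "\<And>w. w \<in> strip \<theta>' \<Longrightarrow> (\<Phi> has_field_derivative \<phi> w) (at w)"
    and \<theta>: "0 < \<theta>" "\<theta> < \<theta>'"
  shows "((\<lambda>y. \<i> * \<phi> (Complex b y)) has_integral (\<Phi> (Complex b \<theta>) - \<Phi> (Complex b (- \<theta>)))) {- \<theta>..\<theta>}"
    and "a \<le> b \<Longrightarrow> \<bar>y\<bar> \<le> \<theta> \<Longrightarrow>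
      ((\<lambda>x. \<phi> (Complex x y)) has_integral (\<Phi> (Complex b y) - \<Phi> (Complex a y))) {a..b}"
proof -
  show "((\<lambda>y. \<i> * \<phi> (Complex b y)) has_integral (\<Phi> (Complex b \<theta>) - \<Phi> (Complex b (- \<theta>)))) {- \<theta>..\<theta>}"
  proof (rule fundamental_theorem_of_calculus)
    fix y assume y: "y \<in> {- \<theta>..\<theta>}"
    have "((\<Phi> \<circ> (\<lambda>y. Complex b y)) has_vector_derivative \<i> * \<phi> (Complex b y)) (at y within {- \<theta>..\<theta>})"
      using y \<theta> by (intro field_vector_diff_chain_within Complex_has_vector_derivative
          has_field_derivative_at_within[OF \<Phi>]) (auto simp: strip_def)
    then show "((\<lambda>y. \<Phi> (Complex b y)) has_vector_derivative \<i> * \<phi> (Complex b y)) (at y within {- \<theta>..\<theta>})"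
      by (simp add: o_def)
  qed (use \<theta> in auto)
  assume ab: "a \<le> b" and y: "\<bar>y\<bar> \<le> \<theta>"
  show "((\<lambda>x. \<phi> (Complex x y)) has_integral (\<Phi> (Complex b y) - \<Phi> (Complex a y))) {a..b}"
  proof (rule fundamental_theorem_of_calculus[OF ab])
    fix x assume x: "x \<in> {a..b}"
    have "((\<Phi> \<circ> (\<lambda>x. Complex x y)) has_vector_derivative 1 * \<phi> (Complex x y)) (at x within {a..b})"
      using y \<theta> by (intro field_vector_diff_chain_within Complex_has_vector_derivative
          has_field_derivative_at_within[OF \<Phi>]) (auto simp: strip_def)
    then show "((\<lambda>x. \<Phi> (Complex x y)) has_vector_derivative \<phi> (Complex x y)) (at x within {a..b})"
      by (simp add: o_def)
  qed
qed

text \<open>On the convex strip a holomorphic function has a primitive. Cauchy's theorem for a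
  rectangle becomes the fundamental theorem of calculus on its four sides, so moving the vertical
  segment costs exactly the two horizontal sides.\<close>

lemma vert_has_integral:
  assumes "\<phi> holomorphic_on strip \<theta>'" "0 < \<theta>" "\<theta> < \<theta>'"
  shows "((\<lambda>y. \<i> * \<phi> (Complex b y)) has_integral vert \<theta> \<phi> b) {- \<theta>..\<theta>}"
    and vert_rectangle: "a \<le> b \<Longrightarrow>
      ((\<lambda>x. \<phi> (Complex x \<theta>) - \<phi> (Complex x (- \<theta>))) has_integral (vert \<theta> \<phi> b - vert \<theta> \<phi> a)) {a..b}"
proof -
  obtain \<Phi> where "\<And>w. w \<in> strip \<theta>' \<Longrightarrow> (\<Phi> has_field_derivative \<phi> w) (at w within strip \<theta>')"
    using holomorphic_convex_primitive'[OF convex_strip open_strip assms(1)] by blast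
  then have \<Phi>: "\<And>w. w \<in> strip \<theta>' \<Longrightarrow> (\<Phi> has_field_derivative \<phi> w) (at w)"
    using at_within_open[OF _ open_strip] by metis
  have I: "((\<lambda>y. \<i> * \<phi> (Complex b y)) has_integral (\<Phi> (Complex b \<theta>) - \<Phi> (Complex b (- \<theta>)))) {- \<theta>..\<theta>}"
      "\<And>y. a \<le> b \<Longrightarrow> \<bar>y\<bar> \<le> \<theta> \<Longrightarrow>
        ((\<lambda>x. \<phi> (Complex x y)) has_integral (\<Phi> (Complex b y) - \<Phi> (Complex a y))) {a..b}" for a b
    using strip_primitive_integrals[OF \<Phi> assms(2,3)] by blast+
  have V: "vert \<theta> \<phi> b = \<Phi> (Complex b \<theta>) - \<Phi> (Complex b (- \<theta>))" for b
    unfolding vert_def by (rule integral_unique[OF I(1)])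
  show "((\<lambda>y. \<i> * \<phi> (Complex b y)) has_integral vert \<theta> \<phi> b) {- \<theta>..\<theta>}"
    unfolding V by (rule I(1))
  assume "a \<le> b"
  from has_integral_diff[OF I(2)[OF this, of \<theta>] I(2)[OF this, of "- \<theta>"]] assms(2)
  show "((\<lambda>x. \<phi> (Complex x \<theta>) - \<phi> (Complex x (- \<theta>))) has_integral (vert \<theta> \<phi> b - vert \<theta> \<phi> a)) {a..b}"
    unfolding V by (simp add: algebra_simps)
qed

lemma vert_bound:
  assumes "\<phi> holomorphic_on strip \<theta>'" "0 < \<theta>" "\<theta> < \<theta>'"
    and "\<And>y. \<bar>y\<bar> \<le> \<theta> \<Longrightarrow> norm (\<phi> (Complex b y)) \<le> B"
  shows "norm (vert \<theta> \<phi> b) \<le> B * (2 * \<theta>)"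
proof -
  have "0 \<le> B" using assms(4)[of 0] assms(2) norm_ge_zero[of "\<phi> (Complex b 0)"] by linarith
  then have "norm (vert \<theta> \<phi> b) \<le> B * Henstock_Kurzweil_Integration.content {- \<theta>..\<theta>}"
    using assms(2,4)
    by (intro has_integral_bound_real[OF _ _ vert_has_integral(1)[OF assms(1-3)], of B "{}" b])
      (auto simp: norm_mult abs_le_iff)
  then show ?thesis using assms(2) by simp
qed

text \<open>The pullback of e^s s^{-\<beta>} ds under s = exp w, the Hankel integrand of
  1/\<Gamma>(\<beta>). In this coordinate it is entire, and the branch cut of s^{-\<beta>} has
  disappeared.\<close>

definition hk :: "real \<Rightarrow> complex \<Rightarrow> complex" where
  "hk \<beta> w = exp (exp w + of_real (1 - \<beta>) * w)"

lemma hk_holomorphic: "hk \<beta> holomorphic_on S"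
  unfolding hk_def[abs_def] by (intro holomorphic_intros)

lemma norm_hk: "norm (hk \<beta> (Complex x y)) = exp (exp x * cos y + (1 - \<beta>) * x)"
  by (simp add: hk_def Re_exp)

lemma double_exp_tendsto_0:
  fixes c \<gamma> :: real
  assumes "c < 0"
  shows "(\<lambda>k. exp (exp (real k) * c + \<gamma> * real k)) \<longlonglongrightarrow> 0"
proof -
  have "((\<lambda>x::real. exp (exp x * c + \<gamma> * x)) \<longlongrightarrow> 0) at_top"
    using assms by real_asymp
  then show ?thesis by (rule filterlim_compose) (rule filterlim_real_sequentially)
qed

text \<open>Integration by parts: e^s s^{-\<beta>} is a primitive of the difference of the two
  integrands, and its values at the ends of the segment tend to 0 because cos \<theta> < 0. This
  mirrors 1/\<Gamma>(\<beta>) = \<beta>/\<Gamma>(\<beta> + 1).\<close>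

lemma hk_recursion:
  assumes \<theta>: "pi / 2 < \<theta>" "\<theta> \<le> pi"
  shows "(\<lambda>k. vert \<theta> (hk \<beta>) (real k) - of_real \<beta> * vert \<theta> (hk (\<beta> + 1)) (real k)) \<longlonglongrightarrow> 0"
proof (rule Lim_null_comparison)
  define E where "E w = exp (exp w - of_real \<beta> * w)" for w :: complex
  have D: "(E has_field_derivative (hk \<beta> w - of_real \<beta> * hk (\<beta> + 1) w)) (at w)" for w
  proof -
    have "(E has_field_derivative exp (exp w - of_real \<beta> * w) * (exp w - of_real \<beta>)) (at w)"
      unfolding E_def by (auto intro!: derivative_eq_intros)
    moreover have "hk \<beta> w = exp (exp w - of_real \<beta> * w) * exp w"
      unfolding hk_def exp_add[symmetric] by (simp add: algebra_simps)
    moreover have "hk (\<beta> + 1) w = exp (exp w - of_real \<beta> * w)"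
      by (simp add: hk_def algebra_simps)
    ultimately show ?thesis by (simp add: algebra_simps)
  qed
  have "vert \<theta> (hk \<beta>) b - of_real \<beta> * vert \<theta> (hk (\<beta> + 1)) b = E (Complex b \<theta>) - E (Complex b (- \<theta>))" for b
  proof -
    have "((\<lambda>y. \<i> * (hk \<beta> (Complex b y) - of_real \<beta> * hk (\<beta> + 1) (Complex b y)))
        has_integral (E (Complex b \<theta>) - E (Complex b (- \<theta>)))) {- \<theta>..\<theta>}"
      using \<theta> pi_gt_zero by (intro strip_primitive_integrals(1)[of "\<theta> + 1", OF D]) linarith+
    moreover have "((\<lambda>y. \<i> * hk \<beta> (Complex b y) - of_real \<beta> * (\<i> * hk (\<beta> + 1) (Complex b y)))
        has_integral (vert \<theta> (hk \<beta>) b - of_real \<beta> * vert \<theta> (hk (\<beta> + 1)) b)) {- \<theta>..\<theta>}"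
      using \<theta> pi_gt_zero
      by (intro has_integral_diff has_integral_mult_right vert_has_integral[of _ "\<theta> + 1"] hk_holomorphic)
        linarith+
    moreover have "\<i> * (hk \<beta> (Complex b y) - of_real \<beta> * hk (\<beta> + 1) (Complex b y))
        = \<i> * hk \<beta> (Complex b y) - of_real \<beta> * (\<i> * hk (\<beta> + 1) (Complex b y))" for y
      by (simp add: algebra_simps)
    ultimately show ?thesis by (simp only: has_integral_unique)
  qed
  moreover have "norm (E (Complex b y)) = exp (exp b * cos y + (- \<beta>) * b)" for b y
    by (simp add: E_def Re_exp)
  ultimately have "norm (vert \<theta> (hk \<beta>) b - of_real \<beta> * vert \<theta> (hk (\<beta> + 1)) b)
      \<le> 2 * exp (exp b * cos \<theta> + (- \<beta>) * b)" for b
    using norm_triangle_ineq4[of "E (Complex b \<theta>)" "E (Complex b (- \<theta>))"] by simp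
  then show "\<forall>\<^sub>F k in sequentially. norm (vert \<theta> (hk \<beta>) (real k) - of_real \<beta> * vert \<theta> (hk (\<beta> + 1)) (real k))
      \<le> 2 * exp (exp (real k) * cos \<theta> + (- \<beta>) * real k)"
    by simp
  have "cos \<theta> < 0" using \<theta> by (intro cos_lt_zero_pi) auto
  from tendsto_mult_right_zero[OF double_exp_tendsto_0[OF this]]
  show "(\<lambda>k. 2 * exp (exp (real k) * cos \<theta> + (- \<beta>) * real k)) \<longlonglongrightarrow> 0" .
qed

text \<open>The contour collapses onto the negative real axis. For \<beta> < 1 the vertical segment
  far to the left contributes nothing, the two horizontal sides combine into a Gamma integral, and
  the reflection formula identifies the value.\<close>

lemma hankel_pi_01:
  assumes \<beta>: "0 < \<beta>" "\<beta> < 1"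
  shows "(\<lambda>k. vert pi (hk \<beta>) (real k)) \<longlonglongrightarrow> 2 * of_real pi * \<i> * of_real (rGamma \<beta>)"
proof -
  define g where "g t = t powr (- \<beta>) * exp (- t)" for t :: real
  define c where "c = 2 * \<i> * of_real (sin (pi * (1 - \<beta>)))"
  have G: "(g has_integral Gamma (1 - \<beta>)) {0..}"
    using Gamma_integral_real[of "1 - \<beta>"] \<beta>
    by (simp add: g_def[abs_def] exp_minus divide_inverse)
  have vert_low: "(\<lambda>k. vert pi (hk \<beta>) (- real k)) \<longlonglongrightarrow> 0"
  proof (rule Lim_null_comparison)
    show "\<forall>\<^sub>F k in sequentially. norm (vert pi (hk \<beta>) (- real k)) \<le> exp (1 - (1 - \<beta>) * real k) * (2 * pi)"
    proof (intro always_eventually allI vert_bound[of _ "pi + 1"] hk_holomorphic)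
      fix k y
      have "exp (- real k) * cos y \<le> exp (- real k) * 1" by (intro mult_left_mono) auto
      also have "\<dots> \<le> 1" by simp
      finally have "exp (- real k) * cos y \<le> 1" .
      then show "norm (hk \<beta> (Complex (- real k) y)) \<le> exp (1 - (1 - \<beta>) * real k)"
        unfolding norm_hk by simp
    qed auto
    show "(\<lambda>k. exp (1 - (1 - \<beta>) * real k) * (2 * pi)) \<longlonglongrightarrow> 0"
      using \<beta> by real_asymp
  qed
  \<comment> \<open>On Im w = \<plusminus>\<pi> the exponential exp w is -exp x on both sides, and
    only the phases of s^{1-\<beta>} differ; their difference is \<open>c\<close>.\<close>
  have line: "hk \<beta> (Complex x pi) - hk \<beta> (Complex x (- pi)) = c * of_real (exp (- exp x + (1 - \<beta>) * x))" for x
  proof -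
    have *: "hk \<beta> (Complex x y) = of_real (exp (- exp x + (1 - \<beta>) * x)) * cis ((1 - \<beta>) * y)"
      if "y = pi \<or> y = - pi" for y
    proof -
      have "exp (Complex x y) = of_real (- exp x)"
        using that by (auto simp: exp_eq_polar complex_eq_iff)
      moreover have "Complex x y = of_real x + \<i> * of_real y" by (simp add: complex_eq_iff)
      ultimately show ?thesis
        by (simp add: hk_def exp_add[symmetric] exp_of_real[symmetric] cis_conv_exp algebra_simps)
    qed
    have "cis ((1 - \<beta>) * pi) - cis ((1 - \<beta>) * (- pi)) = c"
      by (simp add: c_def complex_eq_iff mult.commute)
    then show ?thesis using *[of pi] *[of "- pi"] by (simp add: algebra_simps)
  qed
  define I where "I k = integral {exp (- real k)..exp (real k)} g" for k
  \<comment> \<open>The substitution t = exp x turns the integral along the sides into the truncated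
    integral \<open>I k\<close> for \<Gamma>(1 - \<beta>).\<close>
  have "vert pi (hk \<beta>) (real k) - vert pi (hk \<beta>) (- real k) = c * of_real (I k)" for k
  proof -
    have "((\<lambda>x. exp x *\<^sub>R g (exp x)) has_integral I k) {- real k..real k}"
      unfolding I_def
    proof (rule has_integral_substitution[where c="exp (- real k)" and d="exp (real k)"])
      show "continuous_on {exp (- real k)..exp (real k)} g" unfolding g_def
        by (intro continuous_intros) (auto simp: less_le_trans[OF exp_gt_zero])
      show "(exp has_real_derivative exp x) (at x within {- real k..real k})" for x
        by (auto intro!: derivative_eq_intros)
    qed auto
    moreover have "exp x *\<^sub>R g (exp x) = exp (- exp x + (1 - \<beta>) * x)" for x
      by (simp add: g_def powr_def exp_add[symmetric] algebra_simps)
    ultimately have "((\<lambda>x. exp (- exp x + (1 - \<beta>) * x)) has_integral I k) {- real k..real k}"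
      by simp
    then have "((\<lambda>x. c * of_real (exp (- exp x + (1 - \<beta>) * x))) has_integral c * of_real (I k)) {- real k..real k}"
      by (intro has_integral_mult_right has_integral_of_real)
    moreover have "((\<lambda>x. c * of_real (exp (- exp x + (1 - \<beta>) * x)))
       has_integral vert pi (hk \<beta>) (real k) - vert pi (hk \<beta>) (- real k)) {- real k..real k}"
      unfolding line[symmetric] by (intro vert_rectangle[of _ "pi + 1"] hk_holomorphic) auto
    ultimately show ?thesis by (metis has_integral_unique)
  qed
  then have V: "vert pi (hk \<beta>) (real k) = vert pi (hk \<beta>) (- real k) + c * of_real (I k)" for k
    by (metis add.commute diff_add_cancel)
  have "I \<longlonglongrightarrow> Gamma (1 - \<beta>)"
  proof -
    define f where "f k t = (if t \<in> {exp (- real k)..exp (real k)} then g t else 0)" for k t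
    have "(\<lambda>k. integral {0..} (f k)) \<longlonglongrightarrow> integral {0..} g"
    proof (rule dominated_convergence(2)[where h=g])
      fix k :: nat
      have "f k integrable_on UNIV \<longleftrightarrow> g integrable_on {exp (- real k)..exp (real k)}"
        unfolding f_def by (rule integrable_restrict_UNIV)
      moreover have "g integrable_on {exp (- real k)..exp (real k)}"
        using G by (intro integrable_on_subinterval[of g "{0..}"]) (auto simp: integrable_on_def less_imp_le)
      moreover have "f k = (\<lambda>t. if t \<in> {0..} then f k t else 0)"
      proof
        fix t
        show "f k t = (if t \<in> {0..} then f k t else 0)"
          using less_le_trans[OF exp_gt_zero[of "- real k"], of t] by (cases "0 \<le> t") (auto simp: f_def)
      qed
      ultimately show "f k integrable_on {0..}" using integrable_restrict_UNIV[of "{0..}" "f k"] by metis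
    next
      show "g integrable_on {0..}" using G by (auto simp: integrable_on_def)
    next
      fix k t show "norm (f k t) \<le> g t" by (auto simp: f_def g_def)
    next
      fix t :: real assume t: "t \<in> {0..}"
      show "(\<lambda>k. f k t) \<longlonglongrightarrow> g t"
      proof (cases "t = 0")
        case True then show ?thesis by (simp add: f_def g_def)
      next
        case False
        then have "0 < t" using t by simp
        have "\<forall>\<^sub>F k in sequentially. \<bar>ln t\<bar> \<le> real k" by real_asymp
        then have "\<forall>\<^sub>F k in sequentially. f k t = g t"
        proof eventually_elim
          case (elim k)
          then have "exp (- real k) \<le> exp (ln t)" "exp (ln t) \<le> exp (real k)" by auto
          then show ?case using \<open>0 < t\<close> by (simp add: f_def)
        qed
        then show ?thesis by (rule tendsto_eventually)
      qed
    qed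
    moreover have "integral {0..} (f k) = I k" for k
    proof -
      have "integral {0..} (f k) = integral {0..} (\<lambda>t. if t \<in> {exp (- real k)..exp (real k)} then g t else 0)"
        by (simp add: f_def[abs_def])
      also have "\<dots> = integral ({0..} \<inter> {exp (- real k)..exp (real k)}) g"
        by (subst Int_commute) (rule integral_restrict_Int)
      also have "{0..} \<inter> {exp (- real k)..exp (real k)} = {exp (- real k)..exp (real k)}"
        by (auto intro: order_trans[OF exp_ge_zero])
      finally show ?thesis by (simp add: I_def)
    qed
    ultimately show ?thesis using integral_unique[OF G] by simp
  qed
  then have "(\<lambda>k. vert pi (hk \<beta>) (real k)) \<longlonglongrightarrow> 0 + c * of_real (Gamma (1 - \<beta>))"
    unfolding V by (intro tendsto_intros vert_low)
  moreover have "c * of_real (Gamma (1 - \<beta>)) = 2 * of_real pi * \<i> * of_real (rGamma \<beta>)"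
  proof -
    have "complex_of_real (Gamma \<beta> * Gamma (1 - \<beta>)) = of_real (pi / sin (pi * \<beta>))"
      using Gamma_reflection_complex[of "of_real \<beta>"]
      by (simp add: Gamma_complex_of_real[symmetric] flip: sin_of_real)
    then have "Gamma \<beta> * Gamma (1 - \<beta>) = pi / sin (pi * \<beta>)"
      by (simp only: of_real_eq_iff)
    moreover have "sin (pi * \<beta>) > 0" using \<beta> by (intro sin_gt_zero) auto
    moreover have "Gamma \<beta> > 0" using \<beta> by (intro Gamma_real_pos) auto
    moreover have "sin (pi * (1 - \<beta>)) = sin (pi * \<beta>)" by (simp add: right_diff_distrib)
    ultimately have "sin (pi * (1 - \<beta>)) * Gamma (1 - \<beta>) = pi * rGamma \<beta>"
      by (simp add: rGamma_inverse_Gamma divide_simps mult_ac)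
    then have "complex_of_real (sin (pi * (1 - \<beta>))) * of_real (Gamma (1 - \<beta>)) = of_real pi * of_real (rGamma \<beta>)"
      by (metis of_real_mult)
    then show ?thesis by (simp add: c_def mult.assoc)
  qed
  ultimately show ?thesis by simp
qed

text \<open>At \<beta> = 1 the integrand has no jump across the cut. The horizontal sides cancel,
  the vertical integral does not depend on its position, and its value is the limit far to the left,
  where the integrand tends to \<i>. This is the residue of e^s/s.\<close>

lemma hankel_pi_1:
  "(\<lambda>k. vert pi (hk 1) (real k)) \<longlonglongrightarrow> 2 * of_real pi * \<i> * of_real (rGamma 1)"
proof -
  have const: "vert pi (hk 1) b = vert pi (hk 1) a" if "a \<le> b" for a b
  proof -
    have "exp (Complex x pi) = exp (Complex x (- pi))" for x by (simp add: exp_eq_polar complex_eq_iff)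
    then have "((\<lambda>x::real. 0) has_integral vert pi (hk 1) b - vert pi (hk 1) a) {a..b}"
      using vert_rectangle[OF hk_holomorphic, of pi "pi + 1" a b 1] that by (simp add: hk_def)
    then have "vert pi (hk 1) b - vert pi (hk 1) a = 0" using has_integral_unique has_integral_0 by blast
    then show ?thesis by simp
  qed
  have "(\<lambda>k. vert pi (hk 1) (- real k)) \<longlonglongrightarrow> 2 * of_real pi * \<i>"
  proof -
    have "(\<lambda>k. integral {- pi..pi} (\<lambda>y. \<i> * hk 1 (Complex (- real k) y))) \<longlonglongrightarrow> integral {- pi..pi} (\<lambda>y. \<i> * 1)"
    proof (rule dominated_convergence(2)[where h="\<lambda>_. exp 1"])
      fix k :: nat
      show "(\<lambda>y. \<i> * hk 1 (Complex (- real k) y)) integrable_on {- pi..pi}"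
        using vert_has_integral(1)[OF hk_holomorphic, of pi "pi + 1" 1 "- real k"] by auto
      fix y :: real
      have "exp (- real k) * cos y \<le> exp (- real k) * 1" by (intro mult_left_mono) auto
      also have "\<dots> \<le> 1" by simp
      finally have "exp (- real k) * cos y \<le> 1" .
      then show "norm (\<i> * hk 1 (Complex (- real k) y)) \<le> exp 1"
        by (simp add: norm_mult norm_hk)
    next
      fix y :: real
      have "(\<lambda>k. exp (Complex (- real k) y)) \<longlonglongrightarrow> 0"
      proof (rule tendsto_norm_zero_cancel)
        show "(\<lambda>k. norm (exp (Complex (- real k) y))) \<longlonglongrightarrow> 0" by simp real_asymp
      qed
      then have "(\<lambda>k. \<i> * exp (exp (Complex (- real k) y))) \<longlonglongrightarrow> \<i> * exp 0" by (intro tendsto_intros)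
      then show "(\<lambda>k. \<i> * hk 1 (Complex (- real k) y)) \<longlonglongrightarrow> \<i> * 1" by (simp add: hk_def)
    qed (auto simp: integrable_const_ivl)
    then show ?thesis by (simp add: vert_def scaleR_conv_of_real mult_ac)
  qed
  moreover have "vert pi (hk 1) (- real k) = vert pi (hk 1) (real k)" for k
    using const[of "- real k" "real k"] by simp
  ultimately show ?thesis by (simp add: rGamma_inverse_Gamma)
qed

text \<open>Induction over unit intervals of \<beta>, with \<open>hk_recursion\<close> matching the
  functional equation of 1/\<Gamma>.\<close>

lemma hankel_pi:
  assumes "0 \<le> \<beta>"
  shows "(\<lambda>k. vert pi (hk \<beta>) (real k)) \<longlonglongrightarrow> 2 * of_real pi * \<i> * of_real (rGamma \<beta>)"
proof -
  have pos: "(\<lambda>k. vert pi (hk \<beta>) (real k)) \<longlonglongrightarrow> 2 * of_real pi * \<i> * of_real (rGamma \<beta>)"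
    if "0 < \<beta>" "\<beta> \<le> real (Suc n)" for n \<beta>
    using that
  proof (induction n arbitrary: \<beta>)
    case 0
    then show ?case using hankel_pi_01 hankel_pi_1 by (cases "\<beta> = 1") auto
  next
    case (Suc n)
    show ?case
    proof (cases "\<beta> \<le> 1")
      case True
      then show ?thesis using Suc.prems hankel_pi_01 hankel_pi_1 by (cases "\<beta> = 1") auto
    next
      case False
      define b where "b = \<beta> - 1"
      have b: "0 < b" "b \<le> real (Suc n)" using False Suc.prems by (auto simp: b_def)
      \<comment> \<open>The quotient is \<open>vert pi (hk (b + 1)) (real k)\<close>, written so
        that both the induction hypothesis and the recursion give the limit.\<close>
      have "(\<lambda>k. (vert pi (hk b) (real k) - (vert pi (hk b) (real k) - of_real b * vert pi (hk (b + 1)) (real k))) / of_real b)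
          \<longlonglongrightarrow> (2 * of_real pi * \<i> * of_real (rGamma b) - 0) / of_real b"
        using b by (intro tendsto_intros Suc.IH hk_recursion) auto
      moreover have "rGamma b = b * rGamma \<beta>" using rGamma_plus1[of b] by (simp add: b_def)
      moreover have "(2 * of_real pi * \<i> * of_real (b * rGamma \<beta>) - 0) / of_real b
          = 2 * of_real pi * \<i> * of_real (rGamma \<beta>)"
        using b by simp
      ultimately show ?thesis using b by (simp add: b_def mult.assoc)
    qed
  qed
  show ?thesis
  proof (cases "\<beta> = 0")
    \<comment> \<open>At \<beta> = 0 the recursion carries the factor 0 and gives the limit 0 at
      once, in agreement with \<open>rGamma 0 = 0\<close>.\<close>
    case True
    have "(\<lambda>k. vert pi (hk 0) (real k) - of_real 0 * vert pi (hk (0 + 1)) (real k)) \<longlonglongrightarrow> 0"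
      by (rule hk_recursion) auto
    then show ?thesis using True by (simp add: rGamma_inverse_Gamma)
  next
    case False
    then show ?thesis using pos[of \<beta> "nat \<lceil>\<beta>\<rceil>"] assms by linarith
  qed
qed

text \<open>Narrowing the contour from \<pi> to \<theta> removes two vertical pieces on which cos y
  \<le> cos \<theta> < 0, where the integrand is doubly exponentially small. A smaller angle is
  needed later because the denominator s^\<alpha> - z may vanish in the full strip.\<close>

lemma hankel:
  assumes \<theta>: "pi / 2 < \<theta>" "\<theta> \<le> pi" and \<beta>: "0 \<le> \<beta>"
  shows "(\<lambda>k. vert \<theta> (hk \<beta>) (real k)) \<longlonglongrightarrow> 2 * of_real pi * \<i> * of_real (rGamma \<beta>)"
proof -
  have c: "cos \<theta> < 0" using \<theta> by (intro cos_lt_zero_pi) auto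
  have \<theta>0: "0 < \<theta>" "- pi \<le> - \<theta>" "- \<theta> \<le> \<theta>" "- \<theta> \<le> pi" using \<theta> pi_gt_zero by linarith+
  have "(\<lambda>k. vert pi (hk \<beta>) (real k) - vert \<theta> (hk \<beta>) (real k)) \<longlonglongrightarrow> 0"
  proof (rule Lim_null_comparison)
    show "\<forall>\<^sub>F k in sequentially. norm (vert pi (hk \<beta>) (real k) - vert \<theta> (hk \<beta>) (real k))
        \<le> 2 * (pi - \<theta>) * exp (exp (real k) * cos \<theta> + (1 - \<beta>) * real k)"
    proof (intro always_eventually allI)
      fix k
      define f where "f y = \<i> * hk \<beta> (Complex (real k) y)" for y
      define B where "B = exp (exp (real k) * cos \<theta> + (1 - \<beta>) * real k)"
      have int: "f integrable_on {- pi..pi}" 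
        unfolding f_def using vert_has_integral(1)[OF hk_holomorphic, of pi "pi + 1" \<beta> "real k"] by auto
      have fB: "norm (f y) \<le> B" if "\<theta> \<le> \<bar>y\<bar>" "\<bar>y\<bar> \<le> pi" for y
      proof -
        have "cos \<bar>y\<bar> \<le> cos \<theta>" using that \<theta> pi_gt_zero by (intro cos_monotone_0_pi_le) linarith+
        then show ?thesis by (simp add: f_def norm_mult norm_hk B_def)
      qed
      have v: "vert pi (hk \<beta>) (real k) = integral {- pi..pi} f" "vert \<theta> (hk \<beta>) (real k) = integral {- \<theta>..\<theta>} f"
        by (simp_all only: vert_def f_def[abs_def])
      have "vert pi (hk \<beta>) (real k) = integral {- pi..- \<theta>} f + integral {- \<theta>..\<theta>} f + integral {\<theta>..pi} f"
      proof -
        have "integral {- pi..pi} f = integral {- pi..- \<theta>} f + integral {- \<theta>..pi} f"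
          using \<theta> \<theta>0 by (intro Henstock_Kurzweil_Integration.integral_combine[symmetric] int) auto
        moreover have "integral {- \<theta>..pi} f = integral {- \<theta>..\<theta>} f + integral {\<theta>..pi} f"
          using \<theta> \<theta>0
          by (intro Henstock_Kurzweil_Integration.integral_combine[symmetric] integrable_on_subinterval[OF int]) auto
        ultimately show ?thesis by (simp add: v)
      qed
      then have "vert pi (hk \<beta>) (real k) - vert \<theta> (hk \<beta>) (real k) = integral {- pi..- \<theta>} f + integral {\<theta>..pi} f"
        by (simp add: v)
      also have "norm \<dots> \<le> B * (pi - \<theta>) + B * (pi - \<theta>)"
      proof (intro order_trans[OF norm_triangle_ineq] add_mono)
        have i: "f integrable_on {- pi..- \<theta>}" "f integrable_on {\<theta>..pi}"
          using \<theta> by (auto intro!: integrable_on_subinterval[OF int])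
        have "norm (integral {- pi..- \<theta>} f) \<le> B * Henstock_Kurzweil_Integration.content {- pi..- \<theta>}"
          using \<theta> fB by (intro has_integral_bound_real[OF _ _ integrable_integral[OF i(1)], of _ "{}"]) (auto simp: B_def)
        then show "norm (integral {- pi..- \<theta>} f) \<le> B * (pi - \<theta>)" using \<theta> by simp
        have "norm (integral {\<theta>..pi} f) \<le> B * Henstock_Kurzweil_Integration.content {\<theta>..pi}"
          using \<theta> fB by (intro has_integral_bound_real[OF _ _ integrable_integral[OF i(2)], of _ "{}"]) (auto simp: B_def)
        then show "norm (integral {\<theta>..pi} f) \<le> B * (pi - \<theta>)" using \<theta> by simp
      qed
      finally show "norm (vert pi (hk \<beta>) (real k) - vert \<theta> (hk \<beta>) (real k))
        \<le> 2 * (pi - \<theta>) * exp (exp (real k) * cos \<theta> + (1 - \<beta>) * real k)"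
        by (simp add: B_def algebra_simps)
    qed
    show "(\<lambda>k. 2 * (pi - \<theta>) * exp (exp (real k) * cos \<theta> + (1 - \<beta>) * real k)) \<longlonglongrightarrow> 0"
      by (intro tendsto_mult_right_zero double_exp_tendsto_0 c)
  qed
  from tendsto_diff[OF hankel_pi[OF \<beta>] this] show ?thesis by simp
qed

section \<open>Bounds along Hankel contours that are uniform in the right end\<close>

lemma vert_norm_diff_le:
  assumes \<phi>: "\<phi> holomorphic_on strip \<theta>'" "0 < \<theta>" "\<theta> < \<theta>'" and ab: "a \<le> b"
    and F: "\<And>x. a \<le> x \<Longrightarrow> x \<le> b \<Longrightarrow> (F has_real_derivative g x) (at x)"
    and bnd: "\<And>x y. a \<le> x \<Longrightarrow> x \<le> b \<Longrightarrow> y = \<theta> \<or> y = - \<theta> \<Longrightarrow> norm (\<phi> (Complex x y)) \<le> g x"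
  shows "norm (vert \<theta> \<phi> b) \<le> norm (vert \<theta> \<phi> a) + 2 * (F b - F a)"
proof -
  let ?d = "\<lambda>x. \<phi> (Complex x \<theta>) - \<phi> (Complex x (- \<theta>))"
  have I: "(?d has_integral (vert \<theta> \<phi> b - vert \<theta> \<phi> a)) {a..b}"
    by (rule vert_rectangle[OF \<phi> ab])
  have G: "((\<lambda>x. 2 * g x) has_integral 2 * (F b - F a)) {a..b}"
    using ab F by (intro has_integral_mult_right fundamental_theorem_of_calculus)
      (auto simp: has_real_derivative_iff_has_vector_derivative[symmetric] intro: has_field_derivative_at_within)
  have "norm (integral {a..b} ?d) \<le> integral {a..b} (\<lambda>x. 2 * g x)"
  proof (rule integral_norm_bound_integral)
    fix x assume x: "x \<in> {a..b}"
    have "norm (?d x) \<le> norm (\<phi> (Complex x \<theta>)) + norm (\<phi> (Complex x (- \<theta>)))"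
      by (rule norm_triangle_ineq4)
    then show "norm (?d x) \<le> 2 * g x"
      using bnd[of x \<theta>] bnd[of x "- \<theta>"] x by auto
  qed (use I G in auto)
  then have "norm (vert \<theta> \<phi> b - vert \<theta> \<phi> a) \<le> 2 * (F b - F a)"
    using integral_unique[OF I] integral_unique[OF G] by simp
  then show ?thesis using norm_triangle_sub[of "vert \<theta> \<phi> b" "vert \<theta> \<phi> a"] by simp
qed

text \<open>The contour is compared with the one starting at real part \<open>a\<close>. To the
  right of it s^{-\<beta>} is at most exp(-\<beta> a), since \<beta> \<ge> 0, while cos \<theta> < 0
  makes the two rays integrable. The bound does not involve \<open>b\<close>, and \<open>a\<close>
  remains free: a large \<open>a\<close> gives fast decay in \<beta>.\<close>

lemma vert_hk_bound:
  assumes \<theta>: "pi / 2 < \<theta>" "\<theta> \<le> pi" and \<beta>: "0 \<le> \<beta>" and ab: "a \<le> b"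
  shows "norm (vert \<theta> (hk \<beta>) b) \<le> exp (- \<beta> * a) * (exp (exp a + a) * (2 * \<theta>) + 2 / (- cos \<theta>))"
proof -
  define c where "c = cos \<theta>"
  have c: "c < 0" unfolding c_def using \<theta> by (intro cos_lt_zero_pi) auto
  have \<theta>0: "0 < \<theta>" using \<theta> pi_gt_zero by linarith
  define F where "F x = exp (- \<beta> * a) / c * exp (c * exp x)" for x
  have "norm (vert \<theta> (hk \<beta>) b) \<le> norm (vert \<theta> (hk \<beta>) a) + 2 * (F b - F a)"
  proof (rule vert_norm_diff_le[OF hk_holomorphic[of _ "strip (\<theta> + 1)"] \<theta>0 _ ab])
    fix x
    show "(F has_real_derivative exp (- \<beta> * a) * exp (c * exp x + x)) (at x)"
      unfolding F_def[abs_def] using c by (auto intro!: derivative_eq_intros simp: exp_add)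
    fix y assume xy: "a \<le> x" "y = \<theta> \<or> y = - \<theta>"
    have "cos y = c" using xy by (auto simp: c_def)
    moreover have "\<beta> * a \<le> \<beta> * x" using xy \<beta> by (intro mult_left_mono)
    ultimately show "norm (hk \<beta> (Complex x y)) \<le> exp (- \<beta> * a) * exp (c * exp x + x)"
      unfolding norm_hk exp_add[symmetric] by (simp add: algebra_simps)
  qed simp
  also have "norm (vert \<theta> (hk \<beta>) a) \<le> exp (exp a + (1 - \<beta>) * a) * (2 * \<theta>)"
  proof (rule vert_bound[OF hk_holomorphic[of _ "strip (\<theta> + 1)"] \<theta>0])
    fix y :: real
    have "exp a * cos y \<le> exp a * 1" by (intro mult_left_mono) auto
    then show "norm (hk \<beta> (Complex a y)) \<le> exp (exp a + (1 - \<beta>) * a)"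
      unfolding norm_hk by simp
  qed simp
  also have "exp (exp a + (1 - \<beta>) * a) = exp (- \<beta> * a) * exp (exp a + a)"
    by (simp add: exp_add[symmetric] algebra_simps)
  also have "2 * (F b - F a) \<le> exp (- \<beta> * a) * (2 / (- c))"
  proof -
    have "F b \<le> 0" unfolding F_def using c by (intro mult_nonpos_nonneg divide_nonneg_neg) auto
    moreover have "- F a \<le> exp (- \<beta> * a) * (1 / (- c))"
    proof -
      have "c * exp a \<le> 0" using c by (simp add: mult_nonpos_nonneg)
      then have "exp (- \<beta> * a) / (- c) * exp (c * exp a) \<le> exp (- \<beta> * a) / (- c) * 1"
        using c by (intro mult_left_mono divide_nonneg_pos) auto
      then show ?thesis by (simp add: F_def)
    qed
    ultimately show ?thesis by (simp add: algebra_simps)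
  qed
  finally show ?thesis by (simp add: c_def algebra_simps)
qed

text \<open>As \<open>a\<close> is arbitrary, 1/\<Gamma>(\<beta>) decays faster than every
  exponential. This replaces Stirling's formula in the convergence of the Mittag-Leffler
  series.\<close>

lemma rGamma_exp_bound:
  obtains K :: real where "0 \<le> K" "\<And>\<beta>. 0 \<le> \<beta> \<Longrightarrow> \<bar>rGamma \<beta>\<bar> \<le> K * exp (- \<beta> * a)"
proof
  define K where "K = exp (exp a + a) * (2 * pi) + 2"
  show "0 \<le> K" by (simp add: K_def)
  fix \<beta> :: real assume \<beta>: "0 \<le> \<beta>"
  have "norm (2 * of_real pi * \<i> * of_real (rGamma \<beta>)) \<le> exp (- \<beta> * a) * K"
  proof (rule tendsto_upperbound)
    show "(\<lambda>k. norm (vert pi (hk \<beta>) (real k))) \<longlonglongrightarrow> norm (2 * of_real pi * \<i> * of_real (rGamma \<beta>))"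
      by (intro tendsto_norm hankel_pi \<beta>)
    have "\<forall>\<^sub>F k in sequentially. a \<le> real k"
      using filterlim_real_sequentially by (simp add: filterlim_at_top)
    then show "\<forall>\<^sub>F k in sequentially. norm (vert pi (hk \<beta>) (real k)) \<le> exp (- \<beta> * a) * K"
      by eventually_elim (use vert_hk_bound[of pi \<beta> a] \<beta> in \<open>auto simp: K_def\<close>)
  qed simp
  then have "2 * pi * \<bar>rGamma \<beta>\<bar> \<le> exp (- \<beta> * a) * K" by (simp add: norm_mult)
  moreover have "1 * \<bar>rGamma \<beta>\<bar> \<le> 2 * pi * \<bar>rGamma \<beta>\<bar>"
    using pi_gt3 by (intro mult_right_mono) auto
  ultimately show "\<bar>rGamma \<beta>\<bar> \<le> K * exp (- \<beta> * a)" by (simp add: mult.commute)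
qed

lemma summable_rGamma_exp:
  fixes x \<alpha> \<beta> :: real
  assumes "0 < \<alpha>" "0 \<le> \<beta>" "0 \<le> x"
  shows "summable (\<lambda>k. x ^ k * \<bar>rGamma (\<alpha> * real k + \<beta>)\<bar>)"
proof -
  \<comment> \<open>Chosen so that exp(-\<alpha> a) = 1/(2(x + 1)); the comparison series is then
    geometric with ratio x/(2(x + 1)) < 1.\<close>
  define a where "a = ln (2 * (x + 1)) / \<alpha>"
  have e: "exp (- \<alpha> * a) = 1 / (2 * (x + 1))"
  proof -
    have "- \<alpha> * a = - ln (2 * (x + 1))" using assms by (simp add: a_def)
    then show ?thesis using assms by (simp only: exp_minus) (simp add: divide_inverse)
  qed
  obtain K where K: "0 \<le> K" "\<And>\<beta>. 0 \<le> \<beta> \<Longrightarrow> \<bar>rGamma \<beta>\<bar> \<le> K * exp (- \<beta> * a)"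
    using rGamma_exp_bound[of a] by blast
  show ?thesis
  proof (rule summable_comparison_test')
    show "summable (\<lambda>k. K * exp (- \<beta> * a) * (x / (2 * (x + 1))) ^ k)"
      using assms by (intro summable_mult summable_geometric) (auto simp: field_simps)
    fix k :: nat
    have "exp (- (\<alpha> * real k + \<beta>) * a) = exp (- \<alpha> * a) ^ k * exp (- \<beta> * a)"
      by (simp add: exp_of_nat_mult[symmetric] exp_add[symmetric] algebra_simps)
    then have "\<bar>rGamma (\<alpha> * real k + \<beta>)\<bar> \<le> K * (exp (- \<beta> * a) * (1 / (2 * (x + 1))) ^ k)"
      using K(2)[of "\<alpha> * real k + \<beta>"] assms e by (simp add: mult_ac)
    then have "x ^ k * \<bar>rGamma (\<alpha> * real k + \<beta>)\<bar> \<le> x ^ k * (K * (exp (- \<beta> * a) * (1 / (2 * (x + 1))) ^ k))"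
      using assms by (intro mult_left_mono) auto
    then show "norm (x ^ k * \<bar>rGamma (\<alpha> * real k + \<beta>)\<bar>) \<le> K * exp (- \<beta> * a) * (x / (2 * (x + 1))) ^ k"
      using assms by (simp add: power_divide mult_ac)
  qed
qed

section \<open>Mittag-Leffler functions and their decay on the negative imaginary axis\<close>

lemma mittag_leffler_rGamma:
  "mittag_leffler \<alpha> \<beta> z = (\<Sum>k. z ^ k * of_real (rGamma (\<alpha> * real k + \<beta>)))"
  \<comment> \<open>At its poles \<open>Gamma\<close> has the value 0 and division by 0 gives 0,
    which agrees with the zeros of \<open>rGamma\<close>; no restriction on the parameters
    arises.\<close>
  unfolding mittag_leffler_def by (simp add: rGamma_inverse_Gamma divide_inverse)

lemma summable_mittag_leffler:
  assumes "0 < \<alpha>" "0 \<le> \<beta>"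
  shows "summable (\<lambda>k. norm (z ^ k * complex_of_real (rGamma (\<alpha> * real k + \<beta>))))"
  using summable_rGamma_exp[OF assms, of "norm z"] by (simp add: norm_mult norm_power)

lemma mittag_leffler_norm_le:
  assumes "0 < \<alpha>" "0 \<le> \<beta>"
  obtains K where "0 \<le> K" "\<And>z. norm z \<le> R \<Longrightarrow> norm (mittag_leffler \<alpha> \<beta> z) \<le> K"
proof
  define K where "K = (\<Sum>k. \<bar>R\<bar> ^ k * \<bar>rGamma (\<alpha> * real k + \<beta>)\<bar>)"
  show "0 \<le> K" unfolding K_def by (intro suminf_nonneg summable_rGamma_exp assms) auto
  fix z :: complex assume z: "norm z \<le> R"
  have "norm (mittag_leffler \<alpha> \<beta> z) \<le> (\<Sum>k. norm (z ^ k * complex_of_real (rGamma (\<alpha> * real k + \<beta>))))"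
    unfolding mittag_leffler_rGamma by (intro summable_norm summable_mittag_leffler assms)
  also have "\<dots> \<le> K"
    unfolding K_def using z
    by (intro suminf_le summable_mittag_leffler summable_rGamma_exp assms)
      (auto simp: norm_mult norm_power intro!: mult_right_mono power_mono)
  finally show "norm (mittag_leffler \<alpha> \<beta> z) \<le> K" .
qed

text \<open>The term k = 0 vanishes because \<open>rGamma 0 = 0\<close>, and shifting the index
  produces the factor z.\<close>

lemma mittag_leffler_0:
  assumes "0 < \<alpha>"
  shows "mittag_leffler \<alpha> 0 z = z * mittag_leffler \<alpha> \<alpha> z"
proof -
  have s: "summable (\<lambda>k. z ^ k * complex_of_real (rGamma (\<alpha> * real k + 0)))"
    using summable_mittag_leffler[OF assms, of 0 z] by (simp add: summable_norm_cancel)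
  have "mittag_leffler \<alpha> 0 z = (\<Sum>k. z ^ Suc k * of_real (rGamma (\<alpha> * real (Suc k) + 0)))"
    unfolding mittag_leffler_rGamma using suminf_split_head[OF s] by simp
  also have "\<dots> = (\<Sum>k. z * (z ^ k * of_real (rGamma (\<alpha> * real k + \<alpha>))))"
    by (simp add: algebra_simps)
  also have "\<dots> = z * mittag_leffler \<alpha> \<alpha> z"
    unfolding mittag_leffler_rGamma using summable_mittag_leffler[OF assms, of \<alpha> z] assms
    by (intro suminf_mult) (simp add: summable_norm_cancel)
  finally show ?thesis .
qed

text \<open>The point -\<i>x has distance x cos \<psi> from the line through 0 in direction
  \<psi>.\<close>

lemma dist_imaginary_axis:
  assumes "0 \<le> x" "\<bar>\<psi>\<bar> \<le> \<gamma>" "\<gamma> \<le> pi / 2"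
  shows "x * cos \<gamma> \<le> norm (of_real r * cis \<psi> + \<i> * of_real x)"
proof -
  have c: "0 \<le> cos \<gamma>" "cos \<gamma> \<le> cos \<psi>"
    using assms cos_monotone_0_pi_le[of "\<bar>\<psi>\<bar>" \<gamma>] pi_gt_zero
    by (auto intro!: cos_ge_zero)
  have "(x * cos \<gamma>)\<^sup>2 \<le> (x * cos \<psi>)\<^sup>2" using c assms by (intro power_mono mult_left_mono) auto
  also have "\<dots> \<le> (x * cos \<psi>)\<^sup>2 + (r + x * sin \<psi>)\<^sup>2" by simp
  also have "\<dots> = (r * cos \<psi>)\<^sup>2 + (r * sin \<psi> + x)\<^sup>2"
    unfolding power2_sum power_mult_distrib cos_squared_eq by (simp add: algebra_simps)
  also have "\<dots> = (norm (of_real r * cis \<psi> + \<i> * of_real x))\<^sup>2"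
    by (simp add: cmod_power2)
  finally show ?thesis by (rule power2_le_imp_le) simp
qed

text \<open>2\<pi>\<i> E_{\<alpha>,\<beta>}(z) is the Hankel integral of e^s
  s^{\<alpha>-\<beta>}/(s^\<alpha> - z). On a contour with angle \<theta> > \<pi>/2 and
  \<alpha>\<theta> < \<pi>/2, which exists since \<alpha> < 1, the powers s^\<alpha> stay at
  distance at least x cos(\<alpha>\<theta>) from z = -\<i>x. The integrand has no pole in the strip,
  so the estimate may start at real part 0 for every x, which makes the constant uniform.\<close>

lemma mittag_leffler_imaginary_bound:
  assumes \<alpha>: "0 < \<alpha>" "\<alpha> < 1" and \<beta>: "0 \<le> \<beta>"
  obtains C where "0 \<le> C" "\<And>x. 0 < x \<Longrightarrow> norm (mittag_leffler \<alpha> \<beta> (- \<i> * of_real x)) \<le> C / x"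
proof -
  \<comment> \<open>The strip of half-width \<theta>' is free of zeros of s^\<alpha> - z. The angle
    \<theta> is the midpoint of \<pi>/2 and \<theta>', which leaves room for a closed contour strip
    inside the open one.\<close>
  define \<theta>' where "\<theta>' = min pi (pi / (2 * \<alpha>))"
  define \<theta> where "\<theta> = (pi / 2 + \<theta>') / 2"
  have "pi / 2 < pi / (2 * \<alpha>)" using \<alpha> by (intro divide_strict_left_mono) auto
  then have \<theta>': "pi / 2 < \<theta>'" "\<theta>' \<le> pi" "\<alpha> * \<theta>' \<le> pi / 2"
    using \<alpha> by (auto simp: \<theta>'_def min_def field_simps)
  have \<theta>: "pi / 2 < \<theta>" "\<theta> \<le> pi" "\<theta> < \<theta>'" "0 < \<theta>" using \<theta>' pi_gt_zero by (auto simp: \<theta>_def)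
  define c where "c = cos \<theta>"
  have c: "c < 0" unfolding c_def using \<theta> by (intro cos_lt_zero_pi) auto
  define d where "d = cos (\<alpha> * \<theta>)"
  have \<alpha>\<theta>: "\<alpha> * \<theta> < pi / 2" using \<theta>' \<theta> \<alpha> mult_strict_left_mono[OF \<theta>(3), of \<alpha>] by linarith
  then have d: "0 < d" unfolding d_def using \<theta> \<alpha> by (intro cos_gt_zero_pi) (auto intro: less_trans[of _ 0])
  \<comment> \<open>The first summand is the vertical segment at real part 0, of length 2\<theta>.
    The second bounds the two rays through the explicit primitive \<open>F\<close> of exp(c exp s +
    2s)/(x d). The denominator d = cos(\<alpha>\<theta>) comes from the distance to the
    pole.\<close>
  define C where "C = (exp 1 * (2 * \<theta>) + 2 * (1 / c\<^sup>2 - 1 / c)) / d"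
  have c2: "0 \<le> 1 / c\<^sup>2 - 1 / c"
    using c divide_nonneg_neg[of 1 c] by (smt (verit) zero_le_divide_1_iff zero_le_power2)
  then have C: "0 \<le> C" unfolding C_def using d \<theta> by (intro divide_nonneg_pos add_nonneg_nonneg) auto
  have "norm (mittag_leffler \<alpha> \<beta> (- \<i> * of_real x)) \<le> C / x" if x: "0 < x" for x
  proof -
    define z where "z = - \<i> * complex_of_real x"
    have nz: "norm z = x" using x by (simp add: z_def norm_mult)
    \<comment> \<open>The integrand e^s s^{\<alpha>-\<beta>}/(s^\<alpha> - z) ds in the coordinate s
      = exp w.\<close>
    define \<phi> where "\<phi> w = hk (\<beta> - \<alpha>) w / (exp (of_real \<alpha> * w) - z)" for w
    have expC: "exp (of_real \<alpha> * Complex s y) = of_real (exp (\<alpha> * s)) * cis (\<alpha> * y)" for s y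
      by (simp add: exp_eq_polar)
    have nonzero: "exp (of_real \<alpha> * w) - z \<noteq> 0" if "w \<in> strip \<theta>'" for w
    proof -
      have "\<bar>\<alpha> * Im w\<bar> < \<alpha> * \<theta>'" using that \<alpha> by (auto simp: strip_def abs_mult)
      then have "cos (\<alpha> * Im w) > 0" using \<theta>' by (intro cos_gt_zero_pi) linarith+
      then have "Re (exp (of_real \<alpha> * w) - z) > 0" by (simp add: Re_exp z_def)
      then show ?thesis by force
    qed
    have hol: "\<phi> holomorphic_on strip \<theta>'"
      unfolding \<phi>_def[abs_def]
      by (intro holomorphic_on_divide hk_holomorphic holomorphic_intros) (use nonzero in auto)
    have nphi: "norm (\<phi> (Complex s y)) \<le> exp (exp s * cos y + 2 * s) / (x * d)"
      if "0 \<le> s" "\<bar>y\<bar> \<le> \<theta>" for s y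
    proof -
      have "\<bar>\<alpha> * y\<bar> \<le> \<alpha> * \<theta>" using that \<alpha> by (auto simp: abs_mult)
      then have den: "x * d \<le> norm (exp (of_real \<alpha> * Complex s y) - z)"
        using dist_imaginary_axis[of x "\<alpha> * y" "\<alpha> * \<theta>" "exp (\<alpha> * s)"] x \<alpha>\<theta>
        unfolding expC d_def z_def by simp
      have "(1 - (\<beta> - \<alpha>)) * s \<le> 2 * s" using that \<alpha> \<beta> by (intro mult_right_mono) auto
      then have "norm (hk (\<beta> - \<alpha>) (Complex s y)) \<le> exp (exp s * cos y + 2 * s)"
        unfolding norm_hk by simp
      then show ?thesis unfolding \<phi>_def norm_divide using den x d by (intro frac_le) auto
    qed
    have bound: "norm (vert \<theta> \<phi> (real n)) \<le> C / x" for n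
    proof -
      define F where "F s = (exp s / c - 1 / c\<^sup>2) * exp (c * exp s) / (x * d)" for s
      have "norm (vert \<theta> \<phi> (real n)) \<le> norm (vert \<theta> \<phi> 0) + 2 * (F (real n) - F 0)"
      proof (rule vert_norm_diff_le[OF hol \<theta>(4,3)])
        fix s :: real assume s: "0 \<le> s"
        show "(F has_real_derivative (exp (c * exp s + 2 * s) / (x * d))) (at s)"
        proof -
          have "exp (c * exp s + 2 * s) = exp (c * exp s) * (exp s * exp s)"
            unfolding exp_add[symmetric] by simp
          then show ?thesis
            unfolding F_def[abs_def] using c x d
            by (auto intro!: derivative_eq_intros simp: power2_eq_square field_simps)
        qed
        fix y assume "y = \<theta> \<or> y = - \<theta>"
        then show "norm (\<phi> (Complex s y)) \<le> exp (c * exp s + 2 * s) / (x * d)"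
          using nphi[OF s, of y] \<theta> by (auto simp: c_def mult.commute)
      qed simp
      also have "norm (vert \<theta> \<phi> 0) \<le> exp 1 / (x * d) * (2 * \<theta>)"
      proof (rule vert_bound[OF hol \<theta>(4,3)])
        fix y assume "\<bar>y\<bar> \<le> \<theta>"
        then have "norm (\<phi> (Complex 0 y)) \<le> exp (exp 0 * cos y + 2 * 0) / (x * d)" by (intro nphi) auto
        also have "\<dots> \<le> exp 1 / (x * d)" using x d by (intro divide_right_mono) auto
        finally show "norm (\<phi> (Complex 0 y)) \<le> exp 1 / (x * d)" .
      qed
      also have "2 * (F (real n) - F 0) \<le> 2 * ((1 / c\<^sup>2 - 1 / c) / (x * d))"
      proof -
        have "F (real n) \<le> 0"
          unfolding F_def using c x d
          by (intro divide_nonpos_pos mult_nonpos_nonneg) (auto simp: divide_nonneg_neg intro: order_trans[of _ 0])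
        moreover have "- F 0 \<le> (1 / c\<^sup>2 - 1 / c) / (x * d)"
        proof -
          have "(1 / c\<^sup>2 - 1 / c) * exp c \<le> (1 / c\<^sup>2 - 1 / c) * 1"
            using c c2 by (intro mult_left_mono) auto
          then have "(1 / c\<^sup>2 - 1 / c) * exp c / (x * d) \<le> (1 / c\<^sup>2 - 1 / c) / (x * d)"
            using x d by (intro divide_right_mono) auto
          moreover have "- F 0 = (1 / c\<^sup>2 - 1 / c) * exp c / (x * d)"
            using x d c by (simp add: F_def field_simps)
          ultimately show ?thesis by simp
        qed
        ultimately have "F (real n) + - F 0 \<le> 0 + (1 / c\<^sup>2 - 1 / c) / (x * d)" by (rule add_mono)
        then have "2 * (F (real n) + - F 0) \<le> 2 * (0 + (1 / c\<^sup>2 - 1 / c) / (x * d))"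
          by (rule mult_left_mono) simp
        then show ?thesis by (simp only: add_0 diff_conv_add_uminus)
      qed
      finally have "norm (vert \<theta> \<phi> (real n)) \<le> exp 1 / (x * d) * (2 * \<theta>) + 2 * ((1 / c\<^sup>2 - 1 / c) / (x * d))"
        by simp
      also have "\<dots> = C / x" using x d c by (simp add: C_def field_simps)
      finally show ?thesis .
    qed
    \<comment> \<open>To the right of \<open>a\<close> the ratio z s^{-\<alpha>} has modulus at most
      1/2, so there 1/(s^\<alpha> - z) expands into a geometric series whose terms are Hankel
      integrands of 1/\<Gamma>(\<alpha>k + \<beta>).\<close>
    define a where "a = ln (2 * x) / \<alpha>"
    have ea: "exp (\<alpha> * a) = 2 * x" using \<alpha> x by (simp add: a_def)
    have expansion: "(\<lambda>k. z ^ k * vert \<theta> (hk (\<alpha> * real k + \<beta>)) b) sums vert \<theta> \<phi> b" if ab: "a \<le> b" for b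
    proof -
      have eb: "2 * x \<le> exp (\<alpha> * b)" using ab \<alpha> unfolding ea[symmetric] by simp
      define q where "q w = z * exp (- (of_real \<alpha> * w))" for w
      have geo: "(\<Sum>k<n. z ^ k * hk (\<alpha> * real k + \<beta>) w) = \<phi> w - \<phi> w * q w ^ n" if "w \<in> strip \<theta>'" for w n
      proof -
        have h: "z ^ k * hk (\<alpha> * real k + \<beta>) w = hk (\<beta> - \<alpha>) w * exp (- (of_real \<alpha> * w)) * q w ^ k" for k
        proof -
          have "hk (\<alpha> * real k + \<beta>) w = hk (\<beta> - \<alpha>) w * exp (- (of_real \<alpha> * w)) * exp (- (of_real \<alpha> * w)) ^ k"
            unfolding hk_def exp_of_nat_mult[symmetric] exp_add[symmetric] by (simp add: algebra_simps)
          then show ?thesis by (simp add: q_def power_mult_distrib mult_ac)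
        qed
        have e: "exp (- (of_real \<alpha> * w)) * exp (of_real \<alpha> * w) = 1" by (simp add: exp_add[symmetric])
        have q1: "exp (- (of_real \<alpha> * w)) * (exp (of_real \<alpha> * w) - z) = 1 - q w"
          unfolding right_diff_distrib e by (simp add: q_def mult.commute)
        then have "1 - q w \<noteq> 0" using nonzero[OF that] by (metis exp_not_eq_zero mult_eq_0_iff)
        have "(\<Sum>k<n. z ^ k * hk (\<alpha> * real k + \<beta>) w) = hk (\<beta> - \<alpha>) w * exp (- (of_real \<alpha> * w)) * (\<Sum>k<n. q w ^ k)"
          unfolding h by (simp add: sum_distrib_left)
        also have "(\<Sum>k<n. q w ^ k) = (1 - q w ^ n) / (1 - q w)"
          using \<open>1 - q w \<noteq> 0\<close> by (subst sum_gp_strict) auto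
        also have "hk (\<beta> - \<alpha>) w * exp (- (of_real \<alpha> * w)) * ((1 - q w ^ n) / (1 - q w)) = \<phi> w * (1 - q w ^ n)"
          unfolding q1[symmetric] \<phi>_def using nonzero[OF that] by simp
        finally show ?thesis by (simp add: algebra_simps)
      qed
      \<comment> \<open>The remainder of the finite geometric sum; on the vertical segment it is of
        order 2^{-n}.\<close>
      define R where "R n w = \<phi> w * q w ^ n" for n w
      have holR: "R n holomorphic_on strip \<theta>'" for n
        unfolding R_def[abs_def] q_def by (intro holomorphic_intros hol)
      have partial: "(\<Sum>k<n. z ^ k * vert \<theta> (hk (\<alpha> * real k + \<beta>)) b) = vert \<theta> \<phi> b - vert \<theta> (R n) b" for n
      proof (rule has_integral_unique)
        show "((\<lambda>y. \<Sum>k<n. z ^ k * (\<i> * hk (\<alpha> * real k + \<beta>) (Complex b y))) has_integral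
            (\<Sum>k<n. z ^ k * vert \<theta> (hk (\<alpha> * real k + \<beta>)) b)) {- \<theta>..\<theta>}"
          using \<theta> by (intro has_integral_sum has_integral_mult_right vert_has_integral(1)[of _ "\<theta>'"] hk_holomorphic) auto
        have "((\<lambda>y. \<i> * \<phi> (Complex b y) - \<i> * R n (Complex b y)) has_integral vert \<theta> \<phi> b - vert \<theta> (R n) b) {- \<theta>..\<theta>}"
          using \<theta> by (intro has_integral_diff vert_has_integral(1)[of _ "\<theta>'"] hol holR) auto
        then show "((\<lambda>y. \<Sum>k<n. z ^ k * (\<i> * hk (\<alpha> * real k + \<beta>) (Complex b y))) has_integral
            vert \<theta> \<phi> b - vert \<theta> (R n) b) {- \<theta>..\<theta>}"
        proof (rule has_integral_eq[rotated])
          fix y assume "y \<in> {- \<theta>..\<theta>}"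
          then have "Complex b y \<in> strip \<theta>'" using \<theta> by (auto simp: strip_def)
          from geo[OF this, of n]
          have "\<i> * (\<Sum>k<n. z ^ k * hk (\<alpha> * real k + \<beta>) (Complex b y)) = \<i> * \<phi> (Complex b y) - \<i> * R n (Complex b y)"
            by (simp add: R_def right_diff_distrib)
          then show "\<i> * \<phi> (Complex b y) - \<i> * R n (Complex b y) = (\<Sum>k<n. z ^ k * (\<i> * hk (\<alpha> * real k + \<beta>) (Complex b y)))"
            by (simp add: sum_distrib_left mult.left_commute)
        qed
      qed
      define B where "B = exp (exp b + (1 - (\<beta> - \<alpha>)) * b) / x"
      have B: "0 \<le> B" using x by (simp add: B_def)
      have "(\<lambda>n. vert \<theta> (R n) b) \<longlonglongrightarrow> 0"
      proof (rule Lim_null_comparison)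
        show "\<forall>\<^sub>F n in sequentially. norm (vert \<theta> (R n) b) \<le> B * (1 / 2) ^ n * (2 * \<theta>)"
        proof (intro always_eventually allI vert_bound[OF holR \<theta>(4,3)])
          fix n y
          have "norm (q (Complex b y)) = x * exp (- (\<alpha> * b))"
            by (simp add: q_def norm_mult nz)
          also have "\<dots> \<le> 1 / 2" using eb by (simp add: exp_minus field_simps)
          finally have q: "norm (q (Complex b y)) \<le> 1 / 2" .
          have "exp (\<alpha> * b) = norm (exp (of_real \<alpha> * Complex b y))" by (simp add: expC norm_mult)
          then have "x \<le> norm (exp (of_real \<alpha> * Complex b y) - z)"
            using norm_triangle_ineq2[of "exp (of_real \<alpha> * Complex b y)" z] eb nz x by linarith
          moreover have "norm (hk (\<beta> - \<alpha>) (Complex b y)) \<le> exp (exp b + (1 - (\<beta> - \<alpha>)) * b)"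
            unfolding norm_hk by simp
          ultimately have "norm (\<phi> (Complex b y)) \<le> B"
            unfolding \<phi>_def norm_divide B_def using x by (intro frac_le) auto
          then show "norm (R n (Complex b y)) \<le> B * (1 / 2) ^ n"
            unfolding R_def norm_mult norm_power using q B by (intro mult_mono power_mono) auto
        qed
        show "(\<lambda>n. B * (1 / 2) ^ n * (2 * \<theta>)) \<longlonglongrightarrow> 0" by real_asymp
      qed
      then have "(\<lambda>n. vert \<theta> \<phi> b - vert \<theta> (R n) b) \<longlonglongrightarrow> vert \<theta> \<phi> b - 0" by (intro tendsto_intros)
      then show ?thesis unfolding sums_def partial by simp
    qed
    define Ka where "Ka = exp (exp a + a) * (2 * \<theta>) + 2 / (- cos \<theta>)"
    have ev: "\<forall>\<^sub>F n in sequentially. a \<le> real n"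
      using filterlim_real_sequentially by (simp add: filterlim_at_top)
    \<comment> \<open>Tannery's theorem exchanges the series with the limit of the contours. The
      majorant is \<open>vert_hk_bound\<close> at the position \<open>a\<close>, where x^k
      exp(-\<alpha> a k) = 2^{-k}.\<close>
    have lim: "(\<lambda>n. \<Sum>k. z ^ k * vert \<theta> (hk (\<alpha> * real k + \<beta>)) (real n)) \<longlonglongrightarrow>
        (\<Sum>k. z ^ k * (2 * of_real pi * \<i> * of_real (rGamma (\<alpha> * real k + \<beta>))))"
    proof (rule conjunct2[OF conjunct2[OF tannerys_theorem[where M="\<lambda>k. exp (- \<beta> * a) * Ka * (1 / 2) ^ k"]]])
      fix k
      show "(\<lambda>n. z ^ k * vert \<theta> (hk (\<alpha> * real k + \<beta>)) (real n)) \<longlonglongrightarrow>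
          z ^ k * (2 * of_real pi * \<i> * of_real (rGamma (\<alpha> * real k + \<beta>)))"
        using \<alpha> \<beta> by (intro tendsto_intros hankel \<theta>) auto
    next
      have "\<forall>\<^sub>F (k::nat, n) in at_top \<times>\<^sub>F sequentially. a \<le> real n"
        using ev by (subst eventually_prod2) auto
      then show "\<forall>\<^sub>F (k, n) in at_top \<times>\<^sub>F sequentially.
          norm (z ^ k * vert \<theta> (hk (\<alpha> * real k + \<beta>)) (real n)) \<le> exp (- \<beta> * a) * Ka * (1 / 2) ^ k"
      proof (rule eventually_mono, clarify)
        fix k n :: nat assume "a \<le> real n"
        then have "norm (vert \<theta> (hk (\<alpha> * real k + \<beta>)) (real n)) \<le> exp (- (\<alpha> * real k + \<beta>) * a) * Ka"
          unfolding Ka_def using \<alpha> \<beta> by (intro vert_hk_bound \<theta>) auto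
        then have "norm (z ^ k * vert \<theta> (hk (\<alpha> * real k + \<beta>)) (real n)) \<le> x ^ k * (exp (- (\<alpha> * real k + \<beta>) * a) * Ka)"
          unfolding norm_mult norm_power nz using x by (intro mult_left_mono) auto
        also have "exp (- (\<alpha> * real k + \<beta>) * a) = exp (- \<beta> * a) * (1 / exp (\<alpha> * a)) ^ k"
          by (simp add: exp_minus[symmetric] exp_of_nat_mult[symmetric] exp_add[symmetric] algebra_simps inverse_eq_divide[symmetric])
        also have "x ^ k * (exp (- \<beta> * a) * (1 / exp (\<alpha> * a)) ^ k * Ka) = exp (- \<beta> * a) * Ka * (1 / 2) ^ k"
          unfolding ea using x by (simp add: power_divide power_mult_distrib field_simps)
        finally show "norm (z ^ k * vert \<theta> (hk (\<alpha> * real k + \<beta>)) (real n)) \<le> exp (- \<beta> * a) * Ka * (1 / 2) ^ k" .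
      qed
    next
      show "summable (\<lambda>k. exp (- \<beta> * a) * Ka * (1 / 2) ^ k)"
        by (intro summable_mult summable_geometric) auto
    qed simp
    have eq_ev: "\<forall>\<^sub>F n in sequentially. (\<Sum>k. z ^ k * vert \<theta> (hk (\<alpha> * real k + \<beta>)) (real n)) = vert \<theta> \<phi> (real n)"
      using ev
    proof eventually_elim
      case (elim n)
      then show ?case by (rule sums_unique[OF expansion, symmetric])
    qed
    have E: "(\<Sum>k. z ^ k * (2 * of_real pi * \<i> * of_real (rGamma (\<alpha> * real k + \<beta>))))
        = 2 * of_real pi * \<i> * mittag_leffler \<alpha> \<beta> z"
      unfolding mittag_leffler_rGamma using summable_mittag_leffler[OF \<alpha>(1) \<beta>, of z]
      by (subst suminf_mult[symmetric]) (auto simp: summable_norm_cancel mult_ac)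
    have "(\<lambda>n. vert \<theta> \<phi> (real n)) \<longlonglongrightarrow> 2 * of_real pi * \<i> * mittag_leffler \<alpha> \<beta> z"
      by (rule Lim_transform_eventually[OF lim[unfolded E] eq_ev])
    then have "norm (2 * of_real pi * \<i> * mittag_leffler \<alpha> \<beta> z) \<le> C / x"
      by (intro tendsto_upperbound[OF tendsto_norm]) (auto simp: bound)
    then have "2 * pi * norm (mittag_leffler \<alpha> \<beta> z) \<le> C / x" by (simp add: norm_mult)
    moreover have "1 * norm (mittag_leffler \<alpha> \<beta> z) \<le> 2 * pi * norm (mittag_leffler \<alpha> \<beta> z)"
      using pi_gt3 by (intro mult_right_mono) auto
    ultimately show ?thesis by (simp add: z_def)
  qed
  then show ?thesis using that C by blast
qed

text \<open>The power series covers x \<le> 1, the contour bound covers x > 1; the factor 2 pays for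
  writing 1 + x in the denominator.\<close>

lemma mittag_leffler_1_decay:
  assumes \<alpha>: "0 < \<alpha>" "\<alpha> < 1"
  obtains C where "0 \<le> C" "\<And>x. 0 \<le> x \<Longrightarrow> norm (mittag_leffler \<alpha> 1 (- \<i> * of_real x)) \<le> C / (1 + x)"
proof -
  obtain C where C: "0 \<le> C" "\<And>x. 0 < x \<Longrightarrow> norm (mittag_leffler \<alpha> 1 (- \<i> * of_real x)) \<le> C / x"
    using mittag_leffler_imaginary_bound[OF \<alpha>, of 1] by auto
  obtain K where K: "0 \<le> K" "\<And>z. norm z \<le> 1 \<Longrightarrow> norm (mittag_leffler \<alpha> 1 z) \<le> K"
    using mittag_leffler_norm_le[OF \<alpha>(1), of 1 1] by auto
  have "norm (mittag_leffler \<alpha> 1 (- \<i> * of_real x)) \<le> 2 * (C + K) / (1 + x)" if x: "0 \<le> x" for x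
  proof (cases "x \<le> 1")
    case True
    have "norm (mittag_leffler \<alpha> 1 (- \<i> * of_real x)) \<le> K" using x True by (intro K) (simp add: norm_mult)
    also have "K \<le> 2 * (C + K) / (1 + x)"
    proof -
      have "K * (1 + x) \<le> K * 2" using x True K by (intro mult_left_mono) auto
      then show ?thesis using x C by (simp add: field_simps)
    qed
    finally show ?thesis .
  next
    case False
    have "norm (mittag_leffler \<alpha> 1 (- \<i> * of_real x)) \<le> C / x" using False by (intro C) auto
    also have "\<dots> \<le> 2 * (C + K) / (1 + x)"
    proof -
      have "C * (1 + x) \<le> C * (2 * x)" using False C by (intro mult_left_mono) auto
      moreover have "0 \<le> K * x" using K x by simp
      ultimately show ?thesis using False by (simp add: field_simps)
    qed
    finally show ?thesis .
  qed
  then show ?thesis using that[of "2 * (C + K)"] C K by auto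
qed

text \<open>The contour bound at parameter 0 reads x |E_{\<alpha>,\<alpha>}(-\<i>x)| \<le> C/x by
  \<open>mittag_leffler_0\<close>. This extra power of x makes the kernels of the modes integrable
  at infinity, uniformly after scaling.\<close>

lemma mittag_leffler_self_decay:
  assumes \<alpha>: "0 < \<alpha>" "\<alpha> < 1"
  obtains C where "0 \<le> C" "\<And>x. 0 \<le> x \<Longrightarrow> norm (mittag_leffler \<alpha> \<alpha> (- \<i> * of_real x)) \<le> C / (1 + x\<^sup>2)"
proof -
  obtain C where C: "0 \<le> C" "\<And>x. 0 < x \<Longrightarrow> norm (mittag_leffler \<alpha> 0 (- \<i> * of_real x)) \<le> C / x"
    using mittag_leffler_imaginary_bound[OF \<alpha>, of 0] by auto
  obtain K where K: "0 \<le> K" "\<And>z. norm z \<le> 1 \<Longrightarrow> norm (mittag_leffler \<alpha> \<alpha> z) \<le> K"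
    using mittag_leffler_norm_le[OF \<alpha>(1), of \<alpha> 1] \<alpha> by auto
  have "norm (mittag_leffler \<alpha> \<alpha> (- \<i> * of_real x)) \<le> 2 * (C + K) / (1 + x\<^sup>2)" if x: "0 \<le> x" for x
  proof (cases "x \<le> 1")
    case True
    have "norm (mittag_leffler \<alpha> \<alpha> (- \<i> * of_real x)) \<le> K" using x True by (intro K) (simp add: norm_mult)
    also have "K \<le> 2 * (C + K) / (1 + x\<^sup>2)"
    proof -
      have "x\<^sup>2 \<le> 1" using x True by (simp add: power_le_one)
      then have "K * (1 + x\<^sup>2) \<le> K * 2" using K by (intro mult_left_mono) auto
      then have "K * (1 + x\<^sup>2) \<le> 2 * (C + K)" using C by simp
      then show ?thesis by (simp add: pos_le_divide_eq add_pos_nonneg)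
    qed
    finally show ?thesis .
  next
    case False
    have "x * norm (mittag_leffler \<alpha> \<alpha> (- \<i> * of_real x)) \<le> C / x"
      using C(2)[of x] False mittag_leffler_0[OF \<alpha>(1)] x by (simp add: norm_mult)
    then have "norm (mittag_leffler \<alpha> \<alpha> (- \<i> * of_real x)) \<le> C / x\<^sup>2"
      using False by (simp add: field_simps power2_eq_square)
    also have "\<dots> \<le> 2 * (C + K) / (1 + x\<^sup>2)"
    proof -
      have "1 \<le> x\<^sup>2" using False by (simp add: one_le_power)
      then have "C * (1 + x\<^sup>2) \<le> C * (2 * x\<^sup>2)" using C by (intro mult_left_mono) auto
      moreover have "0 \<le> K * x\<^sup>2" using K by simp
      ultimately have "C * (1 + x\<^sup>2) \<le> 2 * (C + K) * x\<^sup>2" by (simp add: algebra_simps)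
      moreover have "0 < x\<^sup>2" "0 < 1 + x\<^sup>2" using False by (auto simp: add_pos_nonneg)
      ultimately show ?thesis by (simp add: pos_le_divide_eq pos_divide_le_eq)
    qed
    finally show ?thesis .
  qed
  then show ?thesis using that[of "2 * (C + K)"] C K by auto
qed

section \<open>Convolution and fractional integration on an interval\<close>

text \<open>Where the integrand is not integrable the value is 0. Additivity therefore asks for
  integrability at the point, and associativity is asserted almost everywhere only.\<close>

definition conv :: "(real \<Rightarrow> complex) \<Rightarrow> (real \<Rightarrow> complex) \<Rightarrow> real \<Rightarrow> complex" where
  "conv f g x = (LINT y|lborel. f (x - y) * g y)"

lemma borel_measurable_conv [measurable]:
  assumes [measurable]: "f \<in> borel_measurable borel" "g \<in> borel_measurable borel"
  shows "conv f g \<in> borel_measurable borel"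
  unfolding conv_def[abs_def] by measurable

lemma integral_reflect_shift:
  fixes f :: "real \<Rightarrow> complex"
  shows "(LINT y|lborel. f (x - y)) = (LINT y|lborel. f y)"
  using lborel_integral_real_affine[of "-1" f x] by simp

lemma nn_integral_convp:
  assumes [measurable]: "\<kappa> \<in> borel_measurable borel" "w \<in> borel_measurable borel"
  shows "(\<integral>\<^sup>+x. convp \<kappa> w x \<partial>lborel) = (\<integral>\<^sup>+x. \<kappa> x \<partial>lborel) * (\<integral>\<^sup>+x. w x \<partial>lborel)"
proof -
  have "(\<integral>\<^sup>+x. convp \<kappa> w x \<partial>lborel) = (\<integral>\<^sup>+y. (\<integral>\<^sup>+x. \<kappa> (x - y) * w y \<partial>lborel) \<partial>lborel)"
    unfolding convp_def by (rule lborel_pair.Fubini') measurable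
  also have "\<dots> = (\<integral>\<^sup>+y. (\<integral>\<^sup>+x. \<kappa> x \<partial>lborel) * w y \<partial>lborel)"
  proof (rule nn_integral_cong)
    fix y
    have "(\<integral>\<^sup>+x. \<kappa> (x - y) \<partial>lborel) = (\<integral>\<^sup>+x. \<kappa> x \<partial>lborel)"
      using nn_integral_real_affine[of \<kappa> 1 "- y"] by simp
    then show "(\<integral>\<^sup>+x. \<kappa> (x - y) * w y \<partial>lborel) = (\<integral>\<^sup>+x. \<kappa> x \<partial>lborel) * w y"
      by (simp add: nn_integral_multc)
  qed
  finally show ?thesis by (simp add: nn_integral_cmult)
qed

abbreviation enorm :: "(real \<Rightarrow> complex) \<Rightarrow> real \<Rightarrow> ennreal" where
  "enorm f \<equiv> (\<lambda>x. ennreal (norm (f x)))"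

lemma convp_enorm: "convp (enorm f) (enorm g) x = (\<integral>\<^sup>+y. ennreal (norm (f (x - y) * g y)) \<partial>lborel)"
  by (simp add: convp_def norm_mult ennreal_mult')

lemma norm_conv_le:
  "ennreal (norm (conv f g x)) \<le> convp (enorm f) (enorm g) x"
proof (cases "integrable lborel (\<lambda>y. f (x - y) * g y)")
  case True
  then show ?thesis unfolding convp_enorm conv_def by (rule integral_norm_bound_ennreal)
qed (simp add: conv_def not_integrable_integral_eq)

lemma convp_finite_AE:
  assumes "integrable lborel f" "integrable lborel g"
  shows "AE x in lborel. convp (enorm f) (enorm g) x < \<infinity>"
proof -
  have [measurable]: "f \<in> borel_measurable borel" "g \<in> borel_measurable borel" using assms by auto
  have "(\<integral>\<^sup>+x. convp (enorm f) (enorm g) x \<partial>lborel) < \<infinity>"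
    using assms by (subst nn_integral_convp) (auto simp: integrable_iff_bounded ennreal_mult_less_top)
  then have "AE x in lborel. convp (enorm f) (enorm g) x \<noteq> \<infinity>"
    by (intro nn_integral_noteq_infinite) auto
  then show ?thesis by eventually_elim (simp add: less_top)
qed

lemma conv_integrable_AE:
  fixes f g :: "real \<Rightarrow> complex"
  assumes "integrable lborel f" "integrable lborel g"
  shows "AE x in lborel. integrable lborel (\<lambda>y. f (x - y) * g y)"
proof -
  have [measurable]: "f \<in> borel_measurable borel" "g \<in> borel_measurable borel" using assms by auto
  from convp_finite_AE[OF assms] show ?thesis
    by eventually_elim (simp add: convp_enorm integrable_iff_bounded)
qed

lemma conv_integrable:
  assumes "integrable lborel f" "integrable lborel g"
  shows "integrable lborel (conv f g)"
proof -
  have [measurable]: "f \<in> borel_measurable borel" "g \<in> borel_measurable borel" using assms by auto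
  have "(\<integral>\<^sup>+x. ennreal (norm (conv f g x)) \<partial>lborel) \<le> (\<integral>\<^sup>+x. convp (enorm f) (enorm g) x \<partial>lborel)"
    by (intro nn_integral_mono norm_conv_le)
  also have "\<dots> < \<infinity>"
    using assms by (subst nn_integral_convp) (auto simp: integrable_iff_bounded ennreal_mult_less_top)
  finally show ?thesis by (simp add: integrable_iff_bounded)
qed

lemma conv_commute: "conv f g x = conv g f x"
  unfolding conv_def using integral_reflect_shift[of "\<lambda>y. g (x - y) * f y" x] by (simp add: mult.commute)

text \<open>Fubini's theorem at each x for which the triple convolution of the absolute values is
  finite. The integral of that convolution is the product of three L^1 norms, so almost every x
  qualifies.\<close>

lemma conv_assoc:
  assumes "integrable lborel f" "integrable lborel g" "integrable lborel h"
  shows "AE x in lborel. conv (conv f g) h x = conv f (conv g h) x"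
proof -
  have [measurable]: "f \<in> borel_measurable borel" "g \<in> borel_measurable borel" "h \<in> borel_measurable borel"
    using assms by auto
  have "(\<integral>\<^sup>+x. convp (enorm f) (convp (enorm g) (enorm h)) x \<partial>lborel) < \<infinity>"
  proof -
    have "(\<integral>\<^sup>+x. convp (enorm f) (convp (enorm g) (enorm h)) x \<partial>lborel)
        = (\<integral>\<^sup>+x. enorm f x \<partial>lborel) * ((\<integral>\<^sup>+x. enorm g x \<partial>lborel) * (\<integral>\<^sup>+x. enorm h x \<partial>lborel))"
      by (simp add: nn_integral_convp)
    then show ?thesis using assms by (simp add: integrable_iff_bounded ennreal_mult_less_top)
  qed
  then have "AE x in lborel. convp (enorm f) (convp (enorm g) (enorm h)) x \<noteq> \<infinity>"
    by (intro nn_integral_noteq_infinite) auto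
  then show ?thesis
  proof eventually_elim
    case (elim x)
    have "(\<integral>\<^sup>+w. (\<integral>\<^sup>+y. ennreal (norm (f (x - w) * (g (w - y) * h y))) \<partial>lborel) \<partial>lborel)
        = convp (enorm f) (convp (enorm g) (enorm h)) x"
      unfolding convp_enorm convp_def[of "enorm f"]
      by (simp add: norm_mult ennreal_mult' nn_integral_cmult)
    then have "(\<integral>\<^sup>+w. (\<integral>\<^sup>+y. ennreal (norm (f (x - w) * (g (w - y) * h y))) \<partial>lborel) \<partial>lborel) < \<infinity>"
      using elim by (simp add: less_top)
    then have int: "integrable (lborel \<Otimes>\<^sub>M lborel) (\<lambda>(w, y). f (x - w) * (g (w - y) * h y))"
      by (simp add: integrable_iff_bounded lborel.nn_integral_fst[symmetric] split_beta')
    have "conv (conv f g) h x = (LINT y|lborel. (LINT w|lborel. f (x - w) * (g (w - y) * h y)))"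
      unfolding conv_def[of "conv f g"]
    proof (rule Bochner_Integration.integral_cong[OF refl])
      fix y
      have "conv f g (x - y) = (LINT w|lborel. f (x - w) * g (w - y))"
        unfolding conv_def using lborel_integral_real_affine[of 1 "\<lambda>w. f (x - y - w) * g w" "- y"] 
        by (simp add: algebra_simps)
      then show "conv f g (x - y) * h y = (LINT w|lborel. f (x - w) * (g (w - y) * h y))"
        by (simp add: mult.assoc[symmetric])
    qed
    also have "\<dots> = (LINT w|lborel. (LINT y|lborel. f (x - w) * (g (w - y) * h y)))"
      using lborel_pair.Fubini_integral[OF int] by simp
    also have "\<dots> = conv f (conv g h) x"
      by (simp add: conv_def)
    finally show ?case .
  qed
qed

lemma conv_add_left:
  assumes "integrable lborel (\<lambda>y. f (x - y) * h y)" "integrable lborel (\<lambda>y. g (x - y) * h y)"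
  shows "conv (\<lambda>t. f t + g t) h x = conv f h x + conv g h x"
  using assms by (simp add: conv_def distrib_right)

lemma conv_add_right:
  assumes "integrable lborel (\<lambda>y. f (x - y) * h y)" "integrable lborel (\<lambda>y. f (x - y) * g y)"
  shows "conv f (\<lambda>t. h t + g t) x = conv f h x + conv f g x"
  using assms by (simp add: conv_def distrib_left)

lemma conv_cmult_left: "conv (\<lambda>t. c * f t) h x = c * conv f h x"
  by (simp add: conv_def mult.assoc)

lemma conv_cmult_right: "conv f (\<lambda>t. c * h t) x = c * conv f h x"
  by (simp add: conv_def mult.left_commute)

text \<open>Causality: a kernel vanishing on the nonpositive axis sees only the values before time
  x. This makes the cut-offs at T harmless.\<close>

lemma conv_cong_right:
  assumes h: "AE t in lborel. t < T \<longrightarrow> h t = h' t" and f: "\<And>t. t \<le> 0 \<Longrightarrow> f t = 0" and x: "x \<le> T"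
    and [measurable]: "f \<in> borel_measurable borel" "h \<in> borel_measurable borel" "h' \<in> borel_measurable borel"
  shows "conv f h x = conv f h' x"
  unfolding conv_def
proof (rule integral_cong_AE)
  show "AE y in lborel. f (x - y) * h y = f (x - y) * h' y"
    using h
  proof eventually_elim
    case (elim y)
    then show ?case using f[of "x - y"] x by (cases "y < x") auto
  qed
qed measurable

lemma conv_cong_left:
  assumes "AE t in lborel. t < T \<longrightarrow> h t = h' t" "\<And>t. t \<le> 0 \<Longrightarrow> f t = 0" "x \<le> T"
    "f \<in> borel_measurable borel" "h \<in> borel_measurable borel" "h' \<in> borel_measurable borel"
  shows "conv h f x = conv h' f x"
  using conv_cong_right[OF assms] by (simp add: conv_commute[of _ f])

lemma conv_nonpos:
  assumes "\<And>t. t \<le> 0 \<Longrightarrow> f t = 0" "\<And>t. t \<le> 0 \<Longrightarrow> g t = 0" "x \<le> 0"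
  shows "conv f g x = 0"
proof -
  have "f (x - y) * g y = 0" for y
    using assms(1)[of "x - y"] assms(2)[of y] assms(3) by (cases "y \<le> 0") auto
  then show ?thesis unfolding conv_def by (simp only: Bochner_Integration.integral_zero)
qed

text \<open>The positive and negative parts of \<open>h\<close> are densities of finite measures
  that agree on all half-lines, hence are equal; densities are unique almost everywhere.\<close>

lemma AE_zero_if_tail_integrals_zero:
  fixes h :: "real \<Rightarrow> real"
  assumes h: "integrable lborel h" and z: "\<And>x. (LINT y|lborel. h y * indicator {x<..} y) = 0"
  shows "AE y in lborel. h y = 0"
proof -
  have [measurable]: "h \<in> borel_measurable borel" using h by auto
  let ?p = "\<lambda>y. ennreal (h y)" and ?m = "\<lambda>y. ennreal (- h y)"
  have fin: "(\<integral>\<^sup>+y. ?p y \<partial>lborel) < \<infinity>" "(\<integral>\<^sup>+y. ?m y \<partial>lborel) < \<infinity>"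
    using h by (auto simp: real_integrable_def less_top)
  have le: "(\<integral>\<^sup>+y. ?p y * indicator {x<..} y \<partial>lborel) \<le> (\<integral>\<^sup>+y. ?p y \<partial>lborel)" for x
    by (intro nn_integral_mono) (auto simp: indicator_def)
  have lem: "(\<integral>\<^sup>+y. ?m y * indicator {x<..} y \<partial>lborel) \<le> (\<integral>\<^sup>+y. ?m y \<partial>lborel)" for x
    by (intro nn_integral_mono) (auto simp: indicator_def)
  have "density lborel ?p = density lborel ?m"
  proof (rule measure_eqI_lessThan)
    fix x :: real
    show "emeasure (density lborel ?p) {x<..} < \<infinity>"
      using le[of x] fin by (simp add: emeasure_density le_less_trans)
    have int: "integrable lborel (\<lambda>y. h y * indicator {x<..} y)"
      using h by (intro integrable_real_mult_indicator) auto
    have "(LINT y|lborel. h y * indicator {x<..} y)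
       = enn2real (\<integral>\<^sup>+y. ennreal (h y * indicator {x<..} y) \<partial>lborel)
         - enn2real (\<integral>\<^sup>+y. ennreal (- (h y * indicator {x<..} y)) \<partial>lborel)"
      by (rule real_lebesgue_integral_def[OF int])
    also have "(\<integral>\<^sup>+y. ennreal (h y * indicator {x<..} y) \<partial>lborel) = (\<integral>\<^sup>+y. ?p y * indicator {x<..} y \<partial>lborel)"
      by (intro nn_integral_cong) (auto simp: indicator_def)
    also have "(\<integral>\<^sup>+y. ennreal (- (h y * indicator {x<..} y)) \<partial>lborel) = (\<integral>\<^sup>+y. ?m y * indicator {x<..} y \<partial>lborel)"
      by (intro nn_integral_cong) (auto simp: indicator_def)
    finally have "enn2real (\<integral>\<^sup>+y. ?p y * indicator {x<..} y \<partial>lborel) = enn2real (\<integral>\<^sup>+y. ?m y * indicator {x<..} y \<partial>lborel)"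
      using z[of x] by simp
    moreover have "(\<integral>\<^sup>+y. ?p y * indicator {x<..} y \<partial>lborel) < \<infinity>" "(\<integral>\<^sup>+y. ?m y * indicator {x<..} y \<partial>lborel) < \<infinity>"
      using le[of x] lem[of x] fin by (auto intro: le_less_trans)
    ultimately have "(\<integral>\<^sup>+y. ?p y * indicator {x<..} y \<partial>lborel) = (\<integral>\<^sup>+y. ?m y * indicator {x<..} y \<partial>lborel)"
      by (metis ennreal_enn2real infinity_ennreal_def)
    then show "emeasure (density lborel ?p) {x<..} = emeasure (density lborel ?m) {x<..}"
      by (simp add: emeasure_density)
  qed auto
  then have "AE y in lborel. ?p y = ?m y"
    by (intro sigma_finite_measure.density_unique[OF sigma_finite_lborel]) auto
  then show ?thesis
  proof eventually_elim
    case (elim y)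
    then show ?case by (cases "h y \<ge> 0"; cases "h y \<le> 0") (auto simp: ennreal_neg ennreal_eq_0_iff)
  qed
qed

lemma AE_point_in_interval:
  fixes a b :: real
  assumes "AE x in lborel. P x" "a < b"
  obtains x where "a < x" "x < b" "P x"
proof (rule ccontr)
  assume "\<not> thesis"
  then have no: "\<not> P x" if "a < x" "x < b" for x using that \<open>\<And>x. \<lbrakk>a < x; x < b; P x\<rbrakk> \<Longrightarrow> thesis\<close> by blast
  have "AE x in lborel. x \<notin> {a<..<b}" using assms(1) by eventually_elim (use no in auto)
  then have "emeasure lborel {a<..<b} = 0" by (subst (asm) AE_iff_null_sets[symmetric]) (auto simp: null_sets_def)
  then show False using assms(2) by simp
qed

text \<open>The hypothesis is an almost-everywhere one because it will come from associativity of
  convolutions. A set of full measure is dense, so each x < T is a limit of good points from the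
  right, and dominated convergence removes the exception; the tail integrals then vanish for real
  and imaginary parts.\<close>

lemma AE_zero_if_running_integral_zero:
  fixes h :: "real \<Rightarrow> complex"
  assumes h: "integrable lborel h" and supp: "\<And>t. t \<notin> {0<..<T} \<Longrightarrow> h t = 0"
    and z: "AE x in lborel. x < T \<longrightarrow> (LINT y|lborel. h y * indicator {..<x} y) = 0"
  shows "AE y in lborel. h y = 0"
proof -
  have [measurable]: "h \<in> borel_measurable borel" using h by auto
  have run: "(LINT y|lborel. h y * indicator {..x} y) = 0" if x: "x < T" for x
  proof -
    have "\<exists>s. x < s \<and> s < x + (T - x) / real (Suc n) \<and> (s < T \<longrightarrow> (LINT y|lborel. h y * indicator {..<s} y) = 0)" for n
      by (rule AE_point_in_interval[OF z, of x "x + (T - x) / real (Suc n)"]) (use x in auto)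
    then obtain s where s: "\<And>n. x < s n" "\<And>n. s n < x + (T - x) / real (Suc n)"
        "\<And>n. s n < T \<Longrightarrow> (LINT y|lborel. h y * indicator {..<s n} y) = 0" by metis
    have "s n < T" for n
    proof -
      have "(T - x) / real (Suc n) \<le> (T - x) / 1" using x by (intro divide_left_mono) auto
      then show ?thesis using s(2)[of n] by simp
    qed
    then have s0: "(LINT y|lborel. h y * indicator {..<s n} y) = 0" for n using s(3) by simp
    have slim: "s \<longlonglongrightarrow> x"
    proof (rule tendsto_sandwich[of "\<lambda>_. x" s _ "\<lambda>n. x + (T - x) / real (Suc n)"])
      show "(\<lambda>n. x + (T - x) / real (Suc n)) \<longlonglongrightarrow> x" by real_asymp
    qed (use s(1,2) in \<open>auto intro!: always_eventually less_imp_le\<close>)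
    have "(\<lambda>n. LINT y|lborel. h y * indicator {..<s n} y) \<longlonglongrightarrow> (LINT y|lborel. h y * indicator {..x} y)"
    proof (rule integral_dominated_convergence[where w="\<lambda>y. norm (h y)"])
      show "AE y in lborel. (\<lambda>n. h y * indicator {..<s n} y) \<longlonglongrightarrow> h y * indicator {..x} y"
      proof (rule AE_I2)
        fix y
        have "\<forall>\<^sub>F n in sequentially. (y < s n) = (y \<le> x)"
        proof (cases "y \<le> x")
          case True
          then have "y < s n" for n using s(1)[of n] by simp
          then show ?thesis using True by simp
        next
          case False
          then have "\<forall>\<^sub>F n in sequentially. s n < y" using slim by (intro order_tendstoD) auto
          then show ?thesis by eventually_elim (use False in auto)
        qed
        then have "\<forall>\<^sub>F n in sequentially. h y * indicator {..<s n} y = h y * indicator {..x} y"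
          by eventually_elim (auto simp: indicator_def)
        then show "(\<lambda>n. h y * indicator {..<s n} y) \<longlonglongrightarrow> h y * indicator {..x} y"
          by (rule tendsto_eventually)
      qed
    qed (use h in \<open>auto simp: indicator_def\<close>)
    then show ?thesis using s0 LIMSEQ_unique[OF _ tendsto_const] by (simp add: LIMSEQ_const_iff)
  qed
  have total: "(LINT y|lborel. h y) = 0"
  proof -
    have "(\<lambda>n. LINT y|lborel. h y * indicator {..T - 1 / real (Suc n)} y) \<longlonglongrightarrow> (LINT y|lborel. h y)"
    proof (rule integral_dominated_convergence[where w="\<lambda>y. norm (h y)"])
      show "AE y in lborel. (\<lambda>n. h y * indicator {..T - 1 / real (Suc n)} y) \<longlonglongrightarrow> h y"
      proof (rule AE_I2)
        fix y
        have "\<forall>\<^sub>F n in sequentially. h y * indicator {..T - 1 / real (Suc n)} y = h y"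
        proof (cases "y < T")
          case True
          have "(\<lambda>n. T - 1 / real (Suc n)) \<longlonglongrightarrow> T" by real_asymp
          then have "\<forall>\<^sub>F n in sequentially. y < T - 1 / real (Suc n)" using True by (intro order_tendstoD) auto
          then show ?thesis by eventually_elim auto
        next
          case False then show ?thesis using supp[of y] by simp
        qed
        then show "(\<lambda>n. h y * indicator {..T - 1 / real (Suc n)} y) \<longlonglongrightarrow> h y"
          by (rule tendsto_eventually)
      qed
    qed (use h in \<open>auto simp: indicator_def\<close>)
    moreover have "(LINT y|lborel. h y * indicator {..T - 1 / real (Suc n)} y) = 0" for n
      by (rule run) simp
    ultimately show ?thesis by (simp add: LIMSEQ_const_iff)
  qed
  have tail: "(LINT y|lborel. h y * indicator {x<..} y) = 0" for x
  proof (cases "x < T")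
    case True
    have "(LINT y|lborel. h y * indicator {x<..} y) = (LINT y|lborel. h y - h y * indicator {..x} y)"
      by (intro Bochner_Integration.integral_cong) (auto simp: indicator_def)
    also have "\<dots> = (LINT y|lborel. h y) - (LINT y|lborel. h y * indicator {..x} y)"
      using h by (intro Bochner_Integration.integral_diff Bochner_Integration.integrable_bound[OF h])
        (auto simp: indicator_def)
    finally show ?thesis using total run[OF True] by simp
  next
    case False
    then have "h y * indicator {x<..} y = 0" for y using supp[of y] by (auto simp: indicator_def)
    then show ?thesis by (simp only: Bochner_Integration.integral_zero)
  qed
  have ind: "integrable lborel (\<lambda>y. h y * indicator {x<..} y)" for x
    by (rule Bochner_Integration.integrable_bound[OF h]) (auto simp: indicator_def)
  have "(LINT y|lborel. Re (h y) * indicator {x<..} y) = 0" for x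
  proof -
    have "(LINT y|lborel. Re (h y) * indicator {x<..} y) = (LINT y|lborel. Re (h y * indicator {x<..} y))"
      by (intro Bochner_Integration.integral_cong) (auto simp: indicator_def)
    also have "\<dots> = Re (LINT y|lborel. h y * indicator {x<..} y)" using ind by (rule integral_Re)
    finally show ?thesis by (simp add: tail)
  qed
  moreover have "(LINT y|lborel. Im (h y) * indicator {x<..} y) = 0" for x
  proof -
    have "(LINT y|lborel. Im (h y) * indicator {x<..} y) = (LINT y|lborel. Im (h y * indicator {x<..} y))"
      by (intro Bochner_Integration.integral_cong) (auto simp: indicator_def)
    also have "\<dots> = Im (LINT y|lborel. h y * indicator {x<..} y)" using ind by (rule integral_Im)
    finally show ?thesis by (simp add: tail)
  qed
  ultimately have "AE y in lborel. Re (h y) = 0" "AE y in lborel. Im (h y) = 0"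
    using h by (auto intro!: AE_zero_if_tail_integrals_zero)
  then show ?thesis by eventually_elim (simp add: complex_eq_iff)
qed

text \<open>The kernels \<open>t\<^sup>b\<^sup>-\<^sup>1 / \<Gamma>(b)\<close> and \<open>t\<^sup>b\<^sup>-\<^sup>1 E\<^bsub>\<alpha>,b\<^esub>(z t\<^sup>\<alpha>)\<close>, cut off at \<open>T\<close> to be integrable on
  the line. The cut-off does not change convolutions on \<open>(0,T)\<close>.\<close>

definition gk :: "real \<Rightarrow> real \<Rightarrow> real \<Rightarrow> complex" where
  "gk T b t = (if 0 < t \<and> t < T then of_real (t powr (b - 1) * rGamma b) else 0)"

definition ek :: "real \<Rightarrow> real \<Rightarrow> real \<Rightarrow> complex \<Rightarrow> real \<Rightarrow> complex" where
  "ek T \<alpha> b z t = (if 0 < t \<and> t < T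
     then of_real (t powr (b - 1)) * mittag_leffler \<alpha> b (z * of_real (t powr \<alpha>)) else 0)"

lemma gk_measurable [measurable]: "gk T b \<in> borel_measurable borel"
  unfolding gk_def[abs_def] by measurable

lemma mittag_leffler_measurable [measurable]: "mittag_leffler \<alpha> b \<in> borel_measurable borel"
  unfolding mittag_leffler_rGamma[abs_def] by measurable

lemma ek_measurable [measurable]: "ek T \<alpha> b z \<in> borel_measurable borel"
  unfolding ek_def[abs_def] by measurable

lemma gk_nonpos [simp]: "t \<le> 0 \<Longrightarrow> gk T b t = 0" and ek_nonpos [simp]: "t \<le> 0 \<Longrightarrow> ek T \<alpha> b z t = 0"
  by (auto simp: gk_def ek_def)

section \<open>Semigroup law and resolvent equation for the kernels\<close>

lemma integrable_powr_Ioo: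
  fixes a :: real
  assumes "0 < a"
  shows "integrable lborel (\<lambda>t. t powr (a - 1) * indicator {0<..<T} t)"
proof (rule integrableI_nonneg)
  have "(\<integral>\<^sup>+t. ennreal (t powr (a - 1) * indicator {0<..<T} t) \<partial>lborel)
      \<le> (\<integral>\<^sup>+t. ennreal (t powr (a - 1)) * indicator {0<..<\<bar>T\<bar>} t \<partial>lborel)"
    by (intro nn_integral_mono) (auto simp: indicator_def)
  also have "\<dots> = ennreal (\<bar>T\<bar> powr a / a)" using assms by (intro nn_integral_powr_from_0) auto
  finally show "(\<integral>\<^sup>+t. ennreal (t powr (a - 1) * indicator {0<..<T} t) \<partial>lborel) < \<infinity>"
    by (simp add: le_less_trans)
qed auto

lemma gk_integrable:
  assumes "0 < b"
  shows "integrable lborel (gk T b)"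
proof -
  have "integrable lborel (\<lambda>t. t powr (b - 1) * indicator {0<..<T} t * rGamma b)"
    by (intro integrable_mult_left integrable_powr_Ioo assms)
  then show ?thesis
    by (rule Bochner_Integration.integrable_bound) (auto simp: gk_def norm_mult)
qed

lemma ek_norm_bound:
  assumes "0 < \<alpha>" "0 < b"
  obtains K where "0 \<le> K" "\<And>t. norm (ek T \<alpha> b z t) \<le> K * (t powr (b - 1) * indicator {0<..<T} t)"
proof -
  obtain K where K: "0 \<le> K" "\<And>w. norm w \<le> norm z * T powr \<alpha> \<Longrightarrow> norm (mittag_leffler \<alpha> b w) \<le> K"
    using mittag_leffler_norm_le[of \<alpha> b "norm z * T powr \<alpha>"] assms by (metis less_imp_le)
  have "norm (ek T \<alpha> b z t) \<le> K * (t powr (b - 1) * indicator {0<..<T} t)" for t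
  proof (cases "t \<in> {0<..<T}")
    case True
    have "norm (z * of_real (t powr \<alpha>)) \<le> norm z * T powr \<alpha>"
      using True assms by (auto simp: norm_mult intro!: mult_left_mono powr_mono2)
    then have "norm (mittag_leffler \<alpha> b (z * of_real (t powr \<alpha>))) \<le> K" by (rule K)
    then show ?thesis using True by (simp add: ek_def norm_mult mult.commute mult_right_mono)
  qed (auto simp: ek_def)
  then show ?thesis using that K by blast
qed

lemma ek_integrable:
  assumes "0 < \<alpha>" "0 < b"
  shows "integrable lborel (ek T \<alpha> b z)"
proof -
  obtain K where K: "0 \<le> K" "\<And>t. norm (ek T \<alpha> b z t) \<le> K * (t powr (b - 1) * indicator {0<..<T} t)"
    using ek_norm_bound[OF assms] by blast
  have "integrable lborel (\<lambda>t. K * (t powr (b - 1) * indicator {0<..<T} t))"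
    by (intro integrable_mult_right integrable_powr_Ioo assms)
  then show ?thesis
  proof (rule Bochner_Integration.integrable_bound)
    show "AE t in lborel. norm (ek T \<alpha> b z t) \<le> norm (K * (t powr (b - 1) * indicator {0<..<T} t))"
      using K by (intro AE_I2) (auto intro: order_trans[OF _ abs_ge_self])
  qed auto
qed

lemma nn_integral_beta:
  fixes a b t :: real
  assumes a: "0 < a" and b: "0 < b" and t: "0 < t"
  shows "(\<integral>\<^sup>+y. ennreal ((t - y) powr (a - 1) * y powr (b - 1)) * indicator {0<..<t} y \<partial>lborel)
     = ennreal (t powr (a + b - 1) * Beta a b)"
proof -
  have "((\<lambda>s. s powr (b - 1) * (1 - s) powr (a - 1)) has_integral Beta b a) {0<..<1}"
    using has_integral_Beta_real[OF b a] by (simp add: has_integral_Icc_iff_Ioo)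
  then have B: "(\<integral>\<^sup>+s. ennreal (indicator {0<..<1} s * (s powr (b - 1) * (1 - s) powr (a - 1))) \<partial>lborel) = ennreal (Beta b a)"
    by (intro nn_integral_has_integral_lebesgue) auto
  have "(\<integral>\<^sup>+y. ennreal ((t - y) powr (a - 1) * y powr (b - 1)) * indicator {0<..<t} y \<partial>lborel)
     = ennreal t * (\<integral>\<^sup>+s. ennreal ((t - t * s) powr (a - 1) * (t * s) powr (b - 1)) * indicator {0<..<t} (t * s) \<partial>lborel)"
    using t nn_integral_real_affine[of "\<lambda>y. ennreal ((t - y) powr (a - 1) * y powr (b - 1)) * indicator {0<..<t} y" t 0]
    by simp
  also have "(\<integral>\<^sup>+s. ennreal ((t - t * s) powr (a - 1) * (t * s) powr (b - 1)) * indicator {0<..<t} (t * s) \<partial>lborel)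
     = (\<integral>\<^sup>+s. ennreal (t powr (a + b - 2)) * ennreal (indicator {0<..<1} s * (s powr (b - 1) * (1 - s) powr (a - 1))) \<partial>lborel)"
  proof (rule nn_integral_cong)
    fix s :: real
    show "ennreal ((t - t * s) powr (a - 1) * (t * s) powr (b - 1)) * indicator {0<..<t} (t * s)
      = ennreal (t powr (a + b - 2)) * ennreal (indicator {0<..<1} s * (s powr (b - 1) * (1 - s) powr (a - 1)))"
    proof (cases "0 < s \<and> s < 1")
      case True
      have "(t - t * s) powr (a - 1) = t powr (a - 1) * (1 - s) powr (a - 1)"
        using True t by (simp add: powr_mult[symmetric] right_diff_distrib)
      moreover have "(t * s) powr (b - 1) = t powr (b - 1) * s powr (b - 1)"
        using True t by (simp add: powr_mult)
      moreover have "t powr (a - 1) * t powr (b - 1) = t powr (a + b - 2)"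
        by (simp add: powr_add[symmetric])
      ultimately have "(t - t * s) powr (a - 1) * (t * s) powr (b - 1)
          = t powr (a + b - 2) * (s powr (b - 1) * (1 - s) powr (a - 1))"
        by (simp only: mult_ac flip: \<open>t powr (a - 1) * t powr (b - 1) = t powr (a + b - 2)\<close>)
      then show ?thesis using True t by (simp add: ennreal_mult'[symmetric])
    next
      case False
      then have "\<not> (0 < t * s \<and> t * s < t)" using t by (auto simp: zero_less_mult_iff)
      then show ?thesis using False by auto
    qed
  qed
  also have "\<dots> = ennreal (t powr (a + b - 2)) * ennreal (Beta b a)"
    by (subst nn_integral_cmult) (auto simp: B)
  also have "ennreal t * (ennreal (t powr (a + b - 2)) * ennreal (Beta b a)) = ennreal (t powr (a + b - 1) * Beta a b)"
  proof -
    have "t * t powr (a + b - 2) = t powr (a + b - 1)" using t by (simp add: powr_mult_base)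
    then show ?thesis using t by (simp add: ennreal_mult'[symmetric] Beta_commute mult.assoc[symmetric])
  qed
  finally show ?thesis .
qed

lemma rGamma_nonneg: "0 < b \<Longrightarrow> 0 \<le> (rGamma b :: real)"
  by (simp add: rGamma_inverse_Gamma Gamma_real_nonneg)

text \<open>The semigroup law of fractional integration, from Euler's Beta integral. The form with
  \<open>has_bochner_integral\<close> also records integrability, which the term-by-term integration
  in \<open>ek_volterra\<close> uses.\<close>

lemma conv_gk_has_integral:
  assumes a: "0 < a" and b: "0 < b" and t: "0 < t" "t < T"
  shows "has_bochner_integral lborel (\<lambda>y. gk T a (t - y) * gk T b y) (gk T (a + b) t)"
proof -
  have eq: "gk T a (t - y) * gk T b y
      = of_real (rGamma a * rGamma b * ((t - y) powr (a - 1) * y powr (b - 1) * indicator {0<..<t} y))" for y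
    using t by (auto simp: gk_def)
  have "has_bochner_integral lborel (\<lambda>y. (t - y) powr (a - 1) * y powr (b - 1) * indicator {0<..<t} y) (t powr (a + b - 1) * Beta a b)"
  proof (rule has_bochner_integral_nn_integral)
    show "(\<integral>\<^sup>+y. ennreal ((t - y) powr (a - 1) * y powr (b - 1) * indicator {0<..<t} y) \<partial>lborel) = ennreal (t powr (a + b - 1) * Beta a b)"
      unfolding nn_integral_beta[OF a b t(1), symmetric]
      by (intro nn_integral_cong) (auto simp: indicator_def)
    show "0 \<le> t powr (a + b - 1) * Beta a b"
      using a b by (simp add: Beta_def Gamma_real_nonneg)
  qed auto
  then have "has_bochner_integral lborel (\<lambda>y. gk T a (t - y) * gk T b y)
      (of_real (rGamma a * rGamma b * (t powr (a + b - 1) * Beta a b)))"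
    unfolding eq by (intro has_bochner_integral_of_real has_bochner_integral_mult_right)
  moreover have "rGamma a * rGamma b * (t powr (a + b - 1) * Beta a b) = t powr (a + b - 1) * rGamma (a + b)"
    using Gamma_real_pos[OF a] Gamma_real_pos[OF b]
    by (simp add: Beta_def rGamma_inverse_Gamma field_simps)
  ultimately show ?thesis using t by (simp add: gk_def)
qed

lemma conv_gk: "0 < a \<Longrightarrow> 0 < b \<Longrightarrow> 0 < t \<Longrightarrow> t < T \<Longrightarrow> conv (gk T a) (gk T b) t = gk T (a + b) t"
  unfolding conv_def by (rule has_bochner_integral_integral_eq[OF conv_gk_has_integral])

text \<open>The Neumann series of the resolvent kernel: the k-th term of the Mittag-Leffler series,
  times t^{b-1}, is z^k times the kernel of fractional integration of order \<alpha>k + b.\<close>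

lemma ek_sums:
  assumes "0 < \<alpha>" "0 < b"
  shows "(\<lambda>k. z ^ k * gk T (\<alpha> * real k + b) t) sums ek T \<alpha> b z t"
    and "summable (\<lambda>k. norm (z ^ k * gk T (\<alpha> * real k + b) t))"
proof -
  have eq: "z ^ k * gk T (\<alpha> * real k + b) t
      = (if 0 < t \<and> t < T then of_real (t powr (b - 1)) * ((z * of_real (t powr \<alpha>)) ^ k * of_real (rGamma (\<alpha> * real k + b))) else 0)" for k
  proof (cases "0 < t \<and> t < T")
    case True
    have "t powr (\<alpha> * real k + b - 1) = t powr (b - 1) * (t powr \<alpha>) ^ k"
      using True by (simp add: powr_realpow[symmetric] powr_powr powr_add[symmetric] algebra_simps)
    then show ?thesis using True by (simp add: gk_def power_mult_distrib)
  qed (auto simp: gk_def)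
  have s: "summable (\<lambda>k. norm ((z * of_real (t powr \<alpha>)) ^ k * of_real (rGamma (\<alpha> * real k + b))))"
    using assms by (intro summable_mittag_leffler) auto
  show "(\<lambda>k. z ^ k * gk T (\<alpha> * real k + b) t) sums ek T \<alpha> b z t"
    unfolding eq ek_def mittag_leffler_rGamma using summable_sums[OF summable_norm_cancel[OF s]]
    by (auto intro: sums_mult)
  show "summable (\<lambda>k. norm (z ^ k * gk T (\<alpha> * real k + b) t))"
    unfolding eq using summable_mult[OF s, of "norm (complex_of_real (t powr (b - 1)))"]
    by (cases "0 < t"; cases "t < T") (simp_all add: norm_mult)
qed

text \<open>Convolution with the kernel of order \<alpha> raises every order in the Neumann series
  by \<alpha>, that is, it shifts the index by one; the missing first term is
  \<open>gk T b t\<close>.\<close>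

lemma ek_volterra:
  assumes \<alpha>: "0 < \<alpha>" and b: "0 < b" and t: "0 < t" "t < T"
  shows "ek T \<alpha> b z t = gk T b t + z * conv (gk T \<alpha>) (ek T \<alpha> b z) t"
proof -
  define f where "f k y = z ^ k * (gk T \<alpha> (t - y) * gk T (\<alpha> * real k + b) y)" for k y
  have hb: "has_bochner_integral lborel (\<lambda>y. gk T \<alpha> (t - y) * gk T (\<alpha> * real k + b) y) (gk T (\<alpha> * real (Suc k) + b) t)" for k
    using conv_gk_has_integral[of \<alpha> "\<alpha> * real k + b" t T] \<alpha> b t by (simp add: algebra_simps add_pos_nonneg)
  have fI: "has_bochner_integral lborel (f k) (z ^ k * gk T (\<alpha> * real (Suc k) + b) t)" for k
    unfolding f_def[abs_def] by (intro has_bochner_integral_mult_right hb)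
  \<comment> \<open>The kernels are nonnegative, so their L^1 norms come from the same Beta
    integral. This supplies the summability for integrating the series term by term.\<close>
  have nI: "(LINT y|lborel. norm (f k y)) = norm (z ^ k * gk T (\<alpha> * real (Suc k) + b) t)" for k
  proof -
    have pos: "0 < \<alpha> * real k + b" "0 < \<alpha> * real (Suc k) + b" using \<alpha> b by (auto intro: add_nonneg_pos)
    have "complex_of_real (LINT y|lborel. norm (gk T \<alpha> (t - y) * gk T (\<alpha> * real k + b) y))
       = (LINT y|lborel. of_real (norm (gk T \<alpha> (t - y) * gk T (\<alpha> * real k + b) y)))"
      by (simp add: integral_complex_of_real)
    also have "\<dots> = (LINT y|lborel. gk T \<alpha> (t - y) * gk T (\<alpha> * real k + b) y)"
      using rGamma_nonneg \<alpha> pos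
      by (intro Bochner_Integration.integral_cong) (auto simp: gk_def norm_mult)
    also have "\<dots> = gk T (\<alpha> * real (Suc k) + b) t"
      by (rule has_bochner_integral_integral_eq[OF hb])
    also have "\<dots> = of_real (norm (gk T (\<alpha> * real (Suc k) + b) t))"
      using rGamma_nonneg pos by (auto simp: gk_def norm_mult)
    finally have "(LINT y|lborel. norm (gk T \<alpha> (t - y) * gk T (\<alpha> * real k + b) y)) = norm (gk T (\<alpha> * real (Suc k) + b) t)"
      by (simp only: of_real_eq_iff)
    then show ?thesis by (simp add: f_def norm_mult mult.assoc)
  qed
  have shift: "z ^ Suc k * gk T (\<alpha> * real (Suc k) + b) t = z * (z ^ k * gk T (\<alpha> * real (Suc k) + b) t)" for k
    by (simp add: mult.assoc)
  have "conv (gk T \<alpha>) (ek T \<alpha> b z) t = (LINT y|lborel. (\<Sum>k. f k y))"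
    unfolding conv_def
  proof (rule Bochner_Integration.integral_cong[OF refl])
    fix y
    show "gk T \<alpha> (t - y) * ek T \<alpha> b z y = (\<Sum>k. f k y)"
      using sums_unique[OF sums_mult[OF ek_sums(1)[OF \<alpha> b, of z T y], of "gk T \<alpha> (t - y)"]]
      by (simp add: f_def mult_ac)
  qed
  also have "\<dots> = (\<Sum>k. LINT y|lborel. f k y)"
  proof (rule integral_suminf)
    show "integrable lborel (f k)" for k using fI by (auto simp: has_bochner_integral_iff)
    show "AE y in lborel. summable (\<lambda>k. norm (f k y))"
    proof (rule AE_I2)
      fix y
      show "summable (\<lambda>k. norm (f k y))"
        using summable_mult[OF ek_sums(2)[OF \<alpha> b, of z T y], of "norm (gk T \<alpha> (t - y))"]
        by (simp add: f_def norm_mult mult_ac)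
    qed
    show "summable (\<lambda>k. LINT y|lborel. norm (f k y))"
    proof (cases "z = 0")
      case True
      then have "(LINT y|lborel. norm (f k y)) = 0" if "k \<notin> {0}" for k using that nI by simp
      then show ?thesis by (intro summable_finite[of "{0}"]) auto
    next
      case False
      have "summable (\<lambda>k. norm (z ^ Suc k * gk T (\<alpha> * real (Suc k) + b) t))"
        using ek_sums(2)[OF \<alpha> b, of z T t] by (subst summable_Suc_iff)
      then have "summable (\<lambda>k. norm z * (LINT y|lborel. norm (f k y)))"
        unfolding shift nI by (simp add: norm_mult)
      then show ?thesis using False by (simp add: summable_cmult_iff)
    qed
  qed
  also have "\<dots> = (\<Sum>k. z ^ k * gk T (\<alpha> * real (Suc k) + b) t)"
    using fI by (simp add: has_bochner_integral_iff)
  finally have conv_eq: "conv (gk T \<alpha>) (ek T \<alpha> b z) t = (\<Sum>k. z ^ k * gk T (\<alpha> * real (Suc k) + b) t)" .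
  have "ek T \<alpha> b z t = (\<Sum>k. z ^ k * gk T (\<alpha> * real k + b) t)"
    by (rule sums_unique[OF ek_sums(1)[OF \<alpha> b]])
  also have "\<dots> = gk T b t + (\<Sum>k. z ^ Suc k * gk T (\<alpha> * real (Suc k) + b) t)"
    using suminf_split_head[OF summable_norm_cancel[OF ek_sums(2)[OF \<alpha> b, of z T t]]] by simp
  also have "(\<Sum>k. z ^ Suc k * gk T (\<alpha> * real (Suc k) + b) t) = z * (\<Sum>k. z ^ k * gk T (\<alpha> * real (Suc k) + b) t)"
  proof (cases "z = 0")
    case False
    have "summable (\<lambda>k. z ^ Suc k * gk T (\<alpha> * real (Suc k) + b) t)"
      using summable_norm_cancel[OF ek_sums(2)[OF \<alpha> b, of z T t]] by (subst summable_Suc_iff)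
    then have "summable (\<lambda>k. z ^ k * gk T (\<alpha> * real (Suc k) + b) t)"
      unfolding shift using False by (simp add: summable_cmult_iff)
    then show ?thesis unfolding shift by (rule suminf_mult[symmetric, OF _, symmetric])
  qed simp
  finally show ?thesis by (simp add: conv_eq)
qed

text \<open>Convolving with the complementary kernel \<open>g\<^bsub>1-\<alpha>\<^esub>\<close> turns \<open>J\<^sup>\<alpha>\<close> into the ordinary primitive.\<close>

lemma gk_conv_injective:
  assumes \<alpha>: "0 < \<alpha>" "\<alpha> < 1" and T: "0 < T"
    and h: "integrable lborel h" and supp: "\<And>t. t \<notin> {0<..<T} \<Longrightarrow> h t = 0"
    and z: "AE t in lborel. 0 < t \<and> t < T \<longrightarrow> conv (gk T \<alpha>) h t = 0"
  shows "AE t in lborel. h t = 0"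
proof (rule AE_zero_if_running_integral_zero[OF h supp])
  have [measurable]: "h \<in> borel_measurable borel" using h by auto
  have g: "integrable lborel (gk T \<alpha>)" "integrable lborel (gk T (1 - \<alpha>))"
    using \<alpha> by (auto intro!: gk_integrable)
  have h0: "h t = 0" if "t \<le> 0" for t using supp[of t] that by auto
  have "AE t in lborel. t < T \<longrightarrow> conv (gk T \<alpha>) h t = (\<lambda>_. 0) t"
    using z
  proof eventually_elim
    case (elim t)
    then show ?case using conv_nonpos[of "gk T \<alpha>" h t] h0 by (cases "t \<le> 0") auto
  qed
  then have zero: "conv (gk T (1 - \<alpha>)) (conv (gk T \<alpha>) h) x = 0" if "x \<le> T" for x
    using conv_cong_right[of T "conv (gk T \<alpha>) h" "\<lambda>_. 0" "gk T (1 - \<alpha>)" x] that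
    by (simp add: conv_def)
  have one: "conv (gk T (1 - \<alpha>)) (gk T \<alpha>) t = indicator {0<..} t" if "t < T" for t
  proof (cases "0 < t")
    case True
    then have "conv (gk T (1 - \<alpha>)) (gk T \<alpha>) t = gk T 1 t"
      using conv_gk[of "1 - \<alpha>" \<alpha> t T] \<alpha> that by simp
    then show ?thesis using True that by (simp add: gk_def rGamma_inverse_Gamma)
  next
    case False then show ?thesis by (simp add: conv_nonpos)
  qed
  show "AE x in lborel. x < T \<longrightarrow> (LINT y|lborel. h y * indicator {..<x} y) = 0"
    using conv_assoc[OF g(2) g(1) h]
  proof eventually_elim
    case (elim x)
    show ?case
    proof
      assume x: "x < T"
      have "conv (conv (gk T (1 - \<alpha>)) (gk T \<alpha>)) h x = (LINT y|lborel. h y * indicator {..<x} y)"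
        unfolding conv_def[of "conv (gk T (1 - \<alpha>)) (gk T \<alpha>)"]
      proof (rule Bochner_Integration.integral_cong[OF refl])
        fix y
        show "conv (gk T (1 - \<alpha>)) (gk T \<alpha>) (x - y) * h y = h y * indicator {..<x} y"
          using one[of "x - y"] x h0[of y] by (cases "y \<le> 0") (auto simp: indicator_def)
      qed
      then show "(LINT y|lborel. h y * indicator {..<x} y) = 0" using elim zero[of x] x by simp
    qed
  qed
qed

lemma ek_volterra_le:
  assumes "0 < \<alpha>" "t < T"
  shows "ek T \<alpha> \<alpha> z t = gk T \<alpha> t + z * conv (gk T \<alpha>) (ek T \<alpha> \<alpha> z) t"
  using ek_volterra[of \<alpha> \<alpha> t T z] assms by (cases "0 < t") (auto simp: conv_nonpos)

text \<open>The resolvent equation convolved with \<open>h\<close>. It is limited to x < T because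
  the equation for the cut-off kernels holds only below T.\<close>

lemma conv_ek_eq:
  assumes \<alpha>: "0 < \<alpha>" and h: "integrable lborel h" "\<And>t. t \<le> 0 \<Longrightarrow> h t = 0"
  shows "AE x in lborel. x < T \<longrightarrow>
    conv (ek T \<alpha> \<alpha> z) h x = conv (gk T \<alpha>) h x + z * conv (conv (gk T \<alpha>) (ek T \<alpha> \<alpha> z)) h x"
proof -
  have [measurable]: "h \<in> borel_measurable borel" using h by auto
  let ?g = "gk T \<alpha>" and ?K = "ek T \<alpha> \<alpha> z"
  have g: "integrable lborel ?g" and K: "integrable lborel ?K"
    using \<alpha> by (auto intro!: gk_integrable ek_integrable)
  have gK: "integrable lborel (\<lambda>t. z * conv ?g ?K t)"
    by (intro integrable_mult_right conv_integrable g K)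
  show ?thesis
    using conv_integrable_AE[OF g h(1)] conv_integrable_AE[OF gK h(1)]
  proof eventually_elim
    case (elim x)
    show ?case
    proof
      assume x: "x < T"
      have "conv ?K h x = conv (\<lambda>t. ?g t + z * conv ?g ?K t) h x"
        using x h(2) ek_volterra_le[OF \<alpha>, of _ T z]
        by (intro conv_cong_left[where T=T] AE_I2) auto
      also have "\<dots> = conv ?g h x + conv (\<lambda>t. z * conv ?g ?K t) h x"
        using elim by (intro conv_add_left) auto
      finally show "conv ?K h x = conv ?g h x + z * conv (conv ?g ?K) h x"
        by (simp add: conv_cmult_left)
    qed
  qed
qed

text \<open>Convolving \<open>d = z g\<^sub>\<alpha> * d\<close> with the resolvent kernel gives \<open>g\<^sub>\<alpha> * d = 0\<close>.\<close>

lemma volterra_unique: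
  assumes \<alpha>: "0 < \<alpha>" "\<alpha> < 1" and T: "0 < T"
    and d: "integrable lborel d" and supp: "\<And>t. t \<notin> {0<..<T} \<Longrightarrow> d t = 0"
    and eq: "AE t in lborel. 0 < t \<and> t < T \<longrightarrow> d t = z * conv (gk T \<alpha>) d t"
  shows "AE t in lborel. d t = 0"
proof -
  let ?g = "gk T \<alpha>" and ?K = "ek T \<alpha> \<alpha> z"
  have [measurable]: "d \<in> borel_measurable borel" using d by auto
  have d0: "d t = 0" if "t \<le> 0" for t using supp[of t] that by auto
  have g: "integrable lborel ?g" and K: "integrable lborel ?K"
    using \<alpha> by (auto intro!: gk_integrable ek_integrable)
  have eq': "AE t in lborel. t < T \<longrightarrow> z * conv ?g d t = d t"
    using eq
  proof eventually_elim
    case (elim t)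
    then show ?case using d0[of t] conv_nonpos[of ?g d t] d0 by (cases "0 < t") auto
  qed
  have E: "AE x in lborel. x < T \<longrightarrow> conv ?K d x = conv ?g d x + z * conv (conv ?g ?K) d x"
    by (rule conv_ek_eq) (use \<alpha> d d0 in auto)
  have "AE x in lborel. 0 < x \<and> x < T \<longrightarrow> conv ?g d x = 0"
    using E conv_assoc[OF K g d]
  proof eventually_elim
    case (elim x)
    show ?case
    proof
      assume x: "0 < x \<and> x < T"
      \<comment> \<open>Commutativity, associativity and the equation for \<open>d\<close> turn the
        last term of \<open>E\<close> into its left-hand side, so only the vanishing of
        \<open>conv ?g d x\<close> is left.\<close>
      have "z * conv (conv ?g ?K) d x = z * conv ?K (conv ?g d) x"
        using elim(2) by (simp add: conv_commute[of ?g ?K, abs_def])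
      also have "\<dots> = conv ?K (\<lambda>t. z * conv ?g d t) x" by (simp add: conv_cmult_right)
      also have "\<dots> = conv ?K d x"
        using x by (intro conv_cong_right[OF eq']) auto
      finally show "conv ?g d x = 0" using elim(1) x by simp
    qed
  qed
  then show ?thesis by (intro gk_conv_injective[OF \<alpha> T d supp])
qed

text \<open>The variation-of-constants formula, verified in integrated form: \<open>h\<close> is z u
  + f, cut off, for the candidate u. The constant part uses \<open>ek_volterra\<close> with b = 1,
  where the inhomogeneity is the constant 1 on (0,T); the source part uses
  \<open>conv_ek_eq\<close>.\<close>

lemma volterra_solution:
  assumes \<alpha>: "0 < \<alpha>" and T: "0 < T"
    and f: "integrable lborel f" and f0: "\<And>t. t \<le> 0 \<Longrightarrow> f t = 0"
    and h: "h = (\<lambda>t. if 0 < t \<and> t < T then z * (c * ek T \<alpha> 1 z t + conv (ek T \<alpha> \<alpha> z) f t) + f t else 0)"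
  shows "AE t in lborel. 0 < t \<and> t < T \<longrightarrow>
    c * ek T \<alpha> 1 z t + conv (ek T \<alpha> \<alpha> z) f t - c = conv (gk T \<alpha>) h t"
proof -
  let ?g = "gk T \<alpha>" and ?K = "ek T \<alpha> \<alpha> z" and ?e = "ek T \<alpha> 1 z"
  have [measurable]: "f \<in> borel_measurable borel" using f by auto
  have g: "integrable lborel ?g" and K: "integrable lborel ?K" and e: "integrable lborel ?e"
    using \<alpha> by (auto intro!: gk_integrable ek_integrable)
  let ?a = "\<lambda>t. z * c * ?e t" and ?b = "\<lambda>t. z * conv ?K f t"
  have a: "integrable lborel ?a" and b: "integrable lborel ?b" and bf: "integrable lborel (\<lambda>t. ?b t + f t)"
    using e f K by (auto intro!: conv_integrable)
  have E: "AE x in lborel. x < T \<longrightarrow> conv ?K f x = conv ?g f x + z * conv (conv ?g ?K) f x"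
    by (rule conv_ek_eq) (use \<alpha> f f0 in auto)
  have hm [measurable]: "h \<in> borel_measurable borel" unfolding h by measurable
  show ?thesis
    using E conv_assoc[OF g K f]
      conv_integrable_AE[OF g a] conv_integrable_AE[OF g bf] conv_integrable_AE[OF g b] conv_integrable_AE[OF g f]
  proof eventually_elim
    case (elim x)
    show ?case
    proof
      assume x: "0 < x \<and> x < T"
      have "conv ?g h x = conv ?g (\<lambda>t. ?a t + (?b t + f t)) x"
      proof (rule conv_cong_right[where T=T])
        show "AE t in lborel. t < T \<longrightarrow> h t = ?a t + (?b t + f t)"
        proof (intro AE_I2 impI)
          fix t assume "t < T"
          then show "h t = ?a t + (?b t + f t)"
            using f0[of t] conv_nonpos[of ?K f t] f0 by (cases "0 < t") (auto simp: h algebra_simps)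
        qed
      qed (use x in auto)
      also have "\<dots> = conv ?g ?a x + conv ?g (\<lambda>t. ?b t + f t) x"
        using elim by (intro conv_add_right) auto
      also have "conv ?g (\<lambda>t. ?b t + f t) x = conv ?g ?b x + conv ?g f x"
        using elim by (intro conv_add_right) auto
      also have "conv ?g ?a x = c * (z * conv ?g ?e x)"
        by (simp add: conv_cmult_right mult_ac)
      also have "z * conv ?g ?e x = ?e x - 1"
        using ek_volterra[OF \<alpha>, of 1 x T z] x by (simp add: gk_def rGamma_inverse_Gamma)
      also have "conv ?g ?b x = z * conv (conv ?g ?K) f x"
        using elim(2) by (simp add: conv_cmult_right)
      finally have "conv ?g h x = c * (?e x - 1) + (z * conv (conv ?g ?K) f x + conv ?g f x)" .
      also have "z * conv (conv ?g ?K) f x + conv ?g f x = conv ?K f x"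
        using elim(1) x by simp
      finally show "c * ?e x + conv ?K f x - c = conv ?g h x" by (simp add: algebra_simps)
    qed
  qed
qed

section \<open>Orthonormal bases and diagonal operators\<close>

lemma mult_cnj_norm: "z * cnj z = (complex_of_real (cmod z))\<^sup>2" "cnj z * z = (complex_of_real (cmod z))\<^sup>2"
  using complex_norm_square[of z] by (simp_all add: mult.commute)

lemma cinner_add_right: "cinner x (y + z) = cinner x y + cinner x (z::'a::complex_hilbert)"
  by (metis cinner_add_left cinner_commute complex_cnj_add)

lemma cinner_scaleC_right: "cinner x (a *\<^sub>C y) = cnj a * cinner x (y::'a::complex_hilbert)"
  by (metis cinner_scaleC_left cinner_commute complex_cnj_mult)

lemma cinner_scaleR_left: "cinner (r *\<^sub>R x) y = of_real r * cinner x (y::'a::complex_hilbert)"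
  by (simp add: scaleR_scaleC cinner_scaleC_left)

lemma cinner_scaleR_right: "cinner x (r *\<^sub>R y) = of_real r * cinner x (y::'a::complex_hilbert)"
  by (simp add: scaleR_scaleC cinner_scaleC_right)

lemma cinner_zero_left [simp]: "cinner 0 (y::'a::complex_hilbert) = 0"
  using cinner_scaleR_left[of 0 0 y] by simp

lemma cinner_zero_right [simp]: "cinner (y::'a::complex_hilbert) 0 = 0"
  using cinner_scaleR_right[of y 0 0] by simp

lemma cinner_minus_left: "cinner (- x) y = - cinner x (y::'a::complex_hilbert)"
  using cinner_scaleR_left[of "-1" x y] by simp

lemma cinner_minus_right: "cinner x (- y) = - cinner x (y::'a::complex_hilbert)"
  using cinner_scaleR_right[of x "-1" y] by simp

lemma cinner_diff_left: "cinner (x - y) z = cinner x z - cinner y (z::'a::complex_hilbert)"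
  using cinner_add_left[of x "- y" z] by (simp add: cinner_minus_left)

lemma cinner_sum_left: "cinner (\<Sum>i\<in>I. f i) y = (\<Sum>i\<in>I. cinner (f i) (y::'a::complex_hilbert))"
  by (induction I rule: infinite_finite_induct) (auto simp: cinner_add_left)

lemma cinner_self: "cinner x x = of_real ((norm (x::'a::complex_hilbert))\<^sup>2)"
proof -
  have "Im (cinner x x) = 0" using cinner_commute[of x x] by (simp add: complex_eq_iff)
  moreover have "0 \<le> Re (cinner x x)"
    using norm_ge_zero[of x] unfolding norm_eq_sqrt_cinner by simp
  ultimately show ?thesis by (simp add: complex_eq_iff norm_eq_sqrt_cinner)
qed

lemma norm_scaleC: "norm (c *\<^sub>C x) = cmod c * norm (x::'a::complex_hilbert)"
proof -
  have "complex_of_real ((norm (c *\<^sub>C x))\<^sup>2) = of_real ((cmod c * norm x)\<^sup>2)"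
    unfolding cinner_self[symmetric] cinner_scaleC_left cinner_scaleC_right
    by (simp add: cinner_self power_mult_distrib mult_cnj_norm mult.assoc[symmetric])
  then have "(norm (c *\<^sub>C x))\<^sup>2 = (cmod c * norm x)\<^sup>2" by (simp only: of_real_eq_iff)
  then show ?thesis by (simp add: power2_eq_iff_nonneg)
qed

lemma norm_add_square:
  "(norm (x + y))\<^sup>2 = (norm x)\<^sup>2 + (norm y)\<^sup>2 + 2 * Re (cinner x (y::'a::complex_hilbert))"
proof -
  have "complex_of_real ((norm (x + y))\<^sup>2) = of_real ((norm x)\<^sup>2) + of_real ((norm y)\<^sup>2) + (cinner x y + cinner y x)"
    unfolding cinner_self[symmetric] by (simp add: cinner_add_left cinner_add_right)
  moreover have "Re (cinner x y + cinner y x) = 2 * Re (cinner x y)"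
    using cinner_commute[of y x] by simp
  ultimately show ?thesis by (metis (no_types, lifting) Re_complex_of_real plus_complex.sel(1))
qed

lemma cinner_Cauchy_Schwarz: "cmod (cinner x y) \<le> norm x * norm (y::'a::complex_hilbert)"
proof (cases "y = 0")
  case False
  define c where "c = - cinner x y / of_real ((norm y)\<^sup>2)"
  have "0 \<le> (norm (x + c *\<^sub>C y))\<^sup>2" by simp
  also have "\<dots> = (norm x)\<^sup>2 + (cmod c * norm y)\<^sup>2 + 2 * Re (cnj c * cinner x y)"
    by (simp add: norm_add_square norm_scaleC cinner_scaleC_right)
  also have "cnj c * cinner x y = - of_real ((cmod (cinner x y))\<^sup>2 / (norm y)\<^sup>2)"
    by (simp add: c_def mult_cnj_norm mult.commute)
  also have "(cmod c * norm y)\<^sup>2 = (cmod (cinner x y))\<^sup>2 / (norm y)\<^sup>2"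
  proof -
    have "cmod c = cmod (cinner x y) / (norm y)\<^sup>2" by (simp add: c_def norm_divide norm_power)
    then show ?thesis using False by (simp add: power_mult_distrib power_divide power2_eq_square)
  qed
  finally have "(cmod (cinner x y))\<^sup>2 / (norm y)\<^sup>2 \<le> (norm x)\<^sup>2" by simp
  then have "(cmod (cinner x y))\<^sup>2 \<le> (norm x * norm y)\<^sup>2"
    using False by (simp add: divide_le_eq power_mult_distrib)
  then show ?thesis by (rule power2_le_imp_le) simp
qed simp

lemma bounded_linear_cinner_left: "bounded_linear (\<lambda>x. cinner x (y::'a::complex_hilbert))"
  by (rule bounded_linear_intro[where K="norm y"])
    (auto simp: cinner_add_left cinner_scaleR_left scaleR_conv_of_real cinner_Cauchy_Schwarz)

lemma bounded_linear_scaleC: "bounded_linear (\<lambda>x. c *\<^sub>C (x::'a::complex_hilbert))"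
  by (rule bounded_linear_intro[where K="cmod c"])
    (auto simp: scaleC_add_right scaleR_scaleC scaleC_scaleC norm_scaleC mult.commute)

lemma bounded_linear_scaleC_left: "bounded_linear (\<lambda>c. c *\<^sub>C (x::'a::complex_hilbert))"
  by (rule bounded_linear_intro[where K="norm x"])
    (auto simp: scaleC_add_left scaleR_scaleC scaleC_scaleC norm_scaleC scaleR_conv_of_real)

lemmas scaleC_measurable [measurable] =
  measurable_compose[OF _ borel_measurable_continuous_onI[OF linear_continuous_on[OF bounded_linear_scaleC]]]

lemma borel_measurable_scaleC_left [measurable]:
  assumes "c \<in> borel_measurable M"
  shows "(\<lambda>t. c t *\<^sub>C (x::'a::{complex_hilbert, second_countable_topology})) \<in> borel_measurable M"
  using assms by (rule measurable_compose)
    (rule borel_measurable_continuous_onI[OF linear_continuous_on[OF bounded_linear_scaleC_left]])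

lemma borel_measurable_cinner_left [measurable]:
  assumes "v \<in> borel_measurable M"
  shows "(\<lambda>t. cinner (v t) (x::'a::{complex_hilbert, second_countable_topology})) \<in> borel_measurable M"
  using assms by (rule measurable_compose)
    (rule borel_measurable_continuous_onI[OF linear_continuous_on[OF bounded_linear_cinner_left]])

section \<open>Fourier expansion in an orthonormal basis\<close>

locale onb =
  fixes \<phi> :: "nat \<Rightarrow> 'a::complex_hilbert"
  assumes onb: "orthonormal_basis \<phi>"
begin

abbreviation co :: "nat \<Rightarrow> 'a \<Rightarrow> complex" where
  "co n x \<equiv> cinner x (\<phi> n)"

lemma co_basis: "co n (\<phi> m) = (if m = n then 1 else 0)"
  using onb by (auto simp: orthonormal_basis_def)

lemma co_partial: "co n (\<Sum>k<N. c k *\<^sub>C \<phi> k) = (if n < N then c n else 0)"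
proof -
  have "co n (\<Sum>k<N. c k *\<^sub>C \<phi> k) = (\<Sum>k<N. if k = n then c k else 0)"
    unfolding cinner_sum_left by (intro sum.cong) (auto simp: cinner_scaleC_left co_basis)
  then show ?thesis by simp
qed

lemma cinner_partial: "cinner x (\<Sum>k<N. c k *\<^sub>C \<phi> k) = (\<Sum>k<N. co k x * cnj (c k))"
proof -
  have "cinner x (\<Sum>k<N. c k *\<^sub>C \<phi> k) = cnj (\<Sum>k<N. c k * cinner (\<phi> k) x)"
    using cinner_commute[of x] by (simp add: cinner_sum_left cinner_scaleC_left)
  also have "\<dots> = (\<Sum>k<N. co k x * cnj (c k))"
    by (simp add: mult.commute) (intro sum.cong refl, metis cinner_commute)
  finally show ?thesis .
qed

lemma norm_partial: "(norm (\<Sum>k<N. c k *\<^sub>C \<phi> k))\<^sup>2 = (\<Sum>k<N. (cmod (c k))\<^sup>2)"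
proof -
  have "complex_of_real ((norm (\<Sum>k<N. c k *\<^sub>C \<phi> k))\<^sup>2) = (\<Sum>k<N. c k * cnj (c k))"
    unfolding cinner_self[symmetric] cinner_partial by (intro sum.cong) (auto simp: co_partial)
  also have "\<dots> = of_real (\<Sum>k<N. (cmod (c k))\<^sup>2)" by (simp add: mult_cnj_norm)
  finally show ?thesis by (simp only: of_real_eq_iff)
qed

lemma bessel: "(\<Sum>k<N. (cmod (co k x))\<^sup>2) \<le> (norm x)\<^sup>2"
proof -
  define s where "s = (\<Sum>k<N. co k x *\<^sub>C \<phi> k)"
  have ns: "(norm s)\<^sup>2 = (\<Sum>k<N. (cmod (co k x))\<^sup>2)" unfolding s_def by (rule norm_partial)
  have "cinner x s = of_real (\<Sum>k<N. (cmod (co k x))\<^sup>2)"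
    unfolding s_def cinner_partial by (simp add: mult_cnj_norm)
  then have "Re (cinner x (- s)) = - (norm s)\<^sup>2" by (simp add: cinner_minus_right ns)
  moreover have "0 \<le> (norm (x + (- s)))\<^sup>2" by simp
  ultimately show ?thesis unfolding norm_add_square by (simp add: ns)
qed

text \<open>A finite combination y close to x equals its own partial sums from some index on, and
  Bessel's inequality for x - y bounds the remaining partial sums.\<close>

lemma expansion: "(\<lambda>n. co n x *\<^sub>C \<phi> n) sums x"
  unfolding sums_def
proof (rule LIMSEQ_I)
  fix e :: real assume e: "0 < e"
  have "x \<in> closure {\<Sum>k<n. c k *\<^sub>C \<phi> k | n c. True}" using onb by (auto simp: orthonormal_basis_def)
  then have "\<exists>y\<in>{\<Sum>k<n. c k *\<^sub>C \<phi> k | n c. True}. dist y x < e / 2"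
    using e half_gt_zero unfolding closure_approachable by blast
  then obtain m c where d: "dist (\<Sum>k<m. c k *\<^sub>C \<phi> k) x < e / 2" by blast
  define y where "y = (\<Sum>k<m. c k *\<^sub>C \<phi> k)"
  have "norm ((\<Sum>k<n. co k x *\<^sub>C \<phi> k) - x) < e" if n: "m \<le> n" for n
  proof -
    have y: "(\<Sum>k<n. co k y *\<^sub>C \<phi> k) = y"
    proof -
      have "(\<Sum>k<n. co k y *\<^sub>C \<phi> k) = (\<Sum>k<m. co k y *\<^sub>C \<phi> k)"
        using n scaleC_add_left[of 0 0] unfolding y_def by (intro sum.mono_neutral_right) (auto simp: co_partial)
      also have "\<dots> = y" unfolding y_def by (intro sum.cong) (auto simp: co_partial)
      finally show ?thesis .
    qed
    have lin: "(\<Sum>k<n. co k (x - y) *\<^sub>C \<phi> k) = (\<Sum>k<n. co k x *\<^sub>C \<phi> k) - y"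
      by (subst (2) y[symmetric]) (simp add: cinner_diff_left linear_diff[OF bounded_linear.linear[OF bounded_linear_scaleC_left]] sum_subtractf)
    have "(norm (\<Sum>k<n. co k (x - y) *\<^sub>C \<phi> k))\<^sup>2 \<le> (norm (x - y))\<^sup>2"
      unfolding norm_partial by (rule bessel)
    then have "norm (\<Sum>k<n. co k (x - y) *\<^sub>C \<phi> k) \<le> norm (x - y)" by (rule power2_le_imp_le) simp
    then have "norm ((\<Sum>k<n. co k x *\<^sub>C \<phi> k) - y) \<le> norm (x - y)" unfolding lin .
    moreover have "norm (x - y) < e / 2" using d by (simp add: y_def dist_norm norm_minus_commute)
    moreover have "norm ((\<Sum>k<n. co k x *\<^sub>C \<phi> k) - x) \<le> norm ((\<Sum>k<n. co k x *\<^sub>C \<phi> k) - y) + norm (x - y)"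
      using norm_triangle_ineq4[of "(\<Sum>k<n. co k x *\<^sub>C \<phi> k) - y" "x - y"] by simp
    ultimately show ?thesis by simp
  qed
  then show "\<exists>no. \<forall>n\<ge>no. norm ((\<Sum>k<n. co k x *\<^sub>C \<phi> k) - x) < e" by blast
qed

lemma parseval: "(\<lambda>n. (cmod (co n x))\<^sup>2) sums (norm x)\<^sup>2"
proof -
  have "(\<lambda>n. (norm (\<Sum>k<n. co k x *\<^sub>C \<phi> k))\<^sup>2) \<longlonglongrightarrow> (norm x)\<^sup>2"
    using expansion[of x] unfolding sums_def by (intro tendsto_intros)
  then show ?thesis by (simp add: sums_def norm_partial)
qed

lemma co_sums: "(\<lambda>n. c n *\<^sub>C \<phi> n) sums x \<Longrightarrow> co n x = c n"
proof -
  assume "(\<lambda>n. c n *\<^sub>C \<phi> n) sums x"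
  then have "(\<lambda>m. co n (c m *\<^sub>C \<phi> m)) sums co n x"
    by (rule bounded_linear.sums[OF bounded_linear_cinner_left])
  moreover have "(\<lambda>m. co n (c m *\<^sub>C \<phi> m)) sums c n"
    using sums_finite[of "{n}" "\<lambda>m. co n (c m *\<^sub>C \<phi> m)"] by (simp add: cinner_scaleC_left co_basis)
  ultimately show ?thesis by (rule sums_unique2)
qed

lemma riesz_fischer:
  assumes "summable (\<lambda>n. (cmod (c n))\<^sup>2)"
  shows "summable (\<lambda>n. c n *\<^sub>C \<phi> n)"
proof (rule summable_Cauchy[THEN iffD2], intro allI impI)
  fix e :: real assume e: "0 < e"
  then have "0 < e\<^sup>2" by simp
  then obtain M where M: "\<And>m n. M \<le> m \<Longrightarrow> norm (\<Sum>k\<in>{m..<n}. (cmod (c k))\<^sup>2) < e\<^sup>2"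
    using assms unfolding summable_Cauchy by blast
  have "norm (\<Sum>k\<in>{m..<n}. c k *\<^sub>C \<phi> k) < e" if m: "M \<le> m" for m n
  proof -
    define d where "d k = (if m \<le> k then c k else 0)" for k
    have z: "0 *\<^sub>C (x::'a) = 0" for x using linear_0[OF bounded_linear.linear[OF bounded_linear_scaleC_left]] .
    have "(\<Sum>k<n. d k *\<^sub>C \<phi> k) = (\<Sum>k\<in>{m..<n}. c k *\<^sub>C \<phi> k)"
      by (rule sum.mono_neutral_cong_right) (auto simp: d_def z)
    moreover have "(\<Sum>k<n. (cmod (d k))\<^sup>2) = (\<Sum>k\<in>{m..<n}. (cmod (c k))\<^sup>2)"
      by (rule sum.mono_neutral_cong_right) (auto simp: d_def)
    ultimately have "(norm (\<Sum>k\<in>{m..<n}. c k *\<^sub>C \<phi> k))\<^sup>2 = (\<Sum>k\<in>{m..<n}. (cmod (c k))\<^sup>2)"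
      using norm_partial[of d n] by simp
    also have "\<dots> < e\<^sup>2" using M[OF m, of n] by simp
    finally show ?thesis by (rule power2_less_imp_less) (use e in simp)
  qed
  then show "\<exists>N. \<forall>m\<ge>N. \<forall>n. norm (\<Sum>k\<in>{m..<n}. c k *\<^sub>C \<phi> k) < e" by blast
qed

lemma co_eqI: "(\<And>n. co n x = co n y) \<Longrightarrow> x = y"
  using expansion[of x] expansion[of y] by (simp add: sums_unique2)

lemma cinner_sums: "(\<lambda>n. co n x * cnj (co n y)) sums cinner x y"
proof -
  have "(\<lambda>n. cinner (co n x *\<^sub>C \<phi> n) y) sums cinner x y"
    by (rule bounded_linear.sums[OF bounded_linear_cinner_left expansion])
  moreover have "cinner (co n x *\<^sub>C \<phi> n) y = co n x * cnj (co n y)" for n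
    using cinner_commute[of "\<phi> n" y] by (simp add: cinner_scaleC_left)
  ultimately show ?thesis by simp
qed

end

section \<open>The self-adjoint operator in its eigenbasis\<close>

locale diagonal_operator = onb \<phi> for \<phi> :: "nat \<Rightarrow> 'a::complex_hilbert" +
  fixes D :: "'a set" and A :: "'a \<Rightarrow> 'a" and lam :: "nat \<Rightarrow> real"
  assumes sa: "selfadjoint D A" and basis_dom: "\<And>n. \<phi> n \<in> D"
    and eigen: "\<And>n. A (\<phi> n) = - (lam n *\<^sub>R \<phi> n)"
begin

lemma co_A: "u \<in> D \<Longrightarrow> co n (A u) = - of_real (lam n) * co n u"
proof -
  assume u: "u \<in> D"
  have "(\<phi> n, A (\<phi> n)) \<in> adjoint_graph D A" using sa basis_dom by (auto simp: selfadjoint_def)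
  then have "co n (A u) = cinner u (A (\<phi> n))" using u by (auto simp: adjoint_graph_def)
  then show ?thesis by (simp add: eigen cinner_minus_right cinner_scaleR_right)
qed

lemma norm_A_sums: "u \<in> D \<Longrightarrow> (\<lambda>n. (lam n * cmod (co n u))\<^sup>2) sums (norm (A u))\<^sup>2"
  using parseval[of "A u"] by (simp add: co_A norm_mult power_mult_distrib)

text \<open>The candidate for A u exists by the Riesz--Fischer theorem and is adjoint to u against
  all v in D, by comparing coefficients. Self-adjointness says that the graph of the adjoint is that
  of A, so u lies in D.\<close>

lemma dom_if_summable:
  assumes "summable (\<lambda>n. (lam n * cmod (co n u))\<^sup>2)"
  shows "u \<in> D"
proof -
  define c where "c n = - of_real (lam n) * co n u" for n
  have "summable (\<lambda>n. c n *\<^sub>C \<phi> n)"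
    by (rule riesz_fischer) (use assms in \<open>simp add: c_def norm_mult power_mult_distrib\<close>)
  then have w: "(\<lambda>n. c n *\<^sub>C \<phi> n) sums (\<Sum>n. c n *\<^sub>C \<phi> n)" by (rule summable_sums)
  define w where "w = (\<Sum>n. c n *\<^sub>C \<phi> n)"
  have co_w: "co n w = c n" for n using co_sums[OF w] by (simp add: w_def)
  have "cinner (A v) u = cinner v w" if v: "v \<in> D" for v
  proof -
    have "co n (A v) * cnj (co n u) = co n v * cnj (co n w)" for n
      using v by (simp add: co_A co_w c_def)
    then show ?thesis using cinner_sums[of "A v" u] cinner_sums[of v w] by (simp add: sums_unique2)
  qed
  then have "(u, w) \<in> adjoint_graph D A" by (auto simp: adjoint_graph_def)
  then show ?thesis using sa by (auto simp: selfadjoint_def)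
qed

lemma A_sums:
  assumes "u \<in> D"
  shows "(\<lambda>n. (- of_real (lam n) * co n u) *\<^sub>C \<phi> n) sums A u"
  using expansion[of "A u"] by (simp add: co_A[OF assms])

end

section \<open>Lebesgue spaces and coefficients\<close>

lemma AE_lebesgue_on_Ioo:
  "(AE t in lebesgue_on {a<..<b}. P t) \<longleftrightarrow> (AE t in lborel. a < t \<and> t < b \<longrightarrow> P t)"
  for a b :: real
  by (subst AE_restrict_space_iff) (auto simp: AE_completion_iff)

lemma nn_integral_lebesgue_on:
  fixes S :: "real set"
  assumes "S \<in> sets borel"
  shows "(\<integral>\<^sup>+t. f t \<partial>lebesgue_on S) = (\<integral>\<^sup>+t. f t * indicator S t \<partial>lborel)"
  using assms by (subst nn_integral_restrict_space) (auto simp: nn_integral_completion)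

text \<open>Completeness: preimages differ by a subset of a null set. It is needed for functions
  such as A(u t), which are identified with a measurable series only almost everywhere.\<close>

lemma borel_measurable_lebesgue_on_cong_AE:
  fixes S :: "real set" and h k :: "real \<Rightarrow> 'b::topological_space"
  assumes h: "h \<in> borel_measurable (lebesgue_on S)" and S: "S \<in> sets lebesgue"
    and eq: "AE t in lebesgue_on S. h t = k t"
  shows "k \<in> borel_measurable (lebesgue_on S)"
proof (rule measurableI)
  fix B :: "'b set" assume B: "B \<in> sets borel"
  obtain N where N: "{t \<in> S. h t \<noteq> k t} \<subseteq> N" "N \<in> null_sets (lebesgue_on S)"
    using eq unfolding eventually_ae_filter by (auto simp: space_restrict_space)
  have NL: "N \<in> null_sets lebesgue" using N(2) S by (simp add: null_sets_restrict_space)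
  have "k -` B \<inter> S = ((h -` B \<inter> S) - N) \<union> (k -` B \<inter> S \<inter> N)" using N(1) by auto
  moreover have "h -` B \<inter> S \<in> sets (lebesgue_on S)"
    using measurable_sets[OF h B] by (simp add: space_restrict_space)
  moreover have "k -` B \<inter> S \<inter> N \<in> sets lebesgue"
    using NL by (meson inf_le2 null_setsD2 null_sets_completion_subset)
  moreover have "h -` B \<inter> S \<in> sets lebesgue"
    using \<open>h -` B \<inter> S \<in> sets (lebesgue_on S)\<close> S by (simp add: sets_restrict_space_iff)
  ultimately have "k -` B \<inter> S \<in> sets lebesgue"
    using null_setsD2[OF NL] sets.Un sets.Diff by metis
  then show "k -` B \<inter> space (lebesgue_on S) \<in> sets (lebesgue_on S)"
    using S by (auto simp: space_restrict_space sets_restrict_space_iff)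
qed simp

lemma ex_borel_representative_real:
  fixes h :: "real \<Rightarrow> real"
  assumes "h \<in> borel_measurable (lebesgue_on {a<..<b})"
  obtains h' where "h' \<in> borel_measurable borel" "\<And>t. t \<notin> {a<..<b} \<Longrightarrow> h' t = 0"
    "AE t in lborel. a < t \<and> t < b \<longrightarrow> h' t = h t"
proof -
  have "(\<lambda>t. if t \<in> {a<..<b} then h t else 0) \<in> borel_measurable lebesgue"
    using assms by (subst borel_measurable_if) auto
  from completion_ex_borel_measurable_real[OF this]
  obtain g where g: "g \<in> borel_measurable lborel" "AE t in lborel. (if t \<in> {a<..<b} then h t else 0) = g t"
    by blast
  show ?thesis
  proof (rule that[of "\<lambda>t. if t \<in> {a<..<b} then g t else 0"])
    show "(\<lambda>t. if t \<in> {a<..<b} then g t else 0) \<in> borel_measurable borel" using g(1) by simp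
    show "AE t in lborel. a < t \<and> t < b \<longrightarrow> (if t \<in> {a<..<b} then g t else 0) = h t"
      using g(2) by eventually_elim auto
  qed auto
qed

lemma ex_borel_representative:
  fixes h :: "real \<Rightarrow> complex"
  assumes [measurable]: "h \<in> borel_measurable (lebesgue_on {a<..<b})"
  shows "\<exists>h'. h' \<in> borel_measurable borel \<and> (\<forall>t. t \<notin> {a<..<b} \<longrightarrow> h' t = 0) \<and>
    (AE t in lborel. a < t \<and> t < b \<longrightarrow> h' t = h t)"
proof -
  obtain r where r: "r \<in> borel_measurable borel" "\<And>t. t \<notin> {a<..<b} \<Longrightarrow> r t = 0"
      "AE t in lborel. a < t \<and> t < b \<longrightarrow> r t = Re (h t)"
    using ex_borel_representative_real[of "\<lambda>t. Re (h t)" a b] by auto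
  obtain i where i: "i \<in> borel_measurable borel" "\<And>t. t \<notin> {a<..<b} \<Longrightarrow> i t = 0"
      "AE t in lborel. a < t \<and> t < b \<longrightarrow> i t = Im (h t)"
    using ex_borel_representative_real[of "\<lambda>t. Im (h t)" a b] by auto
  have "AE t in lborel. a < t \<and> t < b \<longrightarrow> Complex (r t) (i t) = h t"
    using r(3) i(3) by eventually_elim (simp add: complex_eq_iff)
  then show ?thesis
    using r(1,2) i(1,2) by (intro exI[of _ "\<lambda>t. Complex (r t) (i t)"]) (auto simp: Complex_eq)
qed

text \<open>The bridge from the integrals over (0,t) in the statement to the convolutions of Borel
  functions on the line.\<close>

lemma LINT_lebesgue_on_borel:
  fixes F G :: "real \<Rightarrow> complex"
  assumes G: "G \<in> borel_measurable borel" "\<And>s. s \<notin> {a<..<b} \<Longrightarrow> G s = 0"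
    and eq: "AE s in lborel. a < s \<and> s < b \<longrightarrow> G s = F s"
  shows "(LINT s|lebesgue_on {a<..<b}. F s) = (LINT s|lborel. G s)"
proof -
  have Gm: "G \<in> borel_measurable (lebesgue_on {a<..<b})"
    using G(1) by (intro measurable_restrict_space1 measurable_completion) simp
  have eq': "AE s in lebesgue_on {a<..<b}. G s = F s" using eq by (simp add: AE_lebesgue_on_Ioo)
  have "F \<in> borel_measurable (lebesgue_on {a<..<b})"
    by (rule borel_measurable_lebesgue_on_cong_AE[OF Gm _ eq']) simp
  then have "(LINT s|lebesgue_on {a<..<b}. F s) = (LINT s|lebesgue_on {a<..<b}. G s)"
    using Gm eq' by (intro integral_cong_AE) auto
  also have "\<dots> = (LINT s|lebesgue. indicator {a<..<b} s *\<^sub>R G s)"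
    by (subst integral_restrict_space) auto
  also have "\<dots> = (LINT s|lebesgue. G s)"
    using G(2) by (intro Bochner_Integration.integral_cong) (auto simp: indicator_def)
  also have "\<dots> = (LINT s|lborel. G s)" using G(1) by (intro integral_completion) simp
  finally show ?thesis .
qed

lemma Lp_norm_powr:
  assumes "0 < p"
  shows "Lp_norm p T v powr p = (LINT t|lebesgue_on {0<..<T}. norm (v t) powr p)"
  unfolding Lp_norm_def using assms by (simp add: powr_powr integral_nonneg_AE)

lemma Lp_norm_nonneg [simp]: "0 \<le> Lp_norm p T v"
  by (simp add: Lp_norm_def)

lemma Lp_set_nn_integral:
  assumes "v \<in> Lp_set p T" "0 < p"
  shows "(\<integral>\<^sup>+t. ennreal (norm (v t) powr p) * indicator {0<..<T} t \<partial>lborel) = ennreal (Lp_norm p T v powr p)"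
proof -
  have "(\<integral>\<^sup>+t. ennreal (norm (v t) powr p) \<partial>lebesgue_on {0<..<T}) = ennreal (LINT t|lebesgue_on {0<..<T}. norm (v t) powr p)"
    using assms by (intro nn_integral_eq_integral) (auto simp: Lp_set_def)
  then show ?thesis using Lp_norm_powr[OF assms(2), of T v] by (simp add: nn_integral_lebesgue_on)
qed

lemma Lp_set_if_nn_integral:
  fixes v :: "real \<Rightarrow> 'a::{complex_hilbert, second_countable_topology}"
  assumes [measurable]: "v \<in> borel_measurable (lebesgue_on {0<..<T})" and p: "0 < p"
    and le: "(\<integral>\<^sup>+t. ennreal (norm (v t) powr p) * indicator {0<..<T} t \<partial>lborel) \<le> ennreal B" and B: "0 \<le> B"
  shows "v \<in> Lp_set p T" "Lp_norm p T v powr p \<le> B"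
proof -
  have le': "(\<integral>\<^sup>+t. ennreal (norm (v t) powr p) \<partial>lebesgue_on {0<..<T}) \<le> ennreal B"
    using le by (simp add: nn_integral_lebesgue_on)
  have "integrable (lebesgue_on {0<..<T}) (\<lambda>t. norm (v t) powr p)"
    using le' by (intro integrableI_nonneg) (auto intro: le_less_trans)
  then show v: "v \<in> Lp_set p T" by (simp add: Lp_set_def)
  show "Lp_norm p T v powr p \<le> B"
    using le B unfolding Lp_set_nn_integral[OF v p] by simp
qed

lemma Lp_norm_cong_AE:
  assumes "AE t in lebesgue_on {0<..<T}. v t = w t"
    and [measurable]: "v \<in> borel_measurable (lebesgue_on {0<..<T})" "w \<in> borel_measurable (lebesgue_on {0<..<T})"
  shows "Lp_norm p T v = Lp_norm p T w"
proof -
  have "(LINT t|lebesgue_on {0<..<T}. norm (v t) powr p) = (LINT t|lebesgue_on {0<..<T}. norm (w t) powr p)"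
    using assms(1) by (intro integral_cong_AE) (auto elim: eventually_mono)
  then show ?thesis by (simp add: Lp_norm_def)
qed

lemma powr_add_le:
  fixes x y p :: real
  assumes "0 \<le> x" "0 \<le> y" "0 < p"
  shows "(x + y) powr p \<le> 2 powr p * (x powr p + y powr p)"
proof -
  have "(x + y) powr p \<le> (2 * max x y) powr p" using assms by (intro powr_mono2) auto
  also have "\<dots> = 2 powr p * max x y powr p" using assms by (simp add: powr_mult)
  also have "max x y powr p \<le> x powr p + y powr p" by (simp add: max_def)
  finally show ?thesis by simp
qed

section \<open>Coefficients of functions in L^p and fractional integration mode by mode\<close>

locale fractional_setting = diagonal_operator \<phi> D A lam
  for \<phi> :: "nat \<Rightarrow> 'a::{complex_hilbert, second_countable_topology}" and D A lam +
  fixes \<alpha> p T :: real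
  assumes \<alpha>: "0 < \<alpha>" "\<alpha> < 1" and p: "1 < p" "1 / p < \<alpha>" and T: "0 < T" and lam: "\<And>n. 0 < lam n"
begin

text \<open>The coefficients of a Lebesgue measurable function are replaced by Borel representatives, since
  Fubini's theorem is only available for the product of Borel measures.\<close>

definition rp :: "(real \<Rightarrow> 'a) \<Rightarrow> nat \<Rightarrow> real \<Rightarrow> complex" where
  "rp v n = (SOME h. h \<in> borel_measurable borel \<and> (\<forall>t. t \<notin> {0<..<T} \<longrightarrow> h t = 0) \<and>
    (AE t in lborel. 0 < t \<and> t < T \<longrightarrow> h t = co n (v t)))"

lemma
  assumes "v \<in> Lp_set p T"
  shows rp_measurable: "rp v n \<in> borel_measurable borel"
    and rp_support: "t \<notin> {0<..<T} \<Longrightarrow> rp v n t = 0"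
    and rp_AE: "AE t in lborel. 0 < t \<and> t < T \<longrightarrow> rp v n t = co n (v t)"
proof -
  have [measurable]: "v \<in> borel_measurable (lebesgue_on {0<..<T})" using assms by (simp add: Lp_set_def)
  have "rp v n \<in> borel_measurable borel \<and> (\<forall>t. t \<notin> {0<..<T} \<longrightarrow> rp v n t = 0) \<and>
    (AE t in lborel. 0 < t \<and> t < T \<longrightarrow> rp v n t = co n (v t))"
    unfolding rp_def by (rule someI_ex[OF ex_borel_representative]) measurable
  then show "rp v n \<in> borel_measurable borel" "t \<notin> {0<..<T} \<Longrightarrow> rp v n t = 0"
    "AE t in lborel. 0 < t \<and> t < T \<longrightarrow> rp v n t = co n (v t)" by auto
qed

lemma rp_nonpos: "v \<in> Lp_set p T \<Longrightarrow> t \<le> 0 \<Longrightarrow> rp v n t = 0"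
  by (rule rp_support) auto

lemma rp_AE_all:
  assumes "v \<in> Lp_set p T"
  shows "AE t in lborel. 0 < t \<and> t < T \<longrightarrow> (\<forall>n. rp v n t = co n (v t))"
proof -
  have "AE t in lborel. \<forall>n. 0 < t \<and> t < T \<longrightarrow> rp v n t = co n (v t)"
    by (subst AE_all_countable) (blast intro: rp_AE[OF assms])
  then show ?thesis by eventually_elim auto
qed

text \<open>Bessel's inequality at almost every time, hence a bound free of N.\<close>

lemma nn_integral_rp_le:
  assumes v: "v \<in> Lp_set p T"
  shows "l2int p T N (\<lambda>n t. cmod (rp v n t))
     \<le> ennreal (Lp_norm p T v powr p)"
proof -
  have "AE t in lborel. ennreal (sqf N (\<lambda>n t. cmod (rp v n t)) t powr (p / 2)) * indicator {0<..<T} t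
      \<le> ennreal (norm (v t) powr p) * indicator {0<..<T} t"
    using rp_AE_all[OF v]
  proof eventually_elim
    case (elim t)
    show ?case
    proof (cases "t \<in> {0<..<T}")
      case True
      have "sqf N (\<lambda>n t. cmod (rp v n t)) t = (\<Sum>n<N. (cmod (co n (v t)))\<^sup>2)"
        using elim True by (simp add: sqf_def)
      also have "\<dots> \<le> (norm (v t))\<^sup>2" by (rule bessel)
      finally have "sqf N (\<lambda>n t. cmod (rp v n t)) t powr (p / 2) \<le> ((norm (v t))\<^sup>2) powr (p / 2)"
        using p by (intro powr_mono2) auto
      also have "\<dots> = norm (v t) powr p"
        by (cases "v t = 0") (simp_all add: powr_powr flip: powr_numeral)
      finally show ?thesis using True by (simp add: ennreal_leI)
    qed simp
  qed
  then have "l2int p T N (\<lambda>n t. cmod (rp v n t))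
     \<le> (\<integral>\<^sup>+t. ennreal (norm (v t) powr p) * indicator {0<..<T} t \<partial>lborel)"
    by (rule nn_integral_mono_AE)
  then show ?thesis using Lp_set_nn_integral[OF v] p by simp
qed

lemma rp_integrable:
  assumes v: "v \<in> Lp_set p T"
  shows "integrable lborel (rp v n)"
proof -
  note [measurable] = rp_measurable[OF v]
  have "(\<integral>\<^sup>+t. ennreal (norm (rp v n t)) \<partial>lborel)
      \<le> (\<integral>\<^sup>+t. indicator {0<..<T} t + ennreal (sqf (Suc n) (\<lambda>n t. cmod (rp v n t)) t powr (p / 2)) * indicator {0<..<T} t \<partial>lborel)"
  proof (rule nn_integral_mono)
    fix t
    show "ennreal (norm (rp v n t)) \<le> indicator {0<..<T} t
        + ennreal (sqf (Suc n) (\<lambda>n t. cmod (rp v n t)) t powr (p / 2)) * indicator {0<..<T} t"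
    proof (cases "t \<in> {0<..<T}")
      case True
      let ?x = "cmod (rp v n t)"
      have x1: "?x \<le> 1 + ?x powr p"
      proof (cases "?x \<le> 1")
        case False
        then have "?x powr 1 \<le> ?x powr p" using p by (intro powr_mono) auto
        then show ?thesis using False by simp
      qed (simp add: add_increasing2)
      have "?x powr p = (?x\<^sup>2) powr (p / 2)"
        by (cases "rp v n t = 0") (simp_all add: powr_powr flip: powr_numeral)
      also have "\<dots> \<le> sqf (Suc n) (\<lambda>n t. cmod (rp v n t)) t powr (p / 2)"
        using p unfolding sqf_def by (intro powr_mono2 member_le_sum) auto
      finally have "ennreal ?x \<le> ennreal (1 + sqf (Suc n) (\<lambda>n t. cmod (rp v n t)) t powr (p / 2))"
        using x1 by (intro ennreal_leI) linarith
      then show ?thesis using True by (simp add: ennreal_plus)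
    next
      case False then show ?thesis using rp_support[OF v] by simp
    qed
  qed
  also have "\<dots> = ennreal T + l2int p T (Suc n) (\<lambda>n t. cmod (rp v n t))"
    using T by (subst nn_integral_add) auto
  also have "\<dots> \<le> ennreal T + ennreal (Lp_norm p T v powr p)"
    by (intro add_left_mono nn_integral_rp_le v)
  also have "\<dots> < \<infinity>" by simp
  finally show ?thesis by (simp add: integrable_iff_bounded)
qed

definition q :: real where "q = p / (p - 1)"

text \<open>The last fact is the condition \<alpha> > 1/p in the form (\<alpha> - 1) q > -1: the
  kernel t^{\<alpha>-1} is locally in L^q.\<close>

lemma q: "1 < q" "1 / q + 1 / p = 1" "0 < (\<alpha> - 1) * q + 1"
proof -
  show "1 < q" "1 / q + 1 / p = 1" using p by (auto simp: q_def field_simps)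
  have "1 < \<alpha> * p" using p by (simp add: divide_less_eq mult.commute)
  then have "0 < (\<alpha> - 1) * p + (p - 1)" by (simp add: algebra_simps)
  then show "0 < (\<alpha> - 1) * q + 1" using p by (simp add: q_def field_simps)
qed

text \<open>The pointwise Young inequality with \<delta> = 1 instead of Hoelder's: an additive bound
  suffices for finiteness at every t and for boundedness uniform in N.\<close>

lemma kernel_young:
  fixes F :: "real \<Rightarrow> real"
  assumes [measurable]: "F \<in> borel_measurable borel" and F: "\<And>s. 0 \<le> F s"
  shows "(\<integral>\<^sup>+s. ennreal ((t - s) powr (\<alpha> - 1) * F s) * indicator {0<..<t} s \<partial>lborel)
     \<le> ennreal (\<bar>t\<bar> powr ((\<alpha> - 1) * q + 1) / ((\<alpha> - 1) * q + 1))
       + (\<integral>\<^sup>+s. ennreal (F s powr p) * indicator {0<..<t} s \<partial>lborel)"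
proof -
  define r where "r = (\<alpha> - 1) * q + 1"
  have r: "0 < r" using q by (simp add: r_def)
  have "(\<integral>\<^sup>+s. ennreal ((t - s) powr (\<alpha> - 1) * F s) * indicator {0<..<t} s \<partial>lborel)
    \<le> (\<integral>\<^sup>+s. ennreal ((t - s) powr (r - 1)) * indicator {0<..<t} (t - s) + ennreal (F s powr p) * indicator {0<..<t} s \<partial>lborel)"
  proof (rule nn_integral_mono)
    fix s
    show "ennreal ((t - s) powr (\<alpha> - 1) * F s) * indicator {0<..<t} s
      \<le> ennreal ((t - s) powr (r - 1)) * indicator {0<..<t} (t - s) + ennreal (F s powr p) * indicator {0<..<t} s"
    proof (cases "s \<in> {0<..<t}")
      case True
      have "(t - s) powr (\<alpha> - 1) * F s \<le> 1 powr (- q) * ((t - s) powr (\<alpha> - 1)) powr q + 1 powr p * F s powr p"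
        using q p F by (intro Youngs_inequality_scaled) auto
      then show ?thesis using True
        by (simp add: powr_powr r_def ennreal_leI ennreal_plus[symmetric] del: ennreal_plus)
    qed simp
  qed
  also have "\<dots> = (\<integral>\<^sup>+s. ennreal ((t - s) powr (r - 1)) * indicator {0<..<t} (t - s) \<partial>lborel)
      + (\<integral>\<^sup>+s. ennreal (F s powr p) * indicator {0<..<t} s \<partial>lborel)"
    by (intro nn_integral_add) measurable
  also have "(\<integral>\<^sup>+s. ennreal ((t - s) powr (r - 1)) * indicator {0<..<t} (t - s) \<partial>lborel)
      = (\<integral>\<^sup>+s. ennreal (s powr (r - 1)) * indicator {0<..<t} s \<partial>lborel)"
    using nn_integral_shift_reflect[of "\<lambda>s. ennreal (s powr (r - 1)) * indicator {0<..<t} s" t] by simp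
  also have "\<dots> \<le> (\<integral>\<^sup>+s. ennreal (s powr (r - 1)) * indicator {0<..<\<bar>t\<bar>} s \<partial>lborel)"
    by (intro nn_integral_mono) (auto simp: indicator_def)
  also have "\<dots> = ennreal (\<bar>t\<bar> powr r / r)"
    using r by (intro nn_integral_powr_from_0) auto
  finally show ?thesis by (simp add: r_def add_right_mono)
qed

end

context fractional_setting
begin

lemma frac_integrable:
  assumes v: "v \<in> Lp_set p T" and t: "t \<le> T"
  shows "integrable (lebesgue_on {0<..<t}) (\<lambda>s. (t - s) powr (\<alpha> - 1) *\<^sub>R v s)"
proof -
  have vm: "v \<in> borel_measurable (lebesgue_on {0<..<T})" using v by (simp add: Lp_set_def)
  then have vt [measurable]: "v \<in> borel_measurable (lebesgue_on {0<..<t})"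
    by (rule measurable_restrict_mono) (use t in auto)
  have [measurable]: "(\<lambda>s. (t - s) powr (\<alpha> - 1)) \<in> borel_measurable (lebesgue_on {0<..<t})"
    by (intro measurable_restrict_space1 measurable_completion) simp
  obtain F0 where F0: "F0 \<in> borel_measurable borel" "\<And>s. s \<notin> {0<..<T} \<Longrightarrow> F0 s = 0"
      "AE s in lborel. 0 < s \<and> s < T \<longrightarrow> F0 s = norm (v s)"
    using ex_borel_representative_real[of "\<lambda>s. norm (v s)" 0 T] vm by auto
  note [measurable] = F0(1)
  have "(\<integral>\<^sup>+s. ennreal (norm ((t - s) powr (\<alpha> - 1) *\<^sub>R v s)) \<partial>lebesgue_on {0<..<t})
      = (\<integral>\<^sup>+s. ennreal ((t - s) powr (\<alpha> - 1) * \<bar>F0 s\<bar>) * indicator {0<..<t} s \<partial>lborel)"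
    unfolding nn_integral_lebesgue_on[OF borel_open[OF open_greaterThanLessThan]]
    using F0(3) t by (intro nn_integral_cong_AE) (auto elim!: eventually_mono simp: indicator_def)
  also have "\<dots> \<le> ennreal (\<bar>t\<bar> powr ((\<alpha> - 1) * q + 1) / ((\<alpha> - 1) * q + 1))
       + (\<integral>\<^sup>+s. ennreal (\<bar>F0 s\<bar> powr p) * indicator {0<..<t} s \<partial>lborel)"
    by (rule kernel_young) auto
  also have "(\<integral>\<^sup>+s. ennreal (\<bar>F0 s\<bar> powr p) * indicator {0<..<t} s \<partial>lborel)
      \<le> (\<integral>\<^sup>+s. ennreal (norm (v s) powr p) * indicator {0<..<T} s \<partial>lborel)"
    using F0(3) t by (intro nn_integral_mono_AE) (auto elim!: eventually_mono simp: indicator_def)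
  also have "\<dots> = ennreal (Lp_norm p T v powr p)" using p by (intro Lp_set_nn_integral v) auto
  finally have "(\<integral>\<^sup>+s. ennreal (norm ((t - s) powr (\<alpha> - 1) *\<^sub>R v s)) \<partial>lebesgue_on {0<..<t}) < \<infinity>"
    by (simp add: add_left_mono le_less_trans)
  then show ?thesis by (intro integrableI_bounded) auto
qed

text \<open>A coefficient is a bounded linear functional and passes through the Bochner integral.
  Integrability of the integrand at every t, from \<alpha> > 1/p, is what permits it.\<close>

lemma co_frac_integral:
  assumes v: "v \<in> Lp_set p T" and t: "0 < t" "t < T"
  shows "co n (frac_integral \<alpha> v t) = conv (gk T \<alpha>) (rp v n) t"
proof -
  note [measurable] = rp_measurable[OF v]
  have "co n (frac_integral \<alpha> v t)
      = of_real (1 / Gamma \<alpha>) * (LINT s|lebesgue_on {0<..<t}. co n ((t - s) powr (\<alpha> - 1) *\<^sub>R v s))"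
  proof -
    have "(LINT s|lebesgue_on {0<..<t}. co n ((t - s) powr (\<alpha> - 1) *\<^sub>R v s))
        = co n (LINT s|lebesgue_on {0<..<t}. (t - s) powr (\<alpha> - 1) *\<^sub>R v s)"
      using t by (intro integral_bounded_linear[OF bounded_linear_cinner_left] frac_integrable[OF v]) simp
    then show ?thesis by (simp only: frac_integral_def cinner_scaleR_left[of "1 / Gamma \<alpha>"])
  qed
  also have "\<dots> = (LINT s|lebesgue_on {0<..<t}. of_real (1 / Gamma \<alpha>) * co n ((t - s) powr (\<alpha> - 1) *\<^sub>R v s))"
    by simp
  also have "\<dots> = (LINT s|lborel. gk T \<alpha> (t - s) * rp v n s)"
  proof (rule LINT_lebesgue_on_borel)
    show "gk T \<alpha> (t - s) * rp v n s = 0" if "s \<notin> {0<..<t}" for s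
      using that rp_nonpos[OF v, of s n] by (cases "s \<le> 0") auto
    show "AE s in lborel. 0 < s \<and> s < t \<longrightarrow> gk T \<alpha> (t - s) * rp v n s
        = of_real (1 / Gamma \<alpha>) * co n ((t - s) powr (\<alpha> - 1) *\<^sub>R v s)"
      using rp_AE[OF v, of n] t
      by (auto elim!: eventually_mono simp: gk_def rGamma_inverse_Gamma cinner_scaleR_left divide_inverse)
  qed measurable
  finally show ?thesis by (simp add: conv_def)
qed

lemma eq_if_rp_eq:
  fixes v w :: "real \<Rightarrow> 'a"
  assumes v: "v \<in> Lp_set p T" and w: "w \<in> Lp_set p T"
    and eq: "\<And>n. AE t in lborel. rp v n t = rp w n t"
  shows "AE t in lebesgue_on {0<..<T}. v t = w t"
proof -
  have "AE t in lborel. \<forall>n. rp v n t = rp w n t" by (subst AE_all_countable) (use eq in blast)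
  then show ?thesis unfolding AE_lebesgue_on_Ioo
    using rp_AE_all[OF v] rp_AE_all[OF w]
    by eventually_elim (auto intro!: co_eqI)
qed

text \<open>Injectivity holds in each mode by \<open>gk_conv_injective\<close>, and countably many
  exceptional null sets are collected at the end.\<close>

lemma frac_integral_injective:
  fixes v w :: "real \<Rightarrow> 'a"
  assumes v: "v \<in> Lp_set p T" and w: "w \<in> Lp_set p T"
    and eq: "AE t in lebesgue_on {0<..<T}. frac_integral \<alpha> v t = frac_integral \<alpha> w t"
  shows "AE t in lebesgue_on {0<..<T}. v t = w t"
proof (rule eq_if_rp_eq[OF v w])
  fix n
  note [measurable] = rp_measurable[OF v] rp_measurable[OF w]
  have g: "integrable lborel (gk T \<alpha>)" using \<alpha> by (intro gk_integrable) auto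
  have rv: "integrable lborel (rp v n)" and rw: "integrable lborel (\<lambda>t. - 1 * rp w n t)"
    using rp_integrable[OF v] rp_integrable[OF w] by auto
  \<comment> \<open>The difference is written as a sum with factor -1, so that
    \<open>conv_add_right\<close> and \<open>conv_cmult_right\<close> apply.\<close>
  have "AE t in lborel. rp v n t + - 1 * rp w n t = 0"
  proof (rule gk_conv_injective[OF \<alpha> T])
    show "integrable lborel (\<lambda>t. rp v n t + - 1 * rp w n t)" using rv rw by simp
    show "rp v n t + - 1 * rp w n t = 0" if "t \<notin> {0<..<T}" for t
      using that by (simp only: rp_support[OF v that] rp_support[OF w that]) simp
    show "AE t in lborel. 0 < t \<and> t < T \<longrightarrow> conv (gk T \<alpha>) (\<lambda>t. rp v n t + - 1 * rp w n t) t = 0"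
      using conv_integrable_AE[OF g rv] conv_integrable_AE[OF g rw] eq[unfolded AE_lebesgue_on_Ioo]
    proof eventually_elim
      case (elim t)
      have "conv (gk T \<alpha>) (\<lambda>t. rp v n t + - 1 * rp w n t) t = conv (gk T \<alpha>) (rp v n) t + - 1 * conv (gk T \<alpha>) (rp w n) t"
        unfolding conv_cmult_right[symmetric] by (rule conv_add_right[OF elim(1,2)])
      then show ?case using elim(3) co_frac_integral[OF v, of t n] co_frac_integral[OF w, of t n] by auto
    qed
  qed
  then show "AE t in lborel. rp v n t = rp w n t" by eventually_elim simp
qed

text \<open>Whatever representative the choice operator picks, injectivity of the fractional
  integral ties it to any known one almost everywhere.\<close>

lemma frac_deriv_eq:
  fixes v g :: "real \<Rightarrow> 'a"
  assumes g: "g \<in> Lp_set p T" and v: "AE t in lebesgue_on {0<..<T}. v t = frac_integral \<alpha> g t"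
  shows "frac_deriv \<alpha> p T v \<in> Lp_set p T"
    and "AE t in lebesgue_on {0<..<T}. v t = frac_integral \<alpha> (frac_deriv \<alpha> p T v) t"
    and "AE t in lebesgue_on {0<..<T}. frac_deriv \<alpha> p T v t = g t"
proof -
  have *: "frac_deriv \<alpha> p T v \<in> Lp_set p T \<and>
      (AE t in lebesgue_on {0<..<T}. v t = frac_integral \<alpha> (frac_deriv \<alpha> p T v) t)"
    unfolding frac_deriv_def
    by (rule someI_ex[of "\<lambda>g. g \<in> Lp_set p T \<and> (AE t in lebesgue_on {0<..<T}. v t = frac_integral \<alpha> g t)"])
      (use g v in blast)
  then show d: "frac_deriv \<alpha> p T v \<in> Lp_set p T"
    and "AE t in lebesgue_on {0<..<T}. v t = frac_integral \<alpha> (frac_deriv \<alpha> p T v) t" by auto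
  have "AE t in lebesgue_on {0<..<T}. frac_integral \<alpha> (frac_deriv \<alpha> p T v) t = frac_integral \<alpha> g t"
    using conjunct2[OF *] v by eventually_elim simp
  then show "AE t in lebesgue_on {0<..<T}. frac_deriv \<alpha> p T v t = g t"
    by (rule frac_integral_injective[OF d g])
qed

section \<open>The solution formula mode by mode, with z n the eigenvalue of \<i>A\<close>

definition z :: "nat \<Rightarrow> complex" where "z n = - \<i> * of_real (lam n)"

abbreviation ker :: "nat \<Rightarrow> real \<Rightarrow> complex" where "ker n \<equiv> ek T \<alpha> \<alpha> (z n)"

abbreviation ker1 :: "nat \<Rightarrow> real \<Rightarrow> complex" where "ker1 n \<equiv> ek T \<alpha> 1 (z n)"

text \<open>A Borel version of \<open>solution_coeff\<close>, built from cut-off kernels and Borel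
  representatives. On (0,T) the two agree at every point, not just almost everywhere.\<close>

definition cf :: "'a \<Rightarrow> (real \<Rightarrow> 'a) \<Rightarrow> nat \<Rightarrow> real \<Rightarrow> complex" where
  "cf u\<^sub>0 f n t = co n u\<^sub>0 * ker1 n t + conv (ker n) (rp f n) t"

lemma cf_measurable [measurable]:
  assumes "f \<in> Lp_set p T" shows "cf u\<^sub>0 f n \<in> borel_measurable borel"
proof -
  note [measurable] = rp_measurable[OF assms]
  show ?thesis unfolding cf_def[abs_def] by measurable
qed

lemma solution_coeff_eq:
  assumes f: "f \<in> Lp_set p T" and t: "0 < t" "t < T"
  shows "solution_coeff \<phi> lam \<alpha> u\<^sub>0 f n t = cf u\<^sub>0 f n t"
proof -
  note [measurable] = rp_measurable[OF f]
  have "mittag_leffler \<alpha> 1 (- \<i> * of_real (lam n * t powr \<alpha>)) = ker1 n t"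
    using t by (simp add: ek_def z_def mult.assoc)
  moreover have "(LINT s|lebesgue_on {0<..<t}. co n (f s) * of_real ((t - s) powr (\<alpha> - 1)) *
        mittag_leffler \<alpha> \<alpha> (- \<i> * of_real (lam n * (t - s) powr \<alpha>)))
      = conv (ker n) (rp f n) t"
    unfolding conv_def
  proof (rule LINT_lebesgue_on_borel)
    show "ker n (t - s) * rp f n s = 0" if "s \<notin> {0<..<t}" for s
      using that rp_nonpos[OF f, of s n] by (cases "s \<le> 0") auto
    show "AE s in lborel. 0 < s \<and> s < t \<longrightarrow> ker n (t - s) * rp f n s
        = co n (f s) * of_real ((t - s) powr (\<alpha> - 1)) * mittag_leffler \<alpha> \<alpha> (- \<i> * of_real (lam n * (t - s) powr \<alpha>))"
      using rp_AE[OF f, of n] t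
      by (auto elim!: eventually_mono simp: ek_def z_def mult_ac)
  qed measurable
  ultimately show ?thesis by (simp add: solution_coeff_def cf_def)
qed

lemma kernel_bound:
  obtains C where "0 \<le> C"
    "\<And>n t. 0 < t \<Longrightarrow> norm (ker n t) \<le> t powr (\<alpha> - 1) * (C / (1 + (lam n * t powr \<alpha>)\<^sup>2))"
proof -
  obtain C where C: "0 \<le> C" "\<And>x. 0 \<le> x \<Longrightarrow> norm (mittag_leffler \<alpha> \<alpha> (- \<i> * of_real x)) \<le> C / (1 + x\<^sup>2)"
    using mittag_leffler_self_decay[OF \<alpha>] by blast
  have "norm (ker n t) \<le> t powr (\<alpha> - 1) * (C / (1 + (lam n * t powr \<alpha>)\<^sup>2))" if "0 < t" for n t
  proof (cases "t < T")
    case True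
    have "0 \<le> lam n * t powr \<alpha>" using lam[of n] by simp
    from mult_left_mono[OF C(2)[OF this], of "t powr (\<alpha> - 1)"]
    show ?thesis using that True by (simp add: ek_def z_def norm_mult mult.assoc)
  next
    case False then show ?thesis using C by (simp add: ek_def)
  qed
  then show ?thesis using that C by blast
qed

lemma E1_bound:
  obtains C where "0 \<le> C" "\<And>n t. 0 < t \<Longrightarrow> norm (ker1 n t) \<le> C / (1 + lam n * t powr \<alpha>)"
proof -
  obtain C where C: "0 \<le> C" "\<And>x. 0 \<le> x \<Longrightarrow> norm (mittag_leffler \<alpha> 1 (- \<i> * of_real x)) \<le> C / (1 + x)"
    using mittag_leffler_1_decay[OF \<alpha>] by blast
  have "norm (ker1 n t) \<le> C / (1 + lam n * t powr \<alpha>)" if "0 < t" for n t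
  proof -
    have x: "0 \<le> lam n * t powr \<alpha>" using lam[of n] by simp
    then show ?thesis using that C(2)[OF x] C(1) by (auto simp: ek_def z_def norm_mult mult.assoc)
  qed
  then show ?thesis using that C by blast
qed

text \<open>Gives convergence of the source part of the series at every single t. The decay in
  \<open>lam n\<close> is dropped: all kernels are below C (t - s)^{\<alpha>-1}, and an integral
  form of Minkowski's inequality is obtained by testing the vector of convolutions against
  itself.\<close>

lemma conv_l2_bounded:
  assumes f: "f \<in> Lp_set p T" and t: "0 < t" "t < T"
  obtains B where "\<And>N. (\<Sum>n<N. (cmod (conv (ker n) (rp f n) t))\<^sup>2) \<le> B"
proof -
  note [measurable] = rp_measurable[OF f]
  obtain C where C: "0 \<le> C"
    "\<And>n t. 0 < t \<Longrightarrow> norm (ker n t) \<le> t powr (\<alpha> - 1) * (C / (1 + (lam n * t powr \<alpha>)\<^sup>2))"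
    using kernel_bound by blast
  have K: "norm (ker n (t - s)) * norm (rp f n s)
      \<le> C * ((t - s) powr (\<alpha> - 1) * norm (rp f n s)) * indicator {0<..<t} s" for n s
  proof (cases "s \<in> {0<..<t}")
    case True
    have "C / (1 + (lam n * (t - s) powr \<alpha>)\<^sup>2) \<le> C / 1"
      using C(1) by (intro divide_left_mono) (auto simp: add_pos_nonneg)
    then have "(t - s) powr (\<alpha> - 1) * (C / (1 + (lam n * (t - s) powr \<alpha>)\<^sup>2)) \<le> (t - s) powr (\<alpha> - 1) * C"
      by (intro mult_left_mono) auto
    then have "norm (ker n (t - s)) \<le> (t - s) powr (\<alpha> - 1) * C"
      using C(2)[of "t - s" n] True by simp
    from mult_right_mono[OF this, of "norm (rp f n s)"] show ?thesis using True by (simp add: mult_ac)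
  next
    case False
    then show ?thesis using rp_nonpos[OF f, of s n] by (cases "s \<le> 0") auto
  qed
  define R where "R = \<bar>t\<bar> powr ((\<alpha> - 1) * q + 1) / ((\<alpha> - 1) * q + 1) + Lp_norm p T f powr p"
  have R: "0 \<le> R" using q by (simp add: R_def)
  define F where "F N s = sqrt (sqf N (\<lambda>n s. cmod (rp f n s)) s)" for N s
  have [measurable]: "F N \<in> borel_measurable borel" for N unfolding F_def by measurable
  have young: "(\<integral>\<^sup>+s. ennreal ((t - s) powr (\<alpha> - 1) * F N s) * indicator {0<..<t} s \<partial>lborel) \<le> ennreal R" for N
  proof -
    have "(\<integral>\<^sup>+s. ennreal ((t - s) powr (\<alpha> - 1) * F N s) * indicator {0<..<t} s \<partial>lborel)
     \<le> ennreal (\<bar>t\<bar> powr ((\<alpha> - 1) * q + 1) / ((\<alpha> - 1) * q + 1))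
       + (\<integral>\<^sup>+s. ennreal (F N s powr p) * indicator {0<..<t} s \<partial>lborel)"
      by (rule kernel_young) (auto simp: F_def)
    also have "(\<integral>\<^sup>+s. ennreal (F N s powr p) * indicator {0<..<t} s \<partial>lborel)
       \<le> (\<integral>\<^sup>+s. ennreal (sqf N (\<lambda>n s. cmod (rp f n s)) s powr (p / 2)) * indicator {0<..<T} s \<partial>lborel)"
      using t by (intro nn_integral_mono) (auto simp: F_def indicator_def powr_half_sqrt[symmetric] powr_powr)
    also have "\<dots> \<le> ennreal (Lp_norm p T f powr p)" by (rule nn_integral_rp_le[OF f])
    finally show ?thesis using q by (simp add: R_def ennreal_plus add_left_mono)
  qed
  have int: "integrable lborel (\<lambda>s. ker n (t - s) * rp f n s)" for n
  proof -
    have "(\<integral>\<^sup>+s. ennreal (norm (ker n (t - s) * rp f n s)) \<partial>lborel)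
       \<le> (\<integral>\<^sup>+s. ennreal C * (ennreal ((t - s) powr (\<alpha> - 1) * F (Suc n) s) * indicator {0<..<t} s) \<partial>lborel)"
    proof (rule nn_integral_mono)
      fix s
      have "cmod (rp f n s) \<le> F (Suc n) s"
        unfolding F_def sqf_def by (rule real_le_rsqrt) (rule member_le_sum, auto)
      then have "C * ((t - s) powr (\<alpha> - 1) * norm (rp f n s)) * indicator {0<..<t} s
          \<le> C * ((t - s) powr (\<alpha> - 1) * F (Suc n) s) * indicator {0<..<t} s"
        using C by (intro mult_right_mono mult_left_mono) auto
      with K[of n s] have "norm (ker n (t - s) * rp f n s)
          \<le> C * ((t - s) powr (\<alpha> - 1) * F (Suc n) s) * indicator {0<..<t} s"
        by (simp add: norm_mult)
      then show "ennreal (norm (ker n (t - s) * rp f n s))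
          \<le> ennreal C * (ennreal ((t - s) powr (\<alpha> - 1) * F (Suc n) s) * indicator {0<..<t} s)"
        using C by (auto simp: indicator_def ennreal_mult'[symmetric] intro: ennreal_leI split: if_splits)
    qed
    also have "\<dots> \<le> ennreal C * ennreal R"
      by (subst nn_integral_cmult) (auto intro!: mult_left_mono young)
    also have "\<dots> < \<infinity>" by (simp add: ennreal_mult_less_top)
    finally show ?thesis by (simp add: integrable_iff_bounded)
  qed
  have "(\<Sum>n<N. (cmod (conv (ker n) (rp f n) t))\<^sup>2) \<le> (C * R)\<^sup>2" for N
  proof -
    \<comment> \<open>With S the squared l^2 norm of y, pairing under the integral and
      Cauchy--Schwarz in l^2 give S \<le> C R sqrt S, hence S \<le> (C R)^2.\<close>
    define y where "y n = conv (ker n) (rp f n) t" for n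
    define S where "S = (\<Sum>n<N. (cmod (y n))\<^sup>2)"
    have S: "0 \<le> S" by (simp add: S_def sum_nonneg)
    have "complex_of_real S = (\<Sum>n<N. cnj (y n) * y n)"
      by (simp add: S_def mult_cnj_norm)
    also have "\<dots> = (\<Sum>n<N. LINT s|lborel. cnj (y n) * (ker n (t - s) * rp f n s))"
      by (simp add: y_def conv_def)
    also have "\<dots> = (LINT s|lborel. (\<Sum>n<N. cnj (y n) * (ker n (t - s) * rp f n s)))"
      using int by (intro Bochner_Integration.integral_sum[symmetric]) auto
    finally have "ennreal S = ennreal (norm (LINT s|lborel. (\<Sum>n<N. cnj (y n) * (ker n (t - s) * rp f n s))))"
      using S by (metis norm_of_real abs_of_nonneg)
    also have "\<dots> \<le> (\<integral>\<^sup>+s. ennreal (norm (\<Sum>n<N. cnj (y n) * (ker n (t - s) * rp f n s))) \<partial>lborel)"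
      using int by (intro integral_norm_bound_ennreal) auto
    also have "\<dots> \<le> (\<integral>\<^sup>+s. ennreal (C * sqrt S) * (ennreal ((t - s) powr (\<alpha> - 1) * F N s) * indicator {0<..<t} s) \<partial>lborel)"
    proof (rule nn_integral_mono)
      fix s
      have "norm (\<Sum>n<N. cnj (y n) * (ker n (t - s) * rp f n s))
          \<le> (\<Sum>n<N. cmod (y n) * (C * ((t - s) powr (\<alpha> - 1) * norm (rp f n s)) * indicator {0<..<t} s))"
        using K by (intro sum_norm_le) (simp add: norm_mult mult_left_mono)
      also have "\<dots> = C * (t - s) powr (\<alpha> - 1) * indicator {0<..<t} s * (\<Sum>n<N. \<bar>cmod (y n)\<bar> * \<bar>cmod (rp f n s)\<bar>)"
        unfolding sum_distrib_left by (intro sum.cong) auto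
      also have "\<dots> \<le> C * (t - s) powr (\<alpha> - 1) * indicator {0<..<t} s * (sqrt S * F N s)"
      proof (intro mult_left_mono)
        show "(\<Sum>n<N. \<bar>cmod (y n)\<bar> * \<bar>cmod (rp f n s)\<bar>) \<le> sqrt S * F N s"
          using L2_set_mult_ineq[of "\<lambda>n. cmod (y n)" "\<lambda>n. cmod (rp f n s)" "{..<N}"]
          by (simp add: L2_set_def S_def F_def sqf_def)
      qed (use C in auto)
      finally have "norm (\<Sum>n<N. cnj (y n) * (ker n (t - s) * rp f n s))
          \<le> C * sqrt S * ((t - s) powr (\<alpha> - 1) * F N s) * indicator {0<..<t} s" by (simp add: mult_ac)
      then show "ennreal (norm (\<Sum>n<N. cnj (y n) * (ker n (t - s) * rp f n s)))
         \<le> ennreal (C * sqrt S) * (ennreal ((t - s) powr (\<alpha> - 1) * F N s) * indicator {0<..<t} s)"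
        using C S by (auto simp: indicator_def ennreal_mult'[symmetric] intro: ennreal_leI split: if_splits)
    qed
    also have "\<dots> \<le> ennreal (C * sqrt S) * ennreal R"
      by (subst nn_integral_cmult) (auto intro!: mult_left_mono young)
    also have "\<dots> = ennreal (C * sqrt S * R)" using C S by (simp add: ennreal_mult')
    finally have "S \<le> C * R * sqrt S" using C S R by (simp add: mult_ac)
    then have "sqrt S * sqrt S \<le> C * R * sqrt S" using S by simp
    then have "sqrt S \<le> C * R"
    proof (cases "S = 0")
      case False
      then have "0 < sqrt S" using S by simp
      with \<open>sqrt S * sqrt S \<le> C * R * sqrt S\<close> show ?thesis by (rule mult_right_le_imp_le)
    qed (use C R in simp)
    then have "S \<le> (C * R)\<^sup>2" using S by (simp add: sqrt_le_D)
    then show ?thesis by (simp add: S_def y_def)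
  qed
  then show ?thesis using that by blast
qed

lemma cf_l2_summable:
  assumes f: "f \<in> Lp_set p T" and t: "0 < t" "t < T"
  shows "summable (\<lambda>n. (cmod (cf u\<^sub>0 f n t))\<^sup>2)"
proof -
  obtain B where B: "\<And>N. (\<Sum>n<N. (cmod (conv (ker n) (rp f n) t))\<^sup>2) \<le> B"
    using conv_l2_bounded[OF f t] by blast
  obtain C where C: "0 \<le> C" "\<And>n t. 0 < t \<Longrightarrow> norm (ker1 n t) \<le> C / (1 + lam n * t powr \<alpha>)"
    using E1_bound by blast
  have s1: "summable (\<lambda>n. (cmod (conv (ker n) (rp f n) t))\<^sup>2)"
  proof (rule bounded_imp_summable[where B=B])
    show "(\<Sum>k\<le>n. (cmod (conv (ker k) (rp f k) t))\<^sup>2) \<le> B" for n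
      using B[of "Suc n"] by (simp only: lessThan_Suc_atMost)
  qed simp
  have s2: "summable (\<lambda>n. C\<^sup>2 * (cmod (co n u\<^sub>0))\<^sup>2)"
    by (intro summable_mult sums_summable[OF parseval])
  show ?thesis
  proof (rule summable_comparison_test'[OF summable_add[OF summable_mult[OF s2, of 2] summable_mult[OF s1, of 2]]])
    fix n :: nat
    let ?a = "co n u\<^sub>0 * ker1 n t" and ?b = "conv (ker n) (rp f n) t"
    have "C / (1 + lam n * t powr \<alpha>) \<le> C / 1"
      using C lam[of n] by (intro divide_left_mono) (auto simp: add_pos_nonneg less_imp_le)
    then have "norm (ker1 n t) \<le> C" using C(2)[OF t(1), of n] by simp
    then have "cmod ?a \<le> C * cmod (co n u\<^sub>0)"
      unfolding norm_mult mult.commute[of C] by (rule mult_left_mono) simp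
    then have a2: "(cmod ?a)\<^sup>2 \<le> C\<^sup>2 * (cmod (co n u\<^sub>0))\<^sup>2"
      unfolding power_mult_distrib[symmetric] by (rule power_mono) simp
    have "(cmod (cf u\<^sub>0 f n t))\<^sup>2 \<le> (cmod ?a + cmod ?b)\<^sup>2"
      unfolding cf_def by (intro power_mono norm_triangle_ineq) auto
    also have "\<dots> \<le> 2 * (cmod ?a)\<^sup>2 + 2 * (cmod ?b)\<^sup>2"
      using sum_squares_bound[of "cmod ?a" "cmod ?b"] by (simp add: power2_sum)
    finally show "norm ((cmod (cf u\<^sub>0 f n t))\<^sup>2) \<le> 2 * (C\<^sup>2 * (cmod (co n u\<^sub>0))\<^sup>2) + 2 * (cmod ?b)\<^sup>2"
      using a2 by simp
  qed
qed

lemma solution_series_sums: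
  assumes f: "f \<in> Lp_set p T" and t: "0 < t" "t < T"
  shows "(\<lambda>n. solution_coeff \<phi> lam \<alpha> u\<^sub>0 f n t *\<^sub>C \<phi> n) sums solution_series \<phi> lam \<alpha> u\<^sub>0 f t"
  unfolding solution_series_def
  using riesz_fischer[OF cf_l2_summable[OF f t, of u\<^sub>0]] solution_coeff_eq[OF f t]
  by (simp add: summable_sums)

lemma co_solution:
  assumes f: "f \<in> Lp_set p T" and t: "0 < t" "t < T"
  shows "co n (solution_series \<phi> lam \<alpha> u\<^sub>0 f t) = cf u\<^sub>0 f n t"
  using co_sums[OF solution_series_sums[OF f t]] solution_coeff_eq[OF f t] by simp

lemma cf_volterra:
  assumes f: "f \<in> Lp_set p T"
  shows "AE t in lborel. 0 < t \<and> t < T \<longrightarrow> cf u\<^sub>0 f n t - co n u\<^sub>0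
    = conv (gk T \<alpha>) (\<lambda>t. if 0 < t \<and> t < T then z n * cf u\<^sub>0 f n t + rp f n t else 0) t"
  unfolding cf_def
  by (rule volterra_solution[OF \<alpha>(1) T rp_integrable[OF f] rp_nonpos[OF f] refl])

end

section \<open>Estimates of the two parts of the solution\<close>

lemma K_functional_bdd_below:
  assumes "\<And>b. b \<in> Y \<Longrightarrow> 0 \<le> N b" "0 \<le> t"
  shows "bdd_below {norm a + t * N b | a b. b \<in> Y \<and> x = a + b}"
  using assms by (intro bdd_belowI[where m=0]) auto

lemma K_functional_nonneg:
  assumes "\<And>b. b \<in> Y \<Longrightarrow> 0 \<le> N b" "0 \<le> t" "0 \<in> Y"
  shows "0 \<le> K_functional Y N t x"
  unfolding K_functional_def
proof (rule cInf_greatest)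
  show "{norm a + t * N b | a b. b \<in> Y \<and> x = a + b} \<noteq> {}"
    using assms(3) by (metis (mono_tags, lifting) add.right_neutral empty_iff mem_Collect_eq)
qed (use assms in auto)

text \<open>Monotonicity in the parameter supplies the Borel measurability of the
  K-functional.\<close>

lemma K_functional_mono:
  assumes N: "\<And>b. b \<in> Y \<Longrightarrow> 0 \<le> N b" and st: "0 \<le> s" "s \<le> t" and Y: "0 \<in> Y"
  shows "K_functional Y N s x \<le> K_functional Y N t x"
  unfolding K_functional_def[of Y N t]
proof (rule cInf_greatest)
  show "{norm a + t * N b | a b. b \<in> Y \<and> x = a + b} \<noteq> {}"
    using Y by (metis (mono_tags, lifting) add.right_neutral empty_iff mem_Collect_eq)
  fix y assume "y \<in> {norm a + t * N b | a b. b \<in> Y \<and> x = a + b}"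
  then obtain a b where ab: "y = norm a + t * N b" "b \<in> Y" "x = a + b" by auto
  have "K_functional Y N s x \<le> norm a + s * N b"
    unfolding K_functional_def
    by (rule cInf_lower) (use ab in blast, rule K_functional_bdd_below, use N st in auto)
  also have "\<dots> \<le> y" using ab N st by (auto intro: mult_right_mono)
  finally show "K_functional Y N s x \<le> y" .
qed

text \<open>The change of variables is made on the compact intervals [1/(m+1), m+1], where
  t^\<alpha> has no singularity, and Fatou's lemma extends it. Replacing the range of \<tau> by the
  half-line is why only an inequality is claimed.\<close>

lemma nn_integral_powr_substitution:
  fixes h :: "real \<Rightarrow> real" and \<alpha> :: real
  assumes [measurable]: "h \<in> borel_measurable borel" and \<alpha>: "0 < \<alpha>"
  shows "(\<integral>\<^sup>+t. ennreal (h (t powr \<alpha>)) * indicator {0<..<T} t \<partial>lborel)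
     \<le> ennreal (1 / \<alpha>) * (\<integral>\<^sup>+\<tau>. ennreal (h \<tau> * \<tau> powr (1 / \<alpha> - 1)) * indicator {0<..} \<tau> \<partial>lborel)"
    (is "?L \<le> ?R")
proof -
  define f where "f m t = ennreal (h (t powr \<alpha>)) * indicator {1 / real (Suc m)..real (Suc m)} t" for m t
  have fm: "(\<integral>\<^sup>+t. f m t \<partial>lborel) \<le> ?R" for m
  proof -
    define a b where "a = (1 / real (Suc m)) powr \<alpha>" and "b = real (Suc m) powr \<alpha>"
    have ab: "0 < a" "a \<le> b" unfolding a_def b_def using \<alpha> by (auto intro!: powr_mono2 simp: field_simps)
    have g: "a powr (1 / \<alpha>) = 1 / real (Suc m)" "b powr (1 / \<alpha>) = real (Suc m)"
      using \<alpha> by (auto simp: a_def b_def powr_powr)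
    have "(\<integral>\<^sup>+t. f m t \<partial>lborel) = (\<integral>\<^sup>+t. ennreal (h (t powr \<alpha>) * indicator {a powr (1 / \<alpha>)..b powr (1 / \<alpha>)} t) \<partial>lborel)"
      unfolding g f_def by (intro nn_integral_cong) (auto simp: indicator_def)
    also have "\<dots> = (\<integral>\<^sup>+\<tau>. ennreal (h ((\<tau> powr (1 / \<alpha>)) powr \<alpha>) * (1 / \<alpha> * \<tau> powr (1 / \<alpha> - 1)) * indicator {a..b} \<tau>) \<partial>lborel)"
    proof (rule nn_integral_substitution)
      show "set_borel_measurable borel {a powr (1 / \<alpha>)..b powr (1 / \<alpha>)} (\<lambda>t. h (t powr \<alpha>))"
        unfolding set_borel_measurable_def by measurable
      show "((\<lambda>\<tau>. \<tau> powr (1 / \<alpha>)) has_real_derivative 1 / \<alpha> * \<tau> powr (1 / \<alpha> - 1)) (at \<tau>)"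
        if "\<tau> \<in> {a..b}" for \<tau>
        using that ab by (intro has_real_derivative_powr) auto
      show "continuous_on {a..b} (\<lambda>\<tau>. 1 / \<alpha> * \<tau> powr (1 / \<alpha> - 1))"
        using ab by (intro continuous_intros) auto
    qed (use ab \<alpha> in auto)
    also have "\<dots> \<le> (\<integral>\<^sup>+\<tau>. ennreal (1 / \<alpha>) * (ennreal (h \<tau> * \<tau> powr (1 / \<alpha> - 1)) * indicator {0<..} \<tau>) \<partial>lborel)"
    proof (rule nn_integral_mono)
      fix \<tau>
      show "ennreal (h ((\<tau> powr (1 / \<alpha>)) powr \<alpha>) * (1 / \<alpha> * \<tau> powr (1 / \<alpha> - 1)) * indicator {a..b} \<tau>)
        \<le> ennreal (1 / \<alpha>) * (ennreal (h \<tau> * \<tau> powr (1 / \<alpha> - 1)) * indicator {0<..} \<tau>)"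
        using ab \<alpha> by (auto simp: indicator_def powr_powr ennreal_mult'[symmetric] mult_ac)
    qed
    also have "\<dots> = ?R" by (intro nn_integral_cmult) measurable
    finally show ?thesis .
  qed
  have "?L \<le> (\<integral>\<^sup>+t. liminf (\<lambda>m. f m t) \<partial>lborel)"
  proof (rule nn_integral_mono)
    fix t
    show "ennreal (h (t powr \<alpha>)) * indicator {0<..<T} t \<le> liminf (\<lambda>m. f m t)"
    proof (cases "t \<in> {0<..<T}")
      case True
      then have t: "0 < t" by simp
      have "(\<lambda>m. 1 / real (Suc m)) \<longlonglongrightarrow> 0" by real_asymp
      then have "\<forall>\<^sub>F m in sequentially. 1 / real (Suc m) < t" using t by (intro order_tendstoD) auto
      moreover have "\<forall>\<^sub>F m in sequentially. t \<le> real (Suc m)" using t by real_asymp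
      ultimately have "\<forall>\<^sub>F m in sequentially. f m t = ennreal (h (t powr \<alpha>))"
        by eventually_elim (auto simp: f_def)
      then have "(\<lambda>m. f m t) \<longlonglongrightarrow> ennreal (h (t powr \<alpha>))" by (rule tendsto_eventually)
      then have "liminf (\<lambda>m. f m t) = ennreal (h (t powr \<alpha>))" by (intro lim_imp_Liminf) auto
      then show ?thesis using True by simp
    qed simp
  qed
  also have "\<dots> \<le> liminf (\<lambda>m. \<integral>\<^sup>+t. f m t \<partial>lborel)"
    by (rule nn_integral_liminf) (simp add: f_def[abs_def])
  also have "\<dots> \<le> liminf (\<lambda>m::nat. ?R)"
    by (intro Liminf_mono always_eventually allI fm)
  also have "\<dots> = ?R" by (simp add: Liminf_const)
  finally show ?thesis .
qed

context fractional_setting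
begin

text \<open>The multiplier \<open>lam n\<close> \<tau> / (1 + \<open>lam n\<close> \<tau>) is at
  most 1 and at most \<open>lam n\<close> \<tau>. For a splitting x = a + b the first bound is used
  on a and the second on b, which yields the two terms of the K-functional.\<close>

lemma K_lower_bound:
  assumes \<tau>: "0 < \<tau>"
  shows "\<tau> * L2_set (\<lambda>n. lam n * cmod (co n x) / (1 + lam n * \<tau>)) {..<N} \<le> K_functional D (\<lambda>u. norm (A u)) \<tau> x"
  unfolding K_functional_def
proof (rule cInf_greatest)
  have D0: "0 \<in> D" using sa by (auto simp: selfadjoint_def linear_operator_on_def)
  then show "{norm a + \<tau> * norm (A b) | a b. b \<in> D \<and> x = a + b} \<noteq> {}"
    by (metis (mono_tags, lifting) add.right_neutral empty_iff mem_Collect_eq)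
  fix y assume "y \<in> {norm a + \<tau> * norm (A b) | a b. b \<in> D \<and> x = a + b}"
  then obtain a b where ab: "y = norm a + \<tau> * norm (A b)" "b \<in> D" "x = a + b" by auto
  have den: "0 < 1 + lam n * \<tau>" for n using lam[of n] \<tau> by (simp add: add_pos_pos)
  have "\<tau> * L2_set (\<lambda>n. lam n * cmod (co n x) / (1 + lam n * \<tau>)) {..<N}
      = L2_set (\<lambda>n. \<tau> * (lam n * cmod (co n x) / (1 + lam n * \<tau>))) {..<N}"
    using \<tau> by (simp add: L2_set_right_distrib)
  also have "\<dots> \<le> L2_set (\<lambda>n. cmod (co n a) + \<tau> * (lam n * cmod (co n b))) {..<N}"
  proof (rule L2_set_mono)
    fix n
    have l: "0 < lam n" by (rule lam)
    have "lam n * \<tau> / (1 + lam n * \<tau>) \<le> 1" using den[of n] by simp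
    then have 1: "lam n * \<tau> / (1 + lam n * \<tau>) * cmod (co n a) \<le> 1 * cmod (co n a)"
      by (rule mult_right_mono) simp
    have "lam n * \<tau> / (1 + lam n * \<tau>) \<le> lam n * \<tau> / 1"
      using l \<tau> den[of n] by (intro divide_left_mono) auto
    then have 2: "lam n * \<tau> / (1 + lam n * \<tau>) * cmod (co n b) \<le> lam n * \<tau> / 1 * cmod (co n b)"
      by (rule mult_right_mono) simp
    have "\<tau> * (lam n * cmod (co n x) / (1 + lam n * \<tau>)) = lam n * \<tau> / (1 + lam n * \<tau>) * cmod (co n a + co n b)"
      by (simp add: ab cinner_add_left)
    also have "\<dots> \<le> lam n * \<tau> / (1 + lam n * \<tau>) * (cmod (co n a) + cmod (co n b))"
      using l \<tau> den[of n] by (intro mult_left_mono norm_triangle_ineq) auto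
    also have "\<dots> \<le> cmod (co n a) + \<tau> * (lam n * cmod (co n b))"
      unfolding distrib_left using add_mono[OF 1 2] by (simp only: mult_1 div_by_1 mult_ac)
    finally show "\<tau> * (lam n * cmod (co n x) / (1 + lam n * \<tau>)) \<le> cmod (co n a) + \<tau> * (lam n * cmod (co n b))" .
    show "0 \<le> \<tau> * (lam n * cmod (co n x) / (1 + lam n * \<tau>))" using l \<tau> den[of n] by simp
  qed
  also have "\<dots> \<le> L2_set (\<lambda>n. cmod (co n a)) {..<N} + L2_set (\<lambda>n. \<tau> * (lam n * cmod (co n b))) {..<N}"
    by (rule L2_set_triangle_ineq)
  also have "L2_set (\<lambda>n. cmod (co n a)) {..<N} \<le> norm a"
    unfolding L2_set_def by (rule real_le_lsqrt) (use bessel[of a N] in auto)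
  also have "L2_set (\<lambda>n. \<tau> * (lam n * cmod (co n b))) {..<N} = \<tau> * L2_set (\<lambda>n. cmod (co n (A b))) {..<N}"
    using \<tau> lam by (simp add: L2_set_right_distrib co_A[OF ab(2)] norm_mult less_imp_le)
  also have "L2_set (\<lambda>n. cmod (co n (A b))) {..<N} \<le> norm (A b)"
    unfolding L2_set_def by (rule real_le_lsqrt) (use bessel[of "A b" N] in auto)
  finally show "\<tau> * L2_set (\<lambda>n. lam n * cmod (co n x) / (1 + lam n * \<tau>)) {..<N} \<le> y"
    using ab \<tau> by (simp add: mult_left_mono)
qed

abbreviation Kf :: "real \<Rightarrow> 'a \<Rightarrow> real" where
  "Kf \<tau> x \<equiv> K_functional D (\<lambda>u. norm (A u)) \<tau> x"

lemma initial_estimate: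
  obtains C where "0 \<le> C" "\<And>x N. x \<in> X_set D A \<alpha> p \<Longrightarrow>
     l2int p T N (\<lambda>n t. lam n * cmod (co n x * ker1 n t))
       \<le> ennreal (C * X_norm D A \<alpha> p x powr p)"
proof -
  obtain C where C: "0 \<le> C" "\<And>n t. 0 < t \<Longrightarrow> norm (ker1 n t) \<le> C / (1 + lam n * t powr \<alpha>)"
    using E1_bound by blast
  define \<theta> where "\<theta> = 1 - 1 / (\<alpha> * p)"
  have D0: "0 \<in> D" using sa by (auto simp: selfadjoint_def linear_operator_on_def)
  have "l2int p T N (\<lambda>n t. lam n * cmod (co n x * ker1 n t))
       \<le> ennreal (C powr p / \<alpha> * X_norm D A \<alpha> p x powr p)"
    if x: "x \<in> X_set D A \<alpha> p" for x N
  proof -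
    \<comment> \<open>Set to 0 on the nonpositive axis, so that it is monotone on the whole line and
      thus Borel.\<close>
    define k where "k \<tau> = (if 0 < \<tau> then Kf \<tau> x else 0)" for \<tau>
    have kpos: "0 \<le> Kf \<tau> x" if "0 \<le> \<tau>" for \<tau> using that D0 by (intro K_functional_nonneg) auto
    have "mono k"
      by (rule monoI) (auto simp: k_def kpos intro!: K_functional_mono D0)
    then have [measurable]: "k \<in> borel_measurable borel" by (rule borel_measurable_mono)
    define h where "h \<tau> = (C * (k \<tau> / \<tau>)) powr p" for \<tau>
    have [measurable]: "h \<in> borel_measurable borel" unfolding h_def by measurable
    have point: "sqf N (\<lambda>n t. lam n * cmod (co n x * ker1 n t)) t powr (p / 2) \<le> h (t powr \<alpha>)"
      if t: "0 < t" for t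
    proof -
      let ?\<tau> = "t powr \<alpha>"
      have \<tau>: "0 < ?\<tau>" using t by simp
      let ?L = "L2_set (\<lambda>n. lam n * cmod (co n x) / (1 + lam n * ?\<tau>)) {..<N}"
      have "sqf N (\<lambda>n t. lam n * cmod (co n x * ker1 n t)) t
          \<le> (\<Sum>n<N. (C * (lam n * cmod (co n x) / (1 + lam n * ?\<tau>)))\<^sup>2)"
        unfolding sqf_def
      proof (intro sum_mono power_mono)
        fix n
        have "lam n * cmod (co n x * ker1 n t) \<le> lam n * (cmod (co n x) * (C / (1 + lam n * ?\<tau>)))"
          unfolding norm_mult using C(2)[OF t, of n] lam[of n] by (intro mult_left_mono) auto
        then show "lam n * cmod (co n x * ker1 n t) \<le> C * (lam n * cmod (co n x) / (1 + lam n * ?\<tau>))"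
          by (simp add: mult_ac)
        show "0 \<le> lam n * cmod (co n x * ker1 n t)" using lam[of n] by simp
      qed
      also have "\<dots> = (C * ?L)\<^sup>2"
        unfolding power_mult_distrib[of C] sum_distrib_left[symmetric]
        by (simp add: L2_set_def sum_nonneg)
      finally have "sqf N (\<lambda>n t. lam n * cmod (co n x * ker1 n t)) t powr (p / 2) \<le> ((C * ?L)\<^sup>2) powr (p / 2)"
        using p by (intro powr_mono2) auto
      also have "\<dots> = (C * ?L) powr p"
        using C by (cases "C * ?L = 0") (simp_all add: powr_powr L2_set_nonneg flip: powr_numeral)
      also have "\<dots> \<le> (C * (Kf ?\<tau> x / ?\<tau>)) powr p"
        using K_lower_bound[OF \<tau>, of x N] C p \<tau>
        by (intro powr_mono2 mult_left_mono) (auto simp: L2_set_nonneg field_simps)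
      finally show ?thesis using \<tau> by (simp add: h_def k_def)
    qed
    have I: "integrable (lebesgue_on {0<..}) (\<lambda>\<tau>. (\<tau> powr (- \<theta>) * Kf \<tau> x) powr p / \<tau>)"
      using x by (simp add: X_set_def interp_set_def \<theta>_def)
    have Xp: "X_norm D A \<alpha> p x powr p = (LINT \<tau>|lebesgue_on {0<..}. (\<tau> powr (- \<theta>) * Kf \<tau> x) powr p / \<tau>)"
    proof -
      have "0 \<le> (LINT \<tau>|lebesgue_on {0<..}. (\<tau> powr (- \<theta>) * Kf \<tau> x) powr p / \<tau>)"
        by (intro Bochner_Integration.integral_nonneg) (auto simp: space_restrict_space)
      then show ?thesis using p by (simp add: X_norm_def interp_norm_def \<theta>_def powr_powr)
    qed
    have XI: "(\<integral>\<^sup>+\<tau>. ennreal ((\<tau> powr (- \<theta>) * Kf \<tau> x) powr p / \<tau>) * indicator {0<..} \<tau> \<partial>lborel) = ennreal (X_norm D A \<alpha> p x powr p)"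
    proof -
      have "(\<integral>\<^sup>+\<tau>. ennreal ((\<tau> powr (- \<theta>) * Kf \<tau> x) powr p / \<tau>) \<partial>lebesgue_on {0<..}) = ennreal (X_norm D A \<alpha> p x powr p)"
        unfolding Xp by (intro nn_integral_eq_integral I AE_I2) (auto simp: space_restrict_space)
      then show ?thesis by (simp add: nn_integral_lebesgue_on)
    qed
    have "l2int p T N (\<lambda>n t. lam n * cmod (co n x * ker1 n t))
        \<le> (\<integral>\<^sup>+t. ennreal (h (t powr \<alpha>)) * indicator {0<..<T} t \<partial>lborel)"
      using point by (intro nn_integral_mono) (auto simp: indicator_def intro: ennreal_leI)
    also have "\<dots> \<le> ennreal (1 / \<alpha>) * (\<integral>\<^sup>+\<tau>. ennreal (h \<tau> * \<tau> powr (1 / \<alpha> - 1)) * indicator {0<..} \<tau> \<partial>lborel)"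
      using \<alpha> by (intro nn_integral_powr_substitution) auto
    also have "(\<integral>\<^sup>+\<tau>. ennreal (h \<tau> * \<tau> powr (1 / \<alpha> - 1)) * indicator {0<..} \<tau> \<partial>lborel)
      = (\<integral>\<^sup>+\<tau>. ennreal (C powr p) * (ennreal ((\<tau> powr (- \<theta>) * Kf \<tau> x) powr p / \<tau>) * indicator {0<..} \<tau>) \<partial>lborel)"
    proof (rule nn_integral_cong)
      fix \<tau> :: real
      show "ennreal (h \<tau> * \<tau> powr (1 / \<alpha> - 1)) * indicator {0<..} \<tau>
         = ennreal (C powr p) * (ennreal ((\<tau> powr (- \<theta>) * Kf \<tau> x) powr p / \<tau>) * indicator {0<..} \<tau>)"
      proof (cases "0 < \<tau>")
        case True
        \<comment> \<open>The factor \<tau>^{-p} from the pointwise bound and the Jacobian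
          \<tau>^{1/\<alpha>-1} combine into the weight of the interpolation norm exactly for
          \<theta> = 1 - 1/(\<alpha>p).\<close>
        have e: "- p + (1 / \<alpha> - 1) = - \<theta> * p - 1" using p \<alpha> by (simp add: \<theta>_def field_simps)
        have "(1 / \<tau>) powr p * \<tau> powr (1 / \<alpha> - 1) = \<tau> powr (- p + (1 / \<alpha> - 1))"
          unfolding powr_add powr_divide powr_minus_divide by simp
        also have "\<dots> = (\<tau> powr (- \<theta>)) powr p / \<tau>"
          unfolding e using True by (simp add: powr_powr powr_diff)
        finally have e2: "(1 / \<tau>) powr p * \<tau> powr (1 / \<alpha> - 1) = (\<tau> powr (- \<theta>)) powr p / \<tau>" .
        have "h \<tau> = C powr p * Kf \<tau> x powr p * (1 / \<tau>) powr p"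
          using True C kpos[of \<tau>] unfolding h_def k_def by (simp add: powr_mult powr_divide)
        then have "h \<tau> * \<tau> powr (1 / \<alpha> - 1) = C powr p * Kf \<tau> x powr p * ((1 / \<tau>) powr p * \<tau> powr (1 / \<alpha> - 1))"
          by (simp only: mult.assoc)
        also have "\<dots> = C powr p * ((\<tau> powr (- \<theta>) * Kf \<tau> x) powr p / \<tau>)"
          unfolding e2 using True kpos[of \<tau>] by (simp add: powr_mult)
        finally show ?thesis using True by (simp add: ennreal_mult'[symmetric])
      qed simp
    qed
    also have "\<dots> = ennreal (C powr p) * ennreal (X_norm D A \<alpha> p x powr p)"
    proof -
      have "(\<integral>\<^sup>+\<tau>. ennreal (C powr p) * (ennreal ((\<tau> powr (- \<theta>) * Kf \<tau> x) powr p / \<tau>) * indicator {0<..} \<tau>) \<partial>lborel)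
          = (\<integral>\<^sup>+\<tau>. ennreal (C powr p) * (ennreal ((\<tau> powr (- \<theta>) * k \<tau>) powr p / \<tau>) * indicator {0<..} \<tau>) \<partial>lborel)"
        by (intro nn_integral_cong) (auto simp: indicator_def k_def)
      also have "\<dots> = ennreal (C powr p) * (\<integral>\<^sup>+\<tau>. ennreal ((\<tau> powr (- \<theta>) * k \<tau>) powr p / \<tau>) * indicator {0<..} \<tau> \<partial>lborel)"
        by (intro nn_integral_cmult) measurable
      also have "(\<integral>\<^sup>+\<tau>. ennreal ((\<tau> powr (- \<theta>) * k \<tau>) powr p / \<tau>) * indicator {0<..} \<tau> \<partial>lborel)
          = (\<integral>\<^sup>+\<tau>. ennreal ((\<tau> powr (- \<theta>) * Kf \<tau> x) powr p / \<tau>) * indicator {0<..} \<tau> \<partial>lborel)"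
        by (intro nn_integral_cong) (auto simp: indicator_def k_def)
      finally show ?thesis by (simp only: XI)
    qed
    also have "ennreal (1 / \<alpha>) * (ennreal (C powr p) * ennreal (X_norm D A \<alpha> p x powr p))
        = ennreal (C powr p / \<alpha> * X_norm D A \<alpha> p x powr p)"
      using \<alpha> by (simp add: ennreal_mult'[symmetric])
    finally show ?thesis .
  qed
  then show ?thesis using \<alpha> by (intro that[of "C powr p / \<alpha>"]) auto
qed

text \<open>With x = \<open>lam n\<close> t^\<alpha> the decay of E_{\<alpha>,\<alpha>} gives
  \<open>lam n * norm (ker n t)\<close> \<le> C min(x, 1/x)/t, which is below 8 C times the even
  kernel \<open>ml_kernel\<close>. At nonpositive times \<open>ker n\<close> vanishes, so the causal
  kernel is dominated everywhere, and \<open>convf_Lp\<close> treats all modes at once with M =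
  4/\<alpha>.\<close>

lemma source_estimate:
  obtains C where "0 \<le> C" "\<And>f N. f \<in> Lp_set p T \<Longrightarrow>
     l2int p T N (\<lambda>n t. lam n * cmod (conv (ker n) (rp f n) t))
       \<le> ennreal (C * Lp_norm p T f powr p)"
proof -
  obtain C where C: "0 \<le> C"
    "\<And>n t. 0 < t \<Longrightarrow> norm (ker n t) \<le> t powr (\<alpha> - 1) * (C / (1 + (lam n * t powr \<alpha>)\<^sup>2))"
    using kernel_bound by blast
  define \<kappa> where "\<kappa> n = ml_kernel \<alpha> (lam n)" for n
  have \<kappa>: "maximal_kernel (4 / \<alpha>) (\<kappa> n)" for n
    unfolding \<kappa>_def using \<alpha> lam by (intro maximal_kernel_ml_kernel) auto
  note \<kappa>m [measurable] = maximal_kernel_measurable[OF \<kappa>]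
  have dom: "ennreal (lam n * norm (ker n t)) \<le> ennreal (8 * C) * \<kappa> n t" for n t
  proof (cases "0 < t")
    case True
    let ?x = "lam n * t powr \<alpha>"
    have x: "0 < ?x" using lam[of n] True by simp
    have ta: "t powr (\<alpha> - 1) = t powr \<alpha> / t" using True by (simp add: powr_diff)
    have m: "?x / (1 + ?x\<^sup>2) \<le> min ?x (1 / ?x)"
    proof -
      have "?x / (1 + ?x\<^sup>2) \<le> ?x / 1" using x by (intro divide_left_mono) (auto simp: add_pos_nonneg)
      moreover have "?x * ?x \<le> 1 + ?x\<^sup>2" by (simp add: power2_eq_square)
      then have "?x / (1 + ?x\<^sup>2) \<le> 1 / ?x"
        using x by (simp add: divide_le_eq le_divide_eq pos_divide_le_eq add_pos_nonneg)
      ultimately show ?thesis by simp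
    qed
    have "lam n * norm (ker n t) \<le> lam n * (t powr (\<alpha> - 1) * (C / (1 + ?x\<^sup>2)))"
      using lam[of n] C(2)[OF True, of n] by (intro mult_left_mono) auto
    also have "\<dots> = C * (?x / (1 + ?x\<^sup>2) / t)" by (simp add: ta mult_ac)
    also have "\<dots> \<le> C * (min ?x (1 / ?x) / t)"
      using C True m by (intro mult_left_mono divide_right_mono) auto
    finally have "ennreal (lam n * norm (ker n t)) \<le> ennreal C * ennreal (min ?x (1 / ?x) / t)"
      using C by (simp add: ennreal_leI ennreal_mult'[symmetric])
    also have "\<dots> \<le> ennreal C * (8 * \<kappa> n t)"
      unfolding \<kappa>_def using True lam \<alpha> by (intro mult_left_mono ml_kernel_ge) auto
    also have "\<dots> = ennreal (8 * C) * \<kappa> n t" using C by (simp add: ennreal_mult' mult_ac)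
    finally show ?thesis .
  qed simp
  have M0: "0 \<le> 4 / \<alpha>" using \<alpha> by simp
  obtain C3 where C3: "0 \<le> C3" and vv:
    "\<And>\<kappa> F N T. (\<And>n. maximal_kernel (4 / \<alpha>) (\<kappa> n)) \<Longrightarrow> (\<And>n. F n \<in> borel_measurable borel) \<Longrightarrow>
       (\<And>n x. 0 \<le> F n x) \<Longrightarrow> (\<And>n x. x \<notin> {0<..<T} \<Longrightarrow> F n x = 0) \<Longrightarrow>
       (\<And>n. AE x in lborel. convp (\<kappa> n) (\<lambda>y. ennreal (F n y)) x < \<infinity>) \<Longrightarrow>
       l2int p T N (convf \<kappa> F)
         \<le> ennreal C3 * l2int p T N F"
    by (rule convf_Lp[OF p(1) M0]) (rule that, assumption, blast)
  have "l2int p T N (\<lambda>n t. lam n * cmod (conv (ker n) (rp f n) t))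
       \<le> ennreal ((8 * C) powr p * C3 * Lp_norm p T f powr p)"
    if f: "f \<in> Lp_set p T" for f N
  proof -
    note [measurable] = rp_measurable[OF f]
    define F where "F n t = cmod (rp f n t)" for n t
    have [measurable]: "F n \<in> borel_measurable borel" for n unfolding F_def by measurable
    have fin: "AE x in lborel. convp (\<kappa> n) (\<lambda>y. ennreal (F n y)) x < \<infinity>" for n
    proof -
      have "(\<integral>\<^sup>+x. convp (\<kappa> n) (\<lambda>y. ennreal (F n y)) x \<partial>lborel)
          = (\<integral>\<^sup>+x. \<kappa> n x \<partial>lborel) * (\<integral>\<^sup>+x. ennreal (F n x) \<partial>lborel)"
        by (intro nn_integral_convp) auto
      moreover have "(\<integral>\<^sup>+x. \<kappa> n x \<partial>lborel) < \<infinity>"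
        using maximal_kernel_mass[OF \<kappa>, of n] by (auto intro: le_less_trans)
      moreover have "(\<integral>\<^sup>+x. ennreal (F n x) \<partial>lborel) < \<infinity>"
        using rp_integrable[OF f, of n] by (simp add: F_def integrable_iff_bounded)
      ultimately have "(\<integral>\<^sup>+x. convp (\<kappa> n) (\<lambda>y. ennreal (F n y)) x \<partial>lborel) \<noteq> \<infinity>"
        by (auto simp: ennreal_mult_eq_top_iff)
      then have "AE x in lborel. convp (\<kappa> n) (\<lambda>y. ennreal (F n y)) x \<noteq> \<infinity>"
        by (intro nn_integral_noteq_infinite) auto
      then show ?thesis by eventually_elim (simp add: less_top)
    qed
    have [measurable]: "convf \<kappa> F n \<in> borel_measurable borel" for n
      by (rule borel_measurable_convf[OF \<kappa>]) measurable
    have pt: "lam n * cmod (conv (ker n) (rp f n) t) \<le> 8 * C * convf \<kappa> F n t"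
      if t: "convp (\<kappa> n) (\<lambda>y. ennreal (F n y)) t < \<infinity>" for n t
    proof -
      have "ennreal (lam n * cmod (conv (ker n) (rp f n) t))
          \<le> ennreal (lam n) * convp (enorm (ker n)) (enorm (rp f n)) t"
        using lam[of n] by (simp add: ennreal_mult' mult_left_mono norm_conv_le)
      also have "\<dots> = (\<integral>\<^sup>+s. ennreal (lam n) * (enorm (ker n) (t - s) * enorm (rp f n) s) \<partial>lborel)"
        unfolding convp_def by (intro nn_integral_cmult[symmetric]) measurable
      also have "\<dots> \<le> (\<integral>\<^sup>+s. ennreal (8 * C) * (\<kappa> n (t - s) * ennreal (F n s)) \<partial>lborel)"
      proof (rule nn_integral_mono)
        fix s
        show "ennreal (lam n) * (enorm (ker n) (t - s) * enorm (rp f n) s)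
          \<le> ennreal (8 * C) * (\<kappa> n (t - s) * ennreal (F n s))"
          using mult_right_mono[OF dom[of n "t - s"], of "ennreal (F n s)"] lam[of n]
          by (simp add: F_def ennreal_mult' mult.assoc)
      qed
      also have "\<dots> = ennreal (8 * C) * convp (\<kappa> n) (\<lambda>y. ennreal (F n y)) t"
        unfolding convp_def by (intro nn_integral_cmult) measurable
      also have "\<dots> = ennreal (8 * C) * ennreal (convf \<kappa> F n t)"
        using t by (simp add: convf_def less_top)
      also have "\<dots> = ennreal (8 * C * convf \<kappa> F n t)"
        using C by (simp add: ennreal_mult' convf_def)
      finally show ?thesis using C by (subst (asm) ennreal_le_iff) (auto simp: convf_def)
    qed
    have "AE t in lborel. \<forall>n. convp (\<kappa> n) (\<lambda>y. ennreal (F n y)) t < \<infinity>"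
      by (subst AE_all_countable) (use fin in blast)
    then have "AE t in lborel. ennreal (sqf N (\<lambda>n t. lam n * cmod (conv (ker n) (rp f n) t)) t powr (p / 2)) * indicator {0<..<T} t
        \<le> ennreal ((8 * C) powr p) * (ennreal (sqf N (convf \<kappa> F) t powr (p / 2)) * indicator {0<..<T} t)"
    proof eventually_elim
      case (elim t)
      have "sqf N (\<lambda>n t. lam n * cmod (conv (ker n) (rp f n) t)) t \<le> (\<Sum>n<N. (8 * C * convf \<kappa> F n t)\<^sup>2)"
        unfolding sqf_def using pt elim lam by (intro sum_mono power_mono) (auto simp: less_imp_le)
      also have "\<dots> = (8 * C)\<^sup>2 * sqf N (convf \<kappa> F) t"
        by (simp only: sqf_def power_mult_distrib sum_distrib_left)
      finally have "sqf N (\<lambda>n t. lam n * cmod (conv (ker n) (rp f n) t)) t powr (p / 2)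
          \<le> ((8 * C)\<^sup>2 * sqf N (convf \<kappa> F) t) powr (p / 2)" using p by (intro powr_mono2) auto
      also have "\<dots> = ((8 * C)\<^sup>2) powr (p / 2) * sqf N (convf \<kappa> F) t powr (p / 2)"
        by (rule powr_mult)
      also have "((8 * C)\<^sup>2) powr (p / 2) = (8 * C) powr p"
      proof (cases "C = 0")
        case False
        then have "(8 * C)\<^sup>2 = (8 * C) powr 2" using C by (simp add: powr_numeral)
        then show ?thesis by (simp add: powr_powr)
      qed simp
      finally show ?case by (auto simp: indicator_def ennreal_mult'[symmetric] intro: ennreal_leI)
    qed
    then have "l2int p T N (\<lambda>n t. lam n * cmod (conv (ker n) (rp f n) t))
       \<le> (\<integral>\<^sup>+t. ennreal ((8 * C) powr p) * (ennreal (sqf N (convf \<kappa> F) t powr (p / 2)) * indicator {0<..<T} t) \<partial>lborel)"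
      by (rule nn_integral_mono_AE)
    also have "\<dots> = ennreal ((8 * C) powr p) * l2int p T N (convf \<kappa> F)"
      by (intro nn_integral_cmult) measurable
    also have "\<dots> \<le> ennreal ((8 * C) powr p) * (ennreal C3 * l2int p T N F)"
      using \<kappa> fin rp_support[OF f] by (intro mult_left_mono vv) (auto simp: F_def)
    also have "\<dots> \<le> ennreal ((8 * C) powr p) * (ennreal C3 * ennreal (Lp_norm p T f powr p))"
      unfolding F_def by (intro mult_left_mono nn_integral_rp_le f) auto
    also have "\<dots> = ennreal ((8 * C) powr p * C3 * Lp_norm p T f powr p)"
      using C3 by (simp add: ennreal_mult' mult.assoc)
    finally show ?thesis .
  qed
  then show ?thesis using C3 by (intro that[of "(8 * C) powr p * C3"]) auto
qed

end

section \<open>Maximal regularity\<close>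

lemma powr_le_root:
  fixes a x y k p :: real
  assumes "0 \<le> a" "0 \<le> x" "0 \<le> y" "0 \<le> k" "0 < p" and le: "a powr p \<le> k * (x powr p + y powr p)"
  shows "a \<le> (2 * k) powr (1 / p) * (x + y)"
proof (rule ccontr)
  assume "\<not> ?thesis"
  then have "((2 * k) powr (1 / p) * (x + y)) powr p < a powr p"
    using assms by (intro powr_less_mono2) auto
  also have "((2 * k) powr (1 / p) * (x + y)) powr p = 2 * k * (x + y) powr p"
    using assms by (simp add: powr_mult powr_powr)
  finally have "k * ((x + y) powr p + (x + y) powr p) < a powr p" by simp
  moreover have "k * (x powr p + y powr p) \<le> k * ((x + y) powr p + (x + y) powr p)"
    using assms by (intro mult_left_mono add_mono powr_mono2) auto
  ultimately show False using le by linarith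
qed

context fractional_setting
begin

lemma combined_estimate:
  obtains C where "0 \<le> C" "\<And>u\<^sub>0 f N. u\<^sub>0 \<in> X_set D A \<alpha> p \<Longrightarrow> f \<in> Lp_set p T \<Longrightarrow>
     l2int p T N (\<lambda>n t. lam n * cmod (cf u\<^sub>0 f n t))
       \<le> ennreal (C * (X_norm D A \<alpha> p u\<^sub>0 powr p + Lp_norm p T f powr p))"
proof -
  obtain C1 where C1: "0 \<le> C1" "\<And>x N. x \<in> X_set D A \<alpha> p \<Longrightarrow>
     l2int p T N (\<lambda>n t. lam n * cmod (co n x * ker1 n t))
       \<le> ennreal (C1 * X_norm D A \<alpha> p x powr p)"
    using initial_estimate by blast
  obtain C2 where C2: "0 \<le> C2" "\<And>f N. f \<in> Lp_set p T \<Longrightarrow>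
     l2int p T N (\<lambda>n t. lam n * cmod (conv (ker n) (rp f n) t))
       \<le> ennreal (C2 * Lp_norm p T f powr p)"
    using source_estimate by blast
  \<comment> \<open>One factor stems from (a + b)^2 \<le> 2(a^2 + b^2) in each mode, the other from
    \<open>powr_add_le\<close> with exponent p/2.\<close>
  define k where "k = 2 powr (p / 2) * 2 powr (p / 2)"
  have k: "0 \<le> k" by (simp add: k_def)
  have "l2int p T N (\<lambda>n t. lam n * cmod (cf u\<^sub>0 f n t))
       \<le> ennreal (k * (C1 + C2) * (X_norm D A \<alpha> p u\<^sub>0 powr p + Lp_norm p T f powr p))"
    if u: "u\<^sub>0 \<in> X_set D A \<alpha> p" and f: "f \<in> Lp_set p T" for u\<^sub>0 f N
  proof -
    note [measurable] = rp_measurable[OF f]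
    define Fa Fb where "Fa n t = lam n * cmod (co n u\<^sub>0 * ker1 n t)"
      and "Fb n t = lam n * cmod (conv (ker n) (rp f n) t)" for n t
    have [measurable]: "Fa n \<in> borel_measurable borel" "Fb n \<in> borel_measurable borel" for n
      unfolding Fa_def Fb_def by measurable
    have pt: "sqf N (\<lambda>n t. lam n * cmod (cf u\<^sub>0 f n t)) t powr (p / 2)
        \<le> k * (sqf N Fa t powr (p / 2) + sqf N Fb t powr (p / 2))" for t
    proof -
      have "sqf N (\<lambda>n t. lam n * cmod (cf u\<^sub>0 f n t)) t \<le> (\<Sum>n<N. 2 * ((Fa n t)\<^sup>2 + (Fb n t)\<^sup>2))"
        unfolding sqf_def
      proof (rule sum_mono)
        fix n
        have "lam n * cmod (cf u\<^sub>0 f n t) \<le> Fa n t + Fb n t"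
          unfolding Fa_def Fb_def distrib_left[symmetric] cf_def
          using lam[of n] by (intro mult_left_mono norm_triangle_ineq) auto
        then have "(lam n * cmod (cf u\<^sub>0 f n t))\<^sup>2 \<le> (Fa n t + Fb n t)\<^sup>2"
          using lam[of n] by (intro power_mono) auto
        also have "\<dots> \<le> 2 * ((Fa n t)\<^sup>2 + (Fb n t)\<^sup>2)"
          using sum_squares_bound[of "Fa n t" "Fb n t"] by (simp add: power2_sum)
        finally show "(lam n * cmod (cf u\<^sub>0 f n t))\<^sup>2 \<le> 2 * ((Fa n t)\<^sup>2 + (Fb n t)\<^sup>2)" .
      qed
      also have "\<dots> = 2 * (sqf N Fa t + sqf N Fb t)"
        by (simp add: sqf_def sum.distrib sum_distrib_left)
      finally have "sqf N (\<lambda>n t. lam n * cmod (cf u\<^sub>0 f n t)) t powr (p / 2) \<le> (2 * (sqf N Fa t + sqf N Fb t)) powr (p / 2)"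
        using p by (intro powr_mono2) auto
      also have "\<dots> = 2 powr (p / 2) * (sqf N Fa t + sqf N Fb t) powr (p / 2)" by (rule powr_mult)
      also have "\<dots> \<le> 2 powr (p / 2) * (2 powr (p / 2) * (sqf N Fa t powr (p / 2) + sqf N Fb t powr (p / 2)))"
        using p by (intro mult_left_mono powr_add_le) auto
      finally show ?thesis by (simp add: k_def mult.assoc)
    qed
    have "l2int p T N (\<lambda>n t. lam n * cmod (cf u\<^sub>0 f n t))
      \<le> (\<integral>\<^sup>+t. ennreal k * (ennreal (sqf N Fa t powr (p / 2)) * indicator {0<..<T} t
           + ennreal (sqf N Fb t powr (p / 2)) * indicator {0<..<T} t) \<partial>lborel)"
    proof (rule nn_integral_mono)
      fix t
      have "ennreal (sqf N (\<lambda>n t. lam n * cmod (cf u\<^sub>0 f n t)) t powr (p / 2))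
          \<le> ennreal k * (ennreal (sqf N Fa t powr (p / 2)) + ennreal (sqf N Fb t powr (p / 2)))"
        using pt[of t] k by (simp add: ennreal_leI ennreal_mult'[symmetric] ennreal_plus[symmetric] del: ennreal_plus)
      then show "ennreal (sqf N (\<lambda>n t. lam n * cmod (cf u\<^sub>0 f n t)) t powr (p / 2)) * indicator {0<..<T} t
         \<le> ennreal k * (ennreal (sqf N Fa t powr (p / 2)) * indicator {0<..<T} t
           + ennreal (sqf N Fb t powr (p / 2)) * indicator {0<..<T} t)"
        by (cases "t \<in> {0<..<T}") auto
    qed
    also have "\<dots> = ennreal k * (l2int p T N Fa
           + l2int p T N Fb)"
      by (subst nn_integral_cmult) (auto simp: nn_integral_add)
    also have "\<dots> \<le> ennreal k * (ennreal (C1 * X_norm D A \<alpha> p u\<^sub>0 powr p) + ennreal (C2 * Lp_norm p T f powr p))"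
      unfolding Fa_def Fb_def by (intro mult_left_mono add_mono C1(2)[OF u] C2(2)[OF f]) auto
    also have "\<dots> = ennreal (k * (C1 * X_norm D A \<alpha> p u\<^sub>0 powr p + C2 * Lp_norm p T f powr p))"
      using k C1(1) C2(1) by (simp add: ennreal_mult' ennreal_plus)
    also have "\<dots> \<le> ennreal (k * (C1 + C2) * (X_norm D A \<alpha> p u\<^sub>0 powr p + Lp_norm p T f powr p))"
    proof (rule ennreal_leI)
      let ?x = "X_norm D A \<alpha> p u\<^sub>0 powr p" and ?y = "Lp_norm p T f powr p"
      have "C1 * ?x + C2 * ?y \<le> (C1 + C2) * (?x + ?y)"
        using C1(1) C2(1) by (simp add: algebra_simps)
      then show "k * (C1 * ?x + C2 * ?y) \<le> k * (C1 + C2) * (?x + ?y)"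
        using k by (simp add: mult.assoc mult_left_mono)
    qed
    finally show ?thesis .
  qed
  then show ?thesis using k C1(1) C2(1) by (intro that[of "k * (C1 + C2)"]) auto
qed

text \<open>The bound is uniform in N, so monotone convergence makes the sum of
  (\<open>lam n\<close> |\<open>cf\<close>|)^2 finite for almost every t. By
  \<open>dom_if_summable\<close> u(t) then lies in D, and Parseval's identity identifies the
  supremum with the norm of A u(t).\<close>

lemma solution_in_domain:
  assumes f: "f \<in> Lp_set p T" and B: "0 \<le> B"
    and bound: "\<And>N. l2int p T N (\<lambda>n t. lam n * cmod (cf u\<^sub>0 f n t)) \<le> ennreal B"
  defines "u \<equiv> solution_series \<phi> lam \<alpha> u\<^sub>0 f"
  shows "u \<in> Lp_dom_set p T D A" and "(\<lambda>t. A (u t)) \<in> Lp_set p T"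
    and "Lp_norm p T (\<lambda>t. A (u t)) powr p \<le> B"
proof -
  define S where "S N t = sqf N (\<lambda>n t. lam n * cmod (cf u\<^sub>0 f n t)) t" for N t
  have cfm [measurable]: "cf u\<^sub>0 f n \<in> borel_measurable borel" for n by (rule cf_measurable[OF f])
  have [measurable]: "S N \<in> borel_measurable borel" for N unfolding S_def[abs_def] by measurable
  have co_u: "co n (u t) = cf u\<^sub>0 f n t" if "0 < t" "t < T" for n t
    unfolding u_def by (rule co_solution[OF f that])
  define G where "G N t = ennreal (S N t powr (p / 2)) * indicator {0<..<T} t" for N t
  have [measurable]: "G N \<in> borel_measurable borel" for N unfolding G_def[abs_def] by measurable
  have Smono: "S M t \<le> S N t" if "M \<le> N" for M N t
    unfolding S_def sqf_def using that by (intro sum_mono2) auto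
  have S0: "0 \<le> S N t" for N t by (simp add: S_def)
  have "incseq G"
    unfolding incseq_def le_fun_def G_def using p
    by (auto intro!: mult_right_mono ennreal_leI powr_mono2 Smono simp: S0)
  then have "(\<integral>\<^sup>+t. (SUP N. G N t) \<partial>lborel) = (SUP N. \<integral>\<^sup>+t. G N t \<partial>lborel)"
    by (intro nn_integral_monotone_convergence_SUP) auto
  also have "\<dots> \<le> ennreal B" unfolding G_def S_def by (intro SUP_least bound)
  finally have sup: "(\<integral>\<^sup>+t. (SUP N. G N t) \<partial>lborel) \<le> ennreal B" .
  then have "(\<integral>\<^sup>+t. (SUP N. G N t) \<partial>lborel) \<noteq> \<infinity>" by (auto simp: top_unique)
  then have "AE t in lborel. (SUP N. G N t) \<noteq> \<infinity>" by (intro nn_integral_noteq_infinite) auto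
  then have domAE: "AE t in lborel. 0 < t \<and> t < T \<longrightarrow> u t \<in> D"
  proof eventually_elim
    case (elim t)
    show ?case
    proof
      assume t: "0 < t \<and> t < T"
      obtain b where b: "(SUP N. G N t) = ennreal b" "0 \<le> b" using elim by (cases "SUP N. G N t") auto
      have "S N t \<le> b powr (2 / p)" for N
      proof -
        have "G N t \<le> ennreal b" unfolding b(1)[symmetric] by (rule SUP_upper) simp
        then have "S N t powr (p / 2) \<le> b" using t b by (simp add: G_def)
        then have "(S N t powr (p / 2)) powr (2 / p) \<le> b powr (2 / p)" using p by (intro powr_mono2) auto
        moreover have "(S N t powr (p / 2)) powr (2 / p) = S N t"
          using p by (simp add: powr_powr S_def)
        ultimately show ?thesis by simp
      qed
      from this[of "Suc N" for N]
      have "(\<Sum>n\<le>N. (lam n * cmod (cf u\<^sub>0 f n t))\<^sup>2) \<le> b powr (2 / p)" for N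
        by (simp only: S_def sqf_def lessThan_Suc_atMost)
      then have "summable (\<lambda>n. (lam n * cmod (cf u\<^sub>0 f n t))\<^sup>2)"
        by (intro bounded_imp_summable[where B="b powr (2 / p)"]) auto
      then show "u t \<in> D" using t by (intro dom_if_summable) (simp add: co_u)
    qed
  qed
  have um: "u \<in> borel_measurable (lebesgue_on {0<..<T})"
  proof -
    have "(\<lambda>t. \<Sum>n. cf u\<^sub>0 f n t *\<^sub>C \<phi> n) \<in> borel_measurable (lebesgue_on {0<..<T})"
      by (intro measurable_restrict_space1 measurable_completion) (simp; measurable)
    moreover have "u t = (\<Sum>n. cf u\<^sub>0 f n t *\<^sub>C \<phi> n)" if "t \<in> space (lebesgue_on {0<..<T})" for t
      using that by (simp add: u_def solution_series_def solution_coeff_eq[OF f] space_restrict_space)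
    ultimately show ?thesis by (simp only: measurable_cong[of "lebesgue_on {0<..<T}" u])
  qed
  \<comment> \<open>The values of \<open>A\<close> outside D are arbitrary, so the series represents
    A(u t) only almost everywhere.\<close>
  have Am: "(\<lambda>t. A (u t)) \<in> borel_measurable (lebesgue_on {0<..<T})"
  proof (rule borel_measurable_lebesgue_on_cong_AE)
    show "(\<lambda>t. \<Sum>n. (- of_real (lam n) * cf u\<^sub>0 f n t) *\<^sub>C \<phi> n) \<in> borel_measurable (lebesgue_on {0<..<T})"
      by (intro measurable_restrict_space1 measurable_completion) (simp; measurable)
    show "AE t in lebesgue_on {0<..<T}. (\<Sum>n. (- of_real (lam n) * cf u\<^sub>0 f n t) *\<^sub>C \<phi> n) = A (u t)"
      unfolding AE_lebesgue_on_Ioo using domAE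
    proof eventually_elim
      case (elim t)
      show ?case
      proof
        assume t: "0 < t \<and> t < T"
        then have "u t \<in> D" using elim by simp
        from sums_unique[OF A_sums[OF this]] t
        show "(\<Sum>n. (- of_real (lam n) * cf u\<^sub>0 f n t) *\<^sub>C \<phi> n) = A (u t)" by (simp add: co_u)
      qed
    qed
  qed simp
  have "(\<integral>\<^sup>+t. ennreal (norm (A (u t)) powr p) * indicator {0<..<T} t \<partial>lborel) \<le> (\<integral>\<^sup>+t. (SUP N. G N t) \<partial>lborel)"
  proof (rule nn_integral_mono_AE)
    show "AE t in lborel. ennreal (norm (A (u t)) powr p) * indicator {0<..<T} t \<le> (SUP N. G N t)"
      using domAE
    proof eventually_elim
      case (elim t)
      show ?case
      proof (cases "0 < t \<and> t < T")
        case True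
        then have "(\<lambda>n. (lam n * cmod (cf u\<^sub>0 f n t))\<^sup>2) sums (norm (A (u t)))\<^sup>2"
          using norm_A_sums[of "u t"] elim by (simp add: co_u)
        then have "(\<lambda>N. S N t) \<longlonglongrightarrow> (norm (A (u t)))\<^sup>2" by (simp add: sums_def S_def sqf_def)
        then have "(\<lambda>N. S N t powr (p / 2)) \<longlonglongrightarrow> ((norm (A (u t)))\<^sup>2) powr (p / 2)"
          using p by (intro tendsto_powr2) (auto simp: S_def)
        moreover have "((norm (A (u t)))\<^sup>2) powr (p / 2) = norm (A (u t)) powr p"
          by (cases "A (u t) = 0") (simp_all add: powr_powr flip: powr_numeral)
        ultimately have "(\<lambda>N. G N t) \<longlonglongrightarrow> ennreal (norm (A (u t)) powr p)"
          using True by (simp add: G_def tendsto_ennrealI)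
        then have "ennreal (norm (A (u t)) powr p) \<le> (SUP N. G N t)"
          by (rule LIMSEQ_le_const2) (auto intro!: exI[of _ 0] SUP_upper)
        then show ?thesis using True by simp
      qed auto
    qed
  qed
  also note sup
  finally have le: "(\<integral>\<^sup>+t. ennreal (norm (A (u t)) powr p) * indicator {0<..<T} t \<partial>lborel) \<le> ennreal B" .
  show ALp: "(\<lambda>t. A (u t)) \<in> Lp_set p T" and "Lp_norm p T (\<lambda>t. A (u t)) powr p \<le> B"
    using p by (auto intro!: Lp_set_if_nn_integral[OF Am _ le B])
  show "u \<in> Lp_dom_set p T D A"
    using um ALp domAE by (simp add: Lp_dom_set_def AE_lebesgue_on_Ioo)
qed

lemma Lp_set_add:
  fixes v w :: "real \<Rightarrow> 'a"
  assumes v: "v \<in> Lp_set p T" and w: "w \<in> Lp_set p T"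
  shows "(\<lambda>t. \<i> *\<^sub>C v t + w t) \<in> Lp_set p T"
    and "Lp_norm p T (\<lambda>t. \<i> *\<^sub>C v t + w t) powr p \<le> 2 powr p * (Lp_norm p T v powr p + Lp_norm p T w powr p)"
proof -
  have [measurable]: "v \<in> borel_measurable (lebesgue_on {0<..<T})" "w \<in> borel_measurable (lebesgue_on {0<..<T})"
    using v w by (auto simp: Lp_set_def)
  have m: "(\<lambda>t. \<i> *\<^sub>C v t + w t) \<in> borel_measurable (lebesgue_on {0<..<T})" by measurable
  have mp: "(\<lambda>t. ennreal (norm (v t) powr p)) \<in> borel_measurable (lebesgue_on {0<..<T})"
    "(\<lambda>t. ennreal (norm (w t) powr p)) \<in> borel_measurable (lebesgue_on {0<..<T})" by measurable
  have "(\<integral>\<^sup>+t. ennreal (norm (\<i> *\<^sub>C v t + w t) powr p) \<partial>lebesgue_on {0<..<T})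
    \<le> (\<integral>\<^sup>+t. ennreal (2 powr p) * (ennreal (norm (v t) powr p) + ennreal (norm (w t) powr p)) \<partial>lebesgue_on {0<..<T})"
  proof (rule nn_integral_mono)
    fix t
    have "norm (\<i> *\<^sub>C v t + w t) powr p \<le> (norm (v t) + norm (w t)) powr p"
      using p norm_triangle_ineq[of "\<i> *\<^sub>C v t" "w t"] by (intro powr_mono2) (auto simp: norm_scaleC)
    also have "\<dots> \<le> 2 powr p * (norm (v t) powr p + norm (w t) powr p)" using p by (intro powr_add_le) auto
    finally show "ennreal (norm (\<i> *\<^sub>C v t + w t) powr p) \<le> ennreal (2 powr p) * (ennreal (norm (v t) powr p) + ennreal (norm (w t) powr p))"
      by (simp add: ennreal_leI ennreal_mult'[symmetric] ennreal_plus[symmetric] del: ennreal_plus)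
  qed
  also have "\<dots> = ennreal (2 powr p) * ((\<integral>\<^sup>+t. ennreal (norm (v t) powr p) \<partial>lebesgue_on {0<..<T}) + (\<integral>\<^sup>+t. ennreal (norm (w t) powr p) \<partial>lebesgue_on {0<..<T}))"
    using mp by (simp add: nn_integral_cmult nn_integral_add)
  also have "\<dots> = ennreal (2 powr p * (Lp_norm p T v powr p + Lp_norm p T w powr p))"
    using p Lp_set_nn_integral[OF v] Lp_set_nn_integral[OF w]
    by (simp add: nn_integral_lebesgue_on ennreal_mult' ennreal_plus)
  finally have le: "(\<integral>\<^sup>+t. ennreal (norm (\<i> *\<^sub>C v t + w t) powr p) * indicator {0<..<T} t \<partial>lborel)
      \<le> ennreal (2 powr p * (Lp_norm p T v powr p + Lp_norm p T w powr p))"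
    by (simp add: nn_integral_lebesgue_on)
  show "(\<lambda>t. \<i> *\<^sub>C v t + w t) \<in> Lp_set p T"
    and "Lp_norm p T (\<lambda>t. \<i> *\<^sub>C v t + w t) powr p \<le> 2 powr p * (Lp_norm p T v powr p + Lp_norm p T w powr p)"
    using p by (auto intro!: Lp_set_if_nn_integral[OF m _ le])
qed

text \<open>The coefficients of g = \<i>A u + f are those of the right-hand side in
  \<open>cf_volterra\<close>, so u - u_0 and the fractional integral of g have the same coefficients
  almost everywhere.\<close>

lemma solution_eq_frac_integral:
  fixes u\<^sub>0 :: 'a
  assumes f: "f \<in> Lp_set p T"
  defines "u \<equiv> solution_series \<phi> lam \<alpha> u\<^sub>0 f"
  assumes dom: "u \<in> Lp_dom_set p T D A"
  defines "g \<equiv> \<lambda>t. \<i> *\<^sub>C A (u t) + f t"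
  shows "g \<in> Lp_set p T" "AE t in lebesgue_on {0<..<T}. u t - u\<^sub>0 = frac_integral \<alpha> g t"
proof -
  have Au: "(\<lambda>t. A (u t)) \<in> Lp_set p T" and uD: "AE t in lborel. 0 < t \<and> t < T \<longrightarrow> u t \<in> D"
    using dom by (auto simp: Lp_dom_set_def AE_lebesgue_on_Ioo)
  show g: "g \<in> Lp_set p T" unfolding g_def by (rule Lp_set_add[OF Au f])
  note [measurable] = rp_measurable[OF f] rp_measurable[OF g] cf_measurable[OF f]
  have co_u: "co n (u t) = cf u\<^sub>0 f n t" if "0 < t" "t < T" for n t
    unfolding u_def by (rule co_solution[OF f that])
  have "AE t in lborel. 0 < t \<and> t < T \<longrightarrow> co n (u t - u\<^sub>0) = co n (frac_integral \<alpha> g t)" for n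
  proof -
    let ?h = "\<lambda>t. if 0 < t \<and> t < T then z n * cf u\<^sub>0 f n t + rp f n t else 0"
    have "AE t in lborel. t < T \<longrightarrow> ?h t = rp g n t"
      using rp_AE[OF g, of n] rp_AE[OF f, of n] uD
    proof eventually_elim
      case (elim t)
      show ?case
      proof (cases "0 < t \<and> t < T")
        case True
        then show ?thesis using elim co_u[of t n]
          by (simp add: g_def cinner_add_left cinner_scaleC_left co_A z_def)
      next
        case False then show ?thesis using rp_nonpos[OF g, of t n] by auto
      qed
    qed
    then have "conv (gk T \<alpha>) ?h t = conv (gk T \<alpha>) (rp g n) t" if "t < T" for t
      using that by (intro conv_cong_right[where T=T]) auto
    then show ?thesis
      using cf_volterra[OF f, of u\<^sub>0 n]
      by (auto elim!: eventually_mono simp: cinner_diff_left co_u co_frac_integral[OF g])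
  qed
  then have "AE t in lborel. \<forall>n. 0 < t \<and> t < T \<longrightarrow> co n (u t - u\<^sub>0) = co n (frac_integral \<alpha> g t)"
    by (subst AE_all_countable) blast
  then show "AE t in lebesgue_on {0<..<T}. u t - u\<^sub>0 = frac_integral \<alpha> g t"
    unfolding AE_lebesgue_on_Ioo by eventually_elim (auto intro!: co_eqI)
qed

text \<open>Any solution satisfies the integrated equation, so in each mode its difference from the
  formula solves the homogeneous Volterra equation of \<open>volterra_unique\<close>.\<close>

lemma solution_unique:
  assumes f: "f \<in> Lp_set p T" and v: "is_solution D A \<alpha> p T u\<^sub>0 f v"
  shows "AE t in lebesgue_on {0<..<T}. v t = solution_series \<phi> lam \<alpha> u\<^sub>0 f t"
proof -
  define h where "h = frac_deriv \<alpha> p T (\<lambda>t. v t - u\<^sub>0)"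
  obtain g where "g \<in> Lp_set p T" "AE t in lebesgue_on {0<..<T}. v t - u\<^sub>0 = frac_integral \<alpha> g t"
    using v unfolding is_solution_def W_set_def by blast
  from frac_deriv_eq[OF this] have h: "h \<in> Lp_set p T"
    and vh: "AE t in lborel. 0 < t \<and> t < T \<longrightarrow> v t - u\<^sub>0 = frac_integral \<alpha> h t"
    unfolding h_def AE_lebesgue_on_Ioo by auto
  have vD: "AE t in lborel. 0 < t \<and> t < T \<longrightarrow> v t \<in> D"
    and eq: "AE t in lborel. 0 < t \<and> t < T \<longrightarrow> h t - \<i> *\<^sub>C A (v t) = f t"
    using v unfolding is_solution_def Lp_dom_set_def h_def AE_lebesgue_on_Ioo by auto
  note [measurable] = rp_measurable[OF f] rp_measurable[OF h] cf_measurable[OF f]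
  have g: "integrable lborel (gk T \<alpha>)" using \<alpha> by (intro gk_integrable) auto
  have "AE t in lborel. 0 < t \<and> t < T \<longrightarrow> co n (v t) = cf u\<^sub>0 f n t" for n
  proof -
    \<comment> \<open>Membership of \<open>v\<close> in \<open>Lp_set\<close> is not among the
      assumptions, so its coefficient obtains a Borel version from the integrated equation and not
      from \<open>rp\<close>.\<close>
    define r where "r t = co n u\<^sub>0 + conv (gk T \<alpha>) (rp h n) t" for t
    have [measurable]: "r \<in> borel_measurable borel" unfolding r_def by measurable
    have r: "AE t in lborel. 0 < t \<and> t < T \<longrightarrow> r t = co n (v t)"
      using vh
    proof eventually_elim
      case (elim t)
      show ?case
      proof
        assume t: "0 < t \<and> t < T"
        then have "co n (v t - u\<^sub>0) = conv (gk T \<alpha>) (rp h n) t"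
          using elim co_frac_integral[OF h, of t n] by simp
        then show "r t = co n (v t)" by (simp add: r_def cinner_diff_left algebra_simps)
      qed
    qed
    \<comment> \<open>The right-hand side belonging to the solution formula; \<open>rp h n\<close>
      minus \<open>c\<close> is z n times the difference \<open>d\<close>, which gives the
      homogeneous equation.\<close>
    define c where "c t = (if 0 < t \<and> t < T then z n * cf u\<^sub>0 f n t + rp f n t else 0)" for t
    define d where "d t = (if 0 < t \<and> t < T then r t - cf u\<^sub>0 f n t else 0)" for t
    have [measurable]: "c \<in> borel_measurable borel" "d \<in> borel_measurable borel"
      unfolding c_def d_def by measurable
    have cfi: "integrable lborel (cf u\<^sub>0 f n)"
      unfolding cf_def[abs_def] using \<alpha>
      by (intro Bochner_Integration.integrable_add integrable_mult_right ek_integrable conv_integrable rp_integrable[OF f]) auto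
    have cut: "integrable lborel (\<lambda>t. if 0 < t \<and> t < T then k t else 0)" if k: "integrable lborel k" for k :: "real \<Rightarrow> complex"
    proof (rule Bochner_Integration.integrable_bound[OF k])
      have [measurable]: "k \<in> borel_measurable borel" using k by auto
      show "(\<lambda>t. if 0 < t \<and> t < T then k t else 0) \<in> borel_measurable lborel" by measurable
    qed auto
    have ci: "integrable lborel c"
      unfolding c_def by (intro cut Bochner_Integration.integrable_add integrable_mult_right cfi rp_integrable[OF f])
    have di: "integrable lborel d"
    proof -
      have "integrable lborel (\<lambda>t. (if 0 < t \<and> t < T then conv (gk T \<alpha>) (rp h n) t - cf u\<^sub>0 f n t else 0) + co n u\<^sub>0 * gk T 1 t)"
        by (intro Bochner_Integration.integrable_add integrable_mult_right gk_integrable cut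
            Bochner_Integration.integrable_diff conv_integrable g rp_integrable[OF h] cfi) auto
      moreover have "(\<lambda>t. (if 0 < t \<and> t < T then conv (gk T \<alpha>) (rp h n) t - cf u\<^sub>0 f n t else 0) + co n u\<^sub>0 * gk T 1 t) = d"
        by (auto simp: d_def r_def gk_def rGamma_inverse_Gamma fun_eq_iff)
      ultimately show ?thesis by simp
    qed
    have rh: "AE t in lborel. t < T \<longrightarrow> rp h n t + - 1 * c t = z n * d t"
      using rp_AE[OF h, of n] rp_AE[OF f, of n] r vD eq
    proof eventually_elim
      case (elim t)
      show ?case
      proof (cases "0 < t \<and> t < T")
        case True
        then have "h t = \<i> *\<^sub>C A (v t) + f t" using elim(5) by (metis add.commute diff_add_cancel)
        then have "co n (h t) = z n * co n (v t) + co n (f t)"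
          using True elim(4) by (simp add: cinner_add_left cinner_scaleC_left co_A z_def)
        then show ?thesis using True elim(1-3) by (simp add: c_def d_def algebra_simps)
      next
        case False
        then show ?thesis using rp_nonpos[OF h, of t n] by (auto simp: c_def d_def)
      qed
    qed
    have "AE t in lborel. d t = 0"
    proof (rule volterra_unique[OF \<alpha> T di, of "z n"])
      show "d t = 0" if "t \<notin> {0<..<T}" for t using that by (auto simp: d_def)
      have ci': "integrable lborel (\<lambda>t. - 1 * c t)" using ci by simp
      show "AE t in lborel. 0 < t \<and> t < T \<longrightarrow> d t = z n * conv (gk T \<alpha>) d t"
        using cf_volterra[OF f, of u\<^sub>0 n] conv_integrable_AE[OF g rp_integrable[OF h, of n]] conv_integrable_AE[OF g ci']
      proof eventually_elim
        case (elim t)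
        show ?case
        proof
          assume t: "0 < t \<and> t < T"
          have "d t = conv (gk T \<alpha>) (rp h n) t + - 1 * conv (gk T \<alpha>) c t"
            using elim(1) t by (simp add: d_def r_def c_def[abs_def] algebra_simps)
          also have "\<dots> = conv (gk T \<alpha>) (\<lambda>t. rp h n t + - 1 * c t) t"
            unfolding conv_cmult_right[symmetric] by (rule conv_add_right[OF elim(2,3), symmetric])
          also have "\<dots> = conv (gk T \<alpha>) (\<lambda>t. z n * d t) t"
            using t by (intro conv_cong_right[OF rh]) auto
          finally show "d t = z n * conv (gk T \<alpha>) d t" by (simp add: conv_cmult_right)
        qed
      qed
    qed
    then show ?thesis using r by eventually_elim (auto simp: d_def)
  qed
  then have "AE t in lborel. \<forall>n. 0 < t \<and> t < T \<longrightarrow> co n (v t) = cf u\<^sub>0 f n t"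
    by (subst AE_all_countable) blast
  then show ?thesis
    unfolding AE_lebesgue_on_Ioo
    by eventually_elim (auto intro!: co_eqI simp: co_solution[OF f])
qed

text \<open>The fractional derivative of u - u_0 is \<i>A u + f almost everywhere, so its norm is
  controlled by the norm of A u and that of f; only the estimate of A u needs the kernel
  analysis.\<close>

lemma maximal_regularity:
  "\<exists>C>0. \<forall>u\<^sub>0\<in>X_set D A \<alpha> p. \<forall>f\<in>Lp_set p T.
     let u = solution_series \<phi> lam \<alpha> u\<^sub>0 f in
       (\<forall>t\<in>{0<..<T}. (\<lambda>n. solution_coeff \<phi> lam \<alpha> u\<^sub>0 f n t *\<^sub>C \<phi> n) sums u t) \<and>
       is_solution D A \<alpha> p T u\<^sub>0 f u \<and>
       (\<forall>v. is_solution D A \<alpha> p T u\<^sub>0 f v \<longrightarrow> (AE t in lebesgue_on {0<..<T}. v t = u t)) \<and>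
       (\<lambda>t. u t - u\<^sub>0) \<in> W_set \<alpha> p T \<and>
       u \<in> Lp_dom_set p T D A \<and>
       W_norm \<alpha> p T (\<lambda>t. u t - u\<^sub>0) + Lp_dom_norm p T A u
         \<le> C * (X_norm D A \<alpha> p u\<^sub>0 + Lp_norm p T f)"
proof -
  obtain C where C: "0 \<le> C" "\<And>u\<^sub>0 f N. u\<^sub>0 \<in> X_set D A \<alpha> p \<Longrightarrow> f \<in> Lp_set p T \<Longrightarrow>
     l2int p T N (\<lambda>n t. lam n * cmod (cf u\<^sub>0 f n t))
       \<le> ennreal (C * (X_norm D A \<alpha> p u\<^sub>0 powr p + Lp_norm p T f powr p))"
    using combined_estimate by blast
  define C1 where "C1 = (2 * C) powr (1 / p)"
  define C2 where "C2 = (2 * 2 powr p) powr (1 / p)"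
  have C12: "0 \<le> C1" "0 \<le> C2" by (auto simp: C1_def C2_def)
  show ?thesis
  \<comment> \<open>C1 is the constant for A u, and C2 that of the quasi-triangle inequality for
    \<i>A u + f, both after taking p-th roots by \<open>powr_le_root\<close>. The first product
    bounds the \<open>W_norm\<close>, the next summand the norm in D(A), and the final 1 only
    ensures positivity.\<close>
  proof (intro exI[of _ "C2 * (C1 + 1) + C1 + 1"] conjI ballI)
    show "0 < C2 * (C1 + 1) + C1 + 1" using C12 by (simp add: add_nonneg_pos)
    fix u\<^sub>0 :: 'a and f :: "real \<Rightarrow> 'a" assume u0: "u\<^sub>0 \<in> X_set D A \<alpha> p" and f: "f \<in> Lp_set p T"
    define u where "u = solution_series \<phi> lam \<alpha> u\<^sub>0 f"
    define x where "x = X_norm D A \<alpha> p u\<^sub>0"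
    define y where "y = Lp_norm p T f"
    have xy: "0 \<le> x" "0 \<le> y" by (auto simp: x_def y_def X_norm_def interp_norm_def)
    have B: "0 \<le> C * (x powr p + y powr p)" using C by simp
    note dom = solution_in_domain[OF f B C(2)[OF u0 f, folded x_def y_def], folded u_def]
    define g where "g t = \<i> *\<^sub>C A (u t) + f t" for t
    have g: "g \<in> Lp_set p T" and ug: "AE t in lebesgue_on {0<..<T}. u t - u\<^sub>0 = frac_integral \<alpha> g t"
      using solution_eq_frac_integral[OF f, of u\<^sub>0] dom(1) unfolding u_def[symmetric] g_def[abs_def] by auto
    define \<delta> where "\<delta> = frac_deriv \<alpha> p T (\<lambda>t. u t - u\<^sub>0)"
    have \<delta>: "\<delta> \<in> Lp_set p T" "AE t in lebesgue_on {0<..<T}. \<delta> t = g t"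
      unfolding \<delta>_def using frac_deriv_eq[OF g ug] by auto
    have W: "(\<lambda>t. u t - u\<^sub>0) \<in> W_set \<alpha> p T" unfolding W_set_def using g ug by blast
    have sol: "is_solution D A \<alpha> p T u\<^sub>0 f u"
      unfolding is_solution_def \<delta>_def[symmetric] using W dom(1) \<delta>(2)
      by (auto elim!: eventually_mono simp: g_def)
    define a where "a = Lp_norm p T (\<lambda>t. A (u t))"
    have a: "0 \<le> a" "a \<le> C1 * (x + y)"
      using powr_le_root[of a x y C p] dom(3) xy C(1) p by (auto simp: a_def C1_def)
    have "Lp_norm p T g \<le> C2 * (a + y)"
      using Lp_set_add(2)[OF dom(2) f] p a(1) xy
      unfolding C2_def by (intro powr_le_root) (auto simp: g_def[abs_def] a_def y_def)
    also have "\<dots> \<le> C2 * ((C1 + 1) * (x + y))"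
      using a xy C12 by (intro mult_left_mono) (auto simp: algebra_simps)
    finally have ng: "Lp_norm p T g \<le> C2 * ((C1 + 1) * (x + y))" .
    have "W_norm \<alpha> p T (\<lambda>t. u t - u\<^sub>0) = Lp_norm p T g"
      unfolding W_norm_def \<delta>_def[symmetric] using \<delta> g by (intro Lp_norm_cong_AE) (auto simp: Lp_set_def)
    then have "W_norm \<alpha> p T (\<lambda>t. u t - u\<^sub>0) + Lp_dom_norm p T A u \<le> C2 * ((C1 + 1) * (x + y)) + C1 * (x + y)"
      using ng a by (simp add: Lp_dom_norm_def a_def)
    also have "\<dots> \<le> (C2 * (C1 + 1) + C1 + 1) * (x + y)"
      using xy by (simp add: algebra_simps)
    finally have bound: "W_norm \<alpha> p T (\<lambda>t. u t - u\<^sub>0) + Lp_dom_norm p T A u \<le> (C2 * (C1 + 1) + C1 + 1) * (x + y)" .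
    show "let u = solution_series \<phi> lam \<alpha> u\<^sub>0 f in
       (\<forall>t\<in>{0<..<T}. (\<lambda>n. solution_coeff \<phi> lam \<alpha> u\<^sub>0 f n t *\<^sub>C \<phi> n) sums u t) \<and>
       is_solution D A \<alpha> p T u\<^sub>0 f u \<and>
       (\<forall>v. is_solution D A \<alpha> p T u\<^sub>0 f v \<longrightarrow> (AE t in lebesgue_on {0<..<T}. v t = u t)) \<and>
       (\<lambda>t. u t - u\<^sub>0) \<in> W_set \<alpha> p T \<and>
       u \<in> Lp_dom_set p T D A \<and>
       W_norm \<alpha> p T (\<lambda>t. u t - u\<^sub>0) + Lp_dom_norm p T A u
         \<le> (C2 * (C1 + 1) + C1 + 1) * (X_norm D A \<alpha> p u\<^sub>0 + Lp_norm p T f)"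
      unfolding Let_def u_def[symmetric] x_def[symmetric] y_def[symmetric]
      using solution_series_sums[OF f, of _ u\<^sub>0, folded u_def] sol solution_unique[OF f, of u\<^sub>0, folded u_def] W dom(1) bound
      by auto
  qed
qed

end

text \<open>The \<open>sums\<close> clause is stated separately because an infinite sum has an
  unspecified value when it diverges. The clause on \<open>v\<close> justifies calling the formula
  the solution.\<close>

theorem theorem4p8:
  fixes D :: "'a::{complex_hilbert, second_countable_topology} set"
    and A :: "'a \<Rightarrow> 'a"
    and \<phi> :: "nat \<Rightarrow> 'a"
    and lam :: "nat \<Rightarrow> real"
    and \<alpha> p T :: real
  assumes "selfadjoint D A"
    and "negative_definite D A"
    and "compact_resolvent D A"
    and "orthonormal_basis \<phi>"
    and "\<And>n. \<phi> n \<in> D"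
    and "\<And>n. A (\<phi> n) = - (lam n *\<^sub>R \<phi> n)"
    and "0 < lam 0"
    and "incseq lam"
    and "filterlim lam at_top sequentially"
    and "0 < \<alpha>" and "\<alpha> < 1"
    and "1 < p"
    and "1 / p < \<alpha>"
    and "0 < T"
  shows "\<exists>C>0. \<forall>u\<^sub>0\<in>X_set D A \<alpha> p. \<forall>f\<in>Lp_set p T.
           let u = solution_series \<phi> lam \<alpha> u\<^sub>0 f in
             (\<forall>t\<in>{0<..<T}. (\<lambda>n. solution_coeff \<phi> lam \<alpha> u\<^sub>0 f n t *\<^sub>C \<phi> n) sums u t) \<and>
             is_solution D A \<alpha> p T u\<^sub>0 f u \<and>
             (\<forall>v. is_solution D A \<alpha> p T u\<^sub>0 f v \<longrightarrow> (AE t in lebesgue_on {0<..<T}. v t = u t)) \<and>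
             (\<lambda>t. u t - u\<^sub>0) \<in> W_set \<alpha> p T \<and>
             u \<in> Lp_dom_set p T D A \<and>
             W_norm \<alpha> p T (\<lambda>t. u t - u\<^sub>0) + Lp_dom_norm p T A u
               \<le> C * (X_norm D A \<alpha> p u\<^sub>0 + Lp_norm p T f)"
proof -
  have "0 < lam n" for n
    using assms(7) incseqD[OF assms(8), of 0 n] by simp
  then interpret fractional_setting \<phi> D A lam \<alpha> p T
    using assms by unfold_locales auto
  show ?thesis by (rule maximal_regularity)
qed

end
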